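(* Let $\mathcal B$ be a pivotal bicategory whose categories of 1-morphisms are idempotent complete, and let $X\in\mathcal B(a,b)$ have invertible right quantum dimension $\dim_{\mathrm r}(X)\in\mathrm{End}(I_b)$. Then $A:=X^\dagger\otimes X$ is a symmetric separable Frobenius algebra in $\mathcal B(a,a)$, and $X:(a,A)\rightleftarrows(b,I_b):X^\dagger$ is an adjoint equivalence in the equivariant completion $\mathcal B_{\mathrm{eq}}$.
   Context: Conventions: in a bicategory $\mathcal B$ the composite of $X\in\mathcal B(a,b)$ and $Y\in\mathcal B(b,c)$ is $Y\otimes X\in\mathcal B(a,c)$; $I_a$ is the unit 1-morphism; associators and unitors are suppressed. Pivotal bicategory: every $X\in\mathcal B(a,b)$ comes with a chosen $X^\dagger={}^\dagger X\in\mathcal B(b,a)$ and adjunction maps $\mathrm{ev}_X:X^\dagger\otimes X\to I_a$, $\mathrm{coev}_X:I_b\to X\otimes X^\dagger$ (for $X^\dagger\dashv X$) and $\widetilde{\mathrm{ev}}_X:X\otimes X^\dagger\to I_b$, $\widetilde{\mathrm{coev}}_X:I_a\to X^\dagger\otimes X$ (for $X\dashv X^\dagger$), such that for all $\phi:Z\to X$ one has $(1_{Z^\dagger}\otimes\widetilde{\mathrm{ev}}_X)(1\otimes\phi\otimes1)(\widetilde{\mathrm{coev}}_Z\otimes1_{X^\dagger})=(\mathrm{ev}_X\otimes1_{Z^\dagger})(1\otimes\phi\otimes1)(1_{X^\dagger}\otimes\mathrm{coev}_Z)$, and for all composable $X,Y$ the two maps $(Y\otimes X)^\dagger\to X^\dagger\otimes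 Y^\dagger$ obtained from $(\widetilde{\mathrm{coev}}_X,\widetilde{\mathrm{coev}}_Y,\widetilde{\mathrm{ev}}_{Y\otimes X})$ and from $(\mathrm{coev}_X,\mathrm{coev}_Y,\mathrm{ev}_{Y\otimes X})$ agree. The right quantum dimension is $\dim_{\mathrm r}(X)=\widetilde{\mathrm{ev}}_X\circ\mathrm{coev}_X\in\mathrm{End}(I_b)$. Algebras: an algebra in $\mathcal B(a,a)$ is $A$ with associative $\mu:A\otimes A\to A$ and unit $\eta:I_a\to A$; a coalgebra dually has $\Delta,\varepsilon$. $A$ with both is Frobenius if $(1_A\otimes\mu)(\Delta\otimes 1_A)=\Delta\mu=(\mu\otimes 1_A)(1_A\otimes\Delta)$; separable if $\mu\Delta=1_A$; symmetric if $(\varepsilon\mu\otimes1_{A^\dagger})(1_A\otimes\mathrm{coev}_A)=(1_{A^\dagger}\otimes\varepsilon\mu)(\widetilde{\mathrm{coev}}_A\otimes1_A)$ as maps $A\to A^\dagger$. Structure on $A=X^\dagger\otimes X$: multiplication $1_{X^\dagger}\otimes\widetilde{\mathrm{ev}}_X\otimes1_X$, unit $\widetilde{\mathrm{coev}}_X$, comultiplication $1_{X^\dagger}\otimes(\mathrm{coev}_X\circ\dim_{\mathrm r}(X)^{-1})\otimes1_X$, counit $\mathrm{ev}_X\circ(1_{X^\dagger}\otimes\dim_{\mathrm r}(X)\otimes1_X)$ (using $X^\dagger\otimes I_b\otimes X\cong X^\dagger\otimes X$). $X$ is a right and $X^\dagger$ a left $A$-module via $\widetilde{\mathrm{ev}}_X$.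 Equivariant completion $\mathcal B_{\mathrm{eq}}$: objects are pairs $(a,A)$ with $A\in\mathcal B(a,a)$ a separable Frobenius algebra; 1-morphisms $(a,A)\to(b,B)$ are $B$-$A$-bimodules in $\mathcal B(a,b)$; 2-morphisms are bimodule maps; composition of $X:(a,A)\to(b,B)$ and $Y:(b,B)\to(c,C)$ is the relative tensor product $Y\otimes_BX$ (coequaliser of $Y\otimes B\otimes X\rightrightarrows Y\otimes X$); the unit of $(a,A)$ is $A$. *)

theory Defs
  imports Main
begin

section \<open>Bicategories\<close>

text \<open>
  Composition is written right to left, as for functions: for \<open>X : a \<rightarrow> b\<close> and \<open>Y : b \<rightarrow> c\<close>
  the composite is \<open>Y \<otimes> X : a \<rightarrow> c\<close>. Associators and unitors are kept explicit:
  \<open>\<alpha> Z Y X : (Z \<otimes> Y) \<otimes> X \<Rightarrow> Z \<otimes> (Y \<otimes> X)\<close>, \<open>lun X : I b \<otimes> X \<Rightarrow> X\<close>, \<open>run X : X \<otimes> I a \<Rightarrow> X\<close>.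
  The operations are total functions whose values matter only on composable arguments in the
  carriers.
\<close>

record ('o, 'm, 'c) bicat =
  Obj :: "'o set"
  Mor1 :: "'m set"
  src1 :: "'m \<Rightarrow> 'o"
  trg1 :: "'m \<Rightarrow> 'o"
  Mor2 :: "'c set"
  dom2 :: "'c \<Rightarrow> 'm"
  cod2 :: "'c \<Rightarrow> 'm"
  id2 :: "'m \<Rightarrow> 'c"  (\<open>\<^bold>1\<index>\<close>)
  comp2 :: "'c \<Rightarrow> 'c \<Rightarrow> 'c"  (infixr \<open>\<cdot>\<index>\<close> 60)
  unit1 :: "'o \<Rightarrow> 'm"  (\<open>\<I>\<index>\<close>)
  tens1 :: "'m \<Rightarrow> 'm \<Rightarrow> 'm"  (infixr \<open>\<otimes>\<index>\<close> 75)
  tens2 :: "'c \<Rightarrow> 'c \<Rightarrow> 'c"  (infixr \<open>\<star>\<index>\<close> 70)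
  assoc :: "'m \<Rightarrow> 'm \<Rightarrow> 'm \<Rightarrow> 'c"  (\<open>\<alpha>\<index>\<close>)
  lun :: "'m \<Rightarrow> 'c"  (\<open>\<l>\<index>\<close>)
  run :: "'m \<Rightarrow> 'c"  (\<open>\<r>\<index>\<close>)

context
  fixes B :: "('o, 'm, 'c, 'x) bicat_scheme" (structure)
begin

definition hom1 :: "'o \<Rightarrow> 'o \<Rightarrow> 'm set" where
  "hom1 a b = {X \<in> Mor1 B. src1 B X = a \<and> trg1 B X = b}"

definition hom2 :: "'m \<Rightarrow> 'm \<Rightarrow> 'c set" where
  "hom2 X Y = {\<phi> \<in> Mor2 B. dom2 B \<phi> = X \<and> cod2 B \<phi> = Y}"

definition inverse2 :: "'c \<Rightarrow> 'c \<Rightarrow> bool" where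
  "inverse2 \<phi> \<psi> \<longleftrightarrow> \<phi> \<in> Mor2 B \<and> \<psi> \<in> hom2 (cod2 B \<phi>) (dom2 B \<phi>) \<and>
     \<psi> \<cdot> \<phi> = \<^bold>1 (dom2 B \<phi>) \<and> \<phi> \<cdot> \<psi> = \<^bold>1 (cod2 B \<phi>)"

definition invertible2 :: "'c \<Rightarrow> bool" where
  "invertible2 \<phi> \<longleftrightarrow> (\<exists>\<psi>. inverse2 \<phi> \<psi>)"

definition inv2 :: "'c \<Rightarrow> 'c" where
  "inv2 \<phi> = (THE \<psi>. inverse2 \<phi> \<psi>)"

definition idempotent_complete :: bool where
  "idempotent_complete \<longleftrightarrow>
     (\<forall>X \<in> Mor1 B. \<forall>e \<in> hom2 X X. e \<cdot> e = e \<longrightarrow>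
        (\<exists>Y \<in> Mor1 B. \<exists>p \<in> hom2 X Y. \<exists>i \<in> hom2 Y X. p \<cdot> i = \<^bold>1 Y \<and> i \<cdot> p = e))"

text \<open>
  For \<open>\<eta> : I \<Rightarrow> W \<otimes> Z\<close>, \<open>\<phi> : Z \<Rightarrow> X\<close>, \<open>\<epsilon> : X \<otimes> V \<Rightarrow> I\<close>, \<open>zigL W V \<eta> \<phi> \<epsilon> : V \<Rightarrow> W\<close> is
  \<open>(1\<^sub>W \<otimes> \<epsilon>) (1\<^sub>W \<otimes> \<phi> \<otimes> 1\<^sub>V) (\<eta> \<otimes> 1\<^sub>V)\<close>. For \<open>\<eta> : I \<Rightarrow> Z \<otimes> W\<close>, \<open>\<phi> : Z \<Rightarrow> X\<close>, \<open>\<epsilon> : V \<otimes> X \<Rightarrow> I\<close>,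
  \<open>zigR W V \<eta> \<phi> \<epsilon> : V \<Rightarrow> W\<close> is the mirror image \<open>(\<epsilon> \<otimes> 1\<^sub>W) (1\<^sub>V \<otimes> \<phi> \<otimes> 1\<^sub>W) (1\<^sub>V \<otimes> \<eta>)\<close>.
\<close>

definition zigL :: "'m \<Rightarrow> 'm \<Rightarrow> 'c \<Rightarrow> 'c \<Rightarrow> 'c \<Rightarrow> 'c" where
  "zigL W V \<eta> \<phi> \<epsilon> =
     \<r> W \<cdot> (\<^bold>1 W \<star> \<epsilon>) \<cdot> \<alpha> W (cod2 B \<phi>) V \<cdot> ((\<^bold>1 W \<star> \<phi>) \<star> \<^bold>1 V) \<cdot> (\<eta> \<star> \<^bold>1 V) \<cdot> inv2 (\<l> V)"

definition zigR :: "'m \<Rightarrow> 'm \<Rightarrow> 'c \<Rightarrow> 'c \<Rightarrow> 'c \<Rightarrow> 'c" where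
  "zigR W V \<eta> \<phi> \<epsilon> =
     \<l> W \<cdot> (\<epsilon> \<star> \<^bold>1 W) \<cdot> inv2 (\<alpha> V (cod2 B \<phi>) W) \<cdot> (\<^bold>1 V \<star> (\<phi> \<star> \<^bold>1 W)) \<cdot> (\<^bold>1 V \<star> \<eta>) \<cdot> inv2 (\<r> V)"

text \<open>\<open>L \<stileturn> R\<close> with unit \<open>\<eta>\<close>, counit \<open>\<epsilon>\<close> and the two triangle identities.\<close>

definition adjunction :: "'o \<Rightarrow> 'o \<Rightarrow> 'm \<Rightarrow> 'm \<Rightarrow> 'c \<Rightarrow> 'c \<Rightarrow> bool" where
  "adjunction a b L R \<eta> \<epsilon> \<longleftrightarrow>
     L \<in> hom1 a b \<and> R \<in> hom1 b a \<and> \<eta> \<in> hom2 (\<I> a) (R \<otimes> L) \<and> \<epsilon> \<in> hom2 (L \<otimes> R) (\<I> b) \<and>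
     zigR L L \<eta> (\<^bold>1 R) \<epsilon> = \<^bold>1 L \<and> zigL R R \<eta> (\<^bold>1 L) \<epsilon> = \<^bold>1 R"

definition adjoint_equivalence :: "'o \<Rightarrow> 'o \<Rightarrow> 'm \<Rightarrow> 'm \<Rightarrow> bool" where
  "adjoint_equivalence a b L R \<longleftrightarrow>
     (\<exists>\<eta> \<epsilon>. adjunction a b L R \<eta> \<epsilon> \<and> invertible2 \<eta> \<and> invertible2 \<epsilon>)"

text \<open>
  Coequalisers in the category of 1-morphisms containing the codomain of \<open>f\<close> and \<open>g\<close>;
  the coequaliser object is the codomain of \<open>\<pi>\<close>.
\<close>

definition coequaliser :: "'c \<Rightarrow> 'c \<Rightarrow> 'c \<Rightarrow> bool" where
  "coequaliser f g \<pi> \<longleftrightarrow>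
     \<pi> \<in> Mor2 B \<and> dom2 B \<pi> = cod2 B f \<and> \<pi> \<cdot> f = \<pi> \<cdot> g \<and>
     (\<forall>h \<in> Mor2 B. dom2 B h = cod2 B f \<and> h \<cdot> f = h \<cdot> g \<longrightarrow>
        (\<exists>!k. k \<in> hom2 (cod2 B \<pi>) (cod2 B h) \<and> k \<cdot> \<pi> = h))"

text \<open>The factorisation of \<open>h\<close> through an epimorphism \<open>\<pi>\<close>.\<close>

definition factor2 :: "'c \<Rightarrow> 'c \<Rightarrow> 'c" where
  "factor2 \<pi> h = (THE k. k \<in> hom2 (cod2 B \<pi>) (cod2 B h) \<and> k \<cdot> \<pi> = h)"

end

locale bicategory =
  fixes B :: "('o, 'm, 'c, 'x) bicat_scheme" (structure)
  assumes src1_trg1: "X \<in> Mor1 B \<Longrightarrow> src1 B X \<in> Obj B \<and> trg1 B X \<in> Obj B"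
    and dom2_cod2: "\<phi> \<in> Mor2 B \<Longrightarrow>
      dom2 B \<phi> \<in> Mor1 B \<and> cod2 B \<phi> \<in> Mor1 B \<and>
      src1 B (dom2 B \<phi>) = src1 B (cod2 B \<phi>) \<and> trg1 B (dom2 B \<phi>) = trg1 B (cod2 B \<phi>)"
    and id2_hom: "X \<in> Mor1 B \<Longrightarrow> \<^bold>1 X \<in> hom2 B X X"
    and comp2_hom: "\<lbrakk>\<phi> \<in> hom2 B X Y; \<psi> \<in> hom2 B Y Z\<rbrakk> \<Longrightarrow> \<psi> \<cdot> \<phi> \<in> hom2 B X Z"
    and comp2_id: "\<phi> \<in> hom2 B X Y \<Longrightarrow> \<phi> \<cdot> \<^bold>1 X = \<phi>"
    and id_comp2: "\<phi> \<in> hom2 B X Y \<Longrightarrow> \<^bold>1 Y \<cdot> \<phi> = \<phi>"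
    and comp2_assoc: "\<lbrakk>\<phi> \<in> hom2 B W X; \<psi> \<in> hom2 B X Y; \<chi> \<in> hom2 B Y Z\<rbrakk> \<Longrightarrow>
      (\<chi> \<cdot> \<psi>) \<cdot> \<phi> = \<chi> \<cdot> (\<psi> \<cdot> \<phi>)"
    and unit1_hom: "a \<in> Obj B \<Longrightarrow> \<I> a \<in> hom1 B a a"
    and tens1_hom: "\<lbrakk>X \<in> hom1 B a b; Y \<in> hom1 B b c\<rbrakk> \<Longrightarrow> Y \<otimes> X \<in> hom1 B a c"
    and tens2_hom: "\<lbrakk>X \<in> hom1 B a b; Y \<in> hom1 B b c; \<phi> \<in> hom2 B X X'; \<psi> \<in> hom2 B Y Y'\<rbrakk> \<Longrightarrow>
      \<psi> \<star> \<phi> \<in> hom2 B (Y \<otimes> X) (Y' \<otimes> X')"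
    and tens2_id: "\<lbrakk>X \<in> hom1 B a b; Y \<in> hom1 B b c\<rbrakk> \<Longrightarrow> \<^bold>1 Y \<star> \<^bold>1 X = \<^bold>1 (Y \<otimes> X)"
    and interchange: "\<lbrakk>X \<in> hom1 B a b; Y \<in> hom1 B b c;
      \<phi> \<in> hom2 B X X'; \<phi>' \<in> hom2 B X' X''; \<psi> \<in> hom2 B Y Y'; \<psi>' \<in> hom2 B Y' Y''\<rbrakk> \<Longrightarrow>
      (\<psi>' \<cdot> \<psi>) \<star> (\<phi>' \<cdot> \<phi>) = (\<psi>' \<star> \<phi>') \<cdot> (\<psi> \<star> \<phi>)"
    and assoc_hom: "\<lbrakk>X \<in> hom1 B a b; Y \<in> hom1 B b c; Z \<in> hom1 B c d\<rbrakk> \<Longrightarrow>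
      \<alpha> Z Y X \<in> hom2 B ((Z \<otimes> Y) \<otimes> X) (Z \<otimes> (Y \<otimes> X)) \<and> invertible2 B (\<alpha> Z Y X)"
    and assoc_nat: "\<lbrakk>X \<in> hom1 B a b; Y \<in> hom1 B b c; Z \<in> hom1 B c d;
      \<phi> \<in> hom2 B X X'; \<psi> \<in> hom2 B Y Y'; \<chi> \<in> hom2 B Z Z'\<rbrakk> \<Longrightarrow>
      \<alpha> Z' Y' X' \<cdot> ((\<chi> \<star> \<psi>) \<star> \<phi>) = (\<chi> \<star> (\<psi> \<star> \<phi>)) \<cdot> \<alpha> Z Y X"
    and lun_hom: "X \<in> hom1 B a b \<Longrightarrow> \<l> X \<in> hom2 B (\<I> b \<otimes> X) X \<and> invertible2 B (\<l> X)"
    and lun_nat: "\<lbrakk>X \<in> hom1 B a b; \<phi> \<in> hom2 B X X'\<rbrakk> \<Longrightarrow> \<l> X' \<cdot> (\<^bold>1 (\<I> b) \<star> \<phi>) = \<phi> \<cdot> \<l> X"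
    and run_hom: "X \<in> hom1 B a b \<Longrightarrow> \<r> X \<in> hom2 B (X \<otimes> \<I> a) X \<and> invertible2 B (\<r> X)"
    and run_nat: "\<lbrakk>X \<in> hom1 B a b; \<phi> \<in> hom2 B X X'\<rbrakk> \<Longrightarrow> \<r> X' \<cdot> (\<phi> \<star> \<^bold>1 (\<I> a)) = \<phi> \<cdot> \<r> X"
    and pentagon: "\<lbrakk>X \<in> hom1 B a b; Y \<in> hom1 B b c; Z \<in> hom1 B c d; W \<in> hom1 B d e\<rbrakk> \<Longrightarrow>
      \<alpha> W Z (Y \<otimes> X) \<cdot> \<alpha> (W \<otimes> Z) Y X =
      (\<^bold>1 W \<star> \<alpha> Z Y X) \<cdot> \<alpha> W (Z \<otimes> Y) X \<cdot> (\<alpha> W Z Y \<star> \<^bold>1 X)"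
    and triangle: "\<lbrakk>X \<in> hom1 B a b; Y \<in> hom1 B b c\<rbrakk> \<Longrightarrow>
      (\<^bold>1 Y \<star> \<l> X) \<cdot> \<alpha> Y (\<I> b) X = \<r> Y \<star> \<^bold>1 X"

section \<open>Pivotal bicategories\<close>

record ('o, 'm, 'c) pivotal_bicat = "('o, 'm, 'c) bicat" +
  dual :: "'m \<Rightarrow> 'm"  (\<open>_\<^sup>\<dagger>\<index>\<close> [1000] 999)
  ev :: "'m \<Rightarrow> 'c"
  coev :: "'m \<Rightarrow> 'c"
  evt :: "'m \<Rightarrow> 'c"
  coevt :: "'m \<Rightarrow> 'c"

context
  fixes B :: "('o, 'm, 'c, 'x) pivotal_bicat_scheme" (structure)
begin

text \<open>
  The nested (co)evaluations \<open>I \<Rightarrow> (Y \<otimes> X) \<otimes> (X\<^sup>\<dagger> \<otimes> Y\<^sup>\<dagger>)\<close> and \<open>I \<Rightarrow> (X\<^sup>\<dagger> \<otimes> Y\<^sup>\<dagger>) \<otimes> (Y \<otimes> X)\<close>.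
\<close>

definition coev_nest :: "'m \<Rightarrow> 'm \<Rightarrow> 'c" where
  "coev_nest Y X =
     \<alpha> (Y \<otimes> X) (X\<^sup>\<dagger>) (Y\<^sup>\<dagger>) \<cdot> (inv2 B (\<alpha> Y X (X\<^sup>\<dagger>)) \<star> \<^bold>1 (Y\<^sup>\<dagger>)) \<cdot>
     ((\<^bold>1 Y \<star> coev B X) \<star> \<^bold>1 (Y\<^sup>\<dagger>)) \<cdot> (inv2 B (\<r> Y) \<star> \<^bold>1 (Y\<^sup>\<dagger>)) \<cdot> coev B Y"

definition coevt_nest :: "'m \<Rightarrow> 'm \<Rightarrow> 'c" where
  "coevt_nest Y X =
     inv2 B (\<alpha> (X\<^sup>\<dagger>) (Y\<^sup>\<dagger>) (Y \<otimes> X)) \<cdot> (\<^bold>1 (X\<^sup>\<dagger>) \<star> \<alpha> (Y\<^sup>\<dagger>) Y X) \<cdot>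
     (\<^bold>1 (X\<^sup>\<dagger>) \<star> (coevt B Y \<star> \<^bold>1 X)) \<cdot> (\<^bold>1 (X\<^sup>\<dagger>) \<star> inv2 B (\<l> X)) \<cdot> coevt B X"

text \<open>The right quantum dimension.\<close>

definition dim_r :: "'m \<Rightarrow> 'c" where
  "dim_r X = evt B X \<cdot> coev B X"

end

locale pivotal_bicategory = bicategory B
  for B :: "('o, 'm, 'c, 'x) pivotal_bicat_scheme" (structure) +
  assumes dual_hom: "X \<in> hom1 B a b \<Longrightarrow> X\<^sup>\<dagger> \<in> hom1 B b a"
    and adj_ev_coev: "X \<in> hom1 B a b \<Longrightarrow> adjunction B b a (X\<^sup>\<dagger>) X (coev B X) (ev B X)"
    and adj_evt_coevt: "X \<in> hom1 B a b \<Longrightarrow> adjunction B a b X (X\<^sup>\<dagger>) (coevt B X) (evt B X)"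
    and dual_mor: "\<lbrakk>Z \<in> hom1 B a b; X \<in> hom1 B a b; \<phi> \<in> hom2 B Z X\<rbrakk> \<Longrightarrow>
      zigL B (Z\<^sup>\<dagger>) (X\<^sup>\<dagger>) (coevt B Z) \<phi> (evt B X) = zigR B (Z\<^sup>\<dagger>) (X\<^sup>\<dagger>) (coev B Z) \<phi> (ev B X)"
    and dual_tens: "\<lbrakk>X \<in> hom1 B a b; Y \<in> hom1 B b c\<rbrakk> \<Longrightarrow>
      zigL B (X\<^sup>\<dagger> \<otimes> Y\<^sup>\<dagger>) ((Y \<otimes> X)\<^sup>\<dagger>) (coevt_nest B Y X) (\<^bold>1 (Y \<otimes> X)) (evt B (Y \<otimes> X)) =
      zigR B (X\<^sup>\<dagger> \<otimes> Y\<^sup>\<dagger>) ((Y \<otimes> X)\<^sup>\<dagger>) (coev_nest B Y X) (\<^bold>1 (Y \<otimes> X)) (ev B (Y \<otimes> X))"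

section \<open>Algebras, modules and bimodules\<close>

record ('m, 'c) alg =
  acar :: 'm
  mult :: 'c
  munit :: 'c
  comult :: 'c
  counit :: 'c

record ('o, 'm, 'c) bimod =
  bsrc :: "'o \<times> ('m, 'c) alg"
  btrg :: "'o \<times> ('m, 'c) alg"
  bcar :: 'm
  lact :: 'c
  ract :: 'c

record ('o, 'm, 'c) bimod_map =
  mdom :: "('o, 'm, 'c) bimod"
  mcod :: "('o, 'm, 'c) bimod"
  mfun :: 'c

context
  fixes B :: "('o, 'm, 'c, 'x) bicat_scheme" (structure)
begin

definition algebra :: "'o \<Rightarrow> ('m, 'c) alg \<Rightarrow> bool" where
  "algebra a A \<longleftrightarrow>
     (let M = acar A; \<mu> = mult A; \<eta> = munit A in
       M \<in> hom1 B a a \<and> \<mu> \<in> hom2 B (M \<otimes> M) M \<and> \<eta> \<in> hom2 B (\<I> a) M \<and>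
       \<mu> \<cdot> (\<mu> \<star> \<^bold>1 M) = \<mu> \<cdot> (\<^bold>1 M \<star> \<mu>) \<cdot> \<alpha> M M M \<and>
       \<mu> \<cdot> (\<eta> \<star> \<^bold>1 M) = \<l> M \<and> \<mu> \<cdot> (\<^bold>1 M \<star> \<eta>) = \<r> M)"

definition coalgebra :: "'o \<Rightarrow> ('m, 'c) alg \<Rightarrow> bool" where
  "coalgebra a A \<longleftrightarrow>
     (let M = acar A; \<Delta> = comult A; \<epsilon> = counit A in
       M \<in> hom1 B a a \<and> \<Delta> \<in> hom2 B M (M \<otimes> M) \<and> \<epsilon> \<in> hom2 B M (\<I> a) \<and>
       \<alpha> M M M \<cdot> (\<Delta> \<star> \<^bold>1 M) \<cdot> \<Delta> = (\<^bold>1 M \<star> \<Delta>) \<cdot> \<Delta> \<and>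
       \<l> M \<cdot> (\<epsilon> \<star> \<^bold>1 M) \<cdot> \<Delta> = \<^bold>1 M \<and> \<r> M \<cdot> (\<^bold>1 M \<star> \<epsilon>) \<cdot> \<Delta> = \<^bold>1 M)"

definition frobenius_algebra :: "'o \<Rightarrow> ('m, 'c) alg \<Rightarrow> bool" where
  "frobenius_algebra a A \<longleftrightarrow> algebra a A \<and> coalgebra a A \<and>
     (let M = acar A; \<mu> = mult A; \<Delta> = comult A in
       (\<^bold>1 M \<star> \<mu>) \<cdot> \<alpha> M M M \<cdot> (\<Delta> \<star> \<^bold>1 M) = \<Delta> \<cdot> \<mu> \<and>
       \<Delta> \<cdot> \<mu> = (\<mu> \<star> \<^bold>1 M) \<cdot> inv2 B (\<alpha> M M M) \<cdot> (\<^bold>1 M \<star> \<Delta>))"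

definition separable :: "('m, 'c) alg \<Rightarrow> bool" where
  "separable A \<longleftrightarrow> mult A \<cdot> comult A = \<^bold>1 (acar A)"

text \<open>The unit 1-morphism as an algebra; the bimodule structure of \<open>A\<close> over itself.\<close>

definition unit_alg :: "'o \<Rightarrow> ('m, 'c) alg" where
  "unit_alg a = \<lparr>acar = \<I> a, mult = \<l> (\<I> a), munit = \<^bold>1 (\<I> a),
     comult = inv2 B (\<l> (\<I> a)), counit = \<^bold>1 (\<I> a)\<rparr>"

definition regular_bimod :: "'o \<times> ('m, 'c) alg \<Rightarrow> ('o, 'm, 'c) bimod" where
  "regular_bimod p = \<lparr>bsrc = p, btrg = p, bcar = acar (snd p),
     lact = mult (snd p), ract = mult (snd p)\<rparr>"

text \<open>
  A bimodule with source \<open>(a, A)\<close> and target \<open>(b, C)\<close> is a \<open>C\<close>-\<open>A\<close>-bimodule in the category of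
  1-morphisms from \<open>a\<close> to \<open>b\<close>. Only the algebra parts of \<open>A\<close> and \<open>C\<close> enter.
\<close>

definition left_module :: "('m, 'c) alg \<Rightarrow> 'm \<Rightarrow> 'c \<Rightarrow> bool" where
  "left_module C X l \<longleftrightarrow>
     (let N = acar C in
       l \<in> hom2 B (N \<otimes> X) X \<and>
       l \<cdot> (mult C \<star> \<^bold>1 X) = l \<cdot> (\<^bold>1 N \<star> l) \<cdot> \<alpha> N N X \<and>
       l \<cdot> (munit C \<star> \<^bold>1 X) = \<l> X)"

definition right_module :: "('m, 'c) alg \<Rightarrow> 'm \<Rightarrow> 'c \<Rightarrow> bool" where
  "right_module A X r \<longleftrightarrow>
     (let M = acar A in
       r \<in> hom2 B (X \<otimes> M) X \<and>
       r \<cdot> (r \<star> \<^bold>1 M) = r \<cdot> (\<^bold>1 X \<star> mult A) \<cdot> \<alpha> X M M \<and>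
       r \<cdot> (\<^bold>1 X \<star> munit A) = \<r> X)"

definition bimodule :: "('o, 'm, 'c) bimod \<Rightarrow> bool" where
  "bimodule X \<longleftrightarrow>
     (let A = snd (bsrc X); C = snd (btrg X) in
       bcar X \<in> hom1 B (fst (bsrc X)) (fst (btrg X)) \<and>
       left_module C (bcar X) (lact X) \<and> right_module A (bcar X) (ract X) \<and>
       ract X \<cdot> (lact X \<star> \<^bold>1 (acar A)) =
         lact X \<cdot> (\<^bold>1 (acar C) \<star> ract X) \<cdot> \<alpha> (acar C) (bcar X) (acar A))"

definition bimodule_map :: "('o, 'm, 'c) bimod_map \<Rightarrow> bool" where
  "bimodule_map F \<longleftrightarrow>
     (let X = mdom F; Y = mcod F; f = mfun F in
       bsrc X = bsrc Y \<and> btrg X = btrg Y \<and> f \<in> hom2 B (bcar X) (bcar Y) \<and>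
       f \<cdot> lact X = lact Y \<cdot> (\<^bold>1 (acar (snd (btrg X))) \<star> f) \<and>
       f \<cdot> ract X = ract Y \<cdot> (f \<star> \<^bold>1 (acar (snd (bsrc X)))))"

section \<open>The equivariant completion\<close>

text \<open>
  The relative tensor product over the common algebra \<open>C\<close> is a chosen coequaliser of the two maps
  from \<open>(Y \<otimes> C) \<otimes> X\<close> to \<open>Y \<otimes> X\<close>; \<open>tens_proj Y X\<close> is its projection out of \<open>Y \<otimes> X\<close>. When
  \<open>C\<close> is a separable Frobenius algebra and the categories of 1-morphisms are idempotent complete,
  such coequalisers exist and are split, hence are preserved by composition with 1-morphisms.
\<close>

definition tens_proj :: "('o, 'm, 'c) bimod \<Rightarrow> ('o, 'm, 'c) bimod \<Rightarrow> 'c" where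
  "tens_proj Y X = (SOME \<pi>. coequaliser B
     (ract Y \<star> \<^bold>1 (bcar X))
     ((\<^bold>1 (bcar Y) \<star> lact X) \<cdot> \<alpha> (bcar Y) (acar (snd (bsrc Y))) (bcar X)) \<pi>)"

definition rel_tens :: "('o, 'm, 'c) bimod \<Rightarrow> ('o, 'm, 'c) bimod \<Rightarrow> ('o, 'm, 'c) bimod" where
  "rel_tens Y X =
     (let \<pi> = tens_proj Y X; C = acar (snd (btrg Y)); A = acar (snd (bsrc X)) in
       \<lparr>bsrc = bsrc X, btrg = btrg Y, bcar = cod2 B \<pi>,
        lact = factor2 B (\<^bold>1 C \<star> \<pi>)
          (\<pi> \<cdot> (lact Y \<star> \<^bold>1 (bcar X)) \<cdot> inv2 B (\<alpha> C (bcar Y) (bcar X))),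
        ract = factor2 B (\<pi> \<star> \<^bold>1 A)
          (\<pi> \<cdot> (\<^bold>1 (bcar Y) \<star> ract X) \<cdot> \<alpha> (bcar Y) (bcar X) A)\<rparr>)"

definition rel_tens_map ::
    "('o, 'm, 'c) bimod_map \<Rightarrow> ('o, 'm, 'c) bimod_map \<Rightarrow> ('o, 'm, 'c) bimod_map" where
  "rel_tens_map G F = \<lparr>mdom = rel_tens (mdom G) (mdom F), mcod = rel_tens (mcod G) (mcod F),
     mfun = factor2 B (tens_proj (mdom G) (mdom F))
       (tens_proj (mcod G) (mcod F) \<cdot> (mfun G \<star> mfun F))\<rparr>"

definition rel_assoc ::
    "('o, 'm, 'c) bimod \<Rightarrow> ('o, 'm, 'c) bimod \<Rightarrow> ('o, 'm, 'c) bimod \<Rightarrow> ('o, 'm, 'c) bimod_map" where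
  "rel_assoc Z Y X = \<lparr>mdom = rel_tens (rel_tens Z Y) X, mcod = rel_tens Z (rel_tens Y X),
     mfun = factor2 B
       (tens_proj (rel_tens Z Y) X \<cdot> (tens_proj Z Y \<star> \<^bold>1 (bcar X)))
       (tens_proj Z (rel_tens Y X) \<cdot> (\<^bold>1 (bcar Z) \<star> tens_proj Y X) \<cdot>
          \<alpha> (bcar Z) (bcar Y) (bcar X))\<rparr>"

definition rel_lun :: "('o, 'm, 'c) bimod \<Rightarrow> ('o, 'm, 'c) bimod_map" where
  "rel_lun X = \<lparr>mdom = rel_tens (regular_bimod (btrg X)) X, mcod = X,
     mfun = factor2 B (tens_proj (regular_bimod (btrg X)) X) (lact X)\<rparr>"

definition rel_run :: "('o, 'm, 'c) bimod \<Rightarrow> ('o, 'm, 'c) bimod_map" where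
  "rel_run X = \<lparr>mdom = rel_tens X (regular_bimod (bsrc X)), mcod = X,
     mfun = factor2 B (tens_proj X (regular_bimod (bsrc X))) (ract X)\<rparr>"

definition eq_obj :: "('o \<times> ('m, 'c) alg) set" where
  "eq_obj = {(a, A). a \<in> Obj B \<and> frobenius_algebra a A \<and> separable A}"

definition eq_mor1 :: "('o, 'm, 'c) bimod set" where
  "eq_mor1 = {X. bsrc X \<in> eq_obj \<and> btrg X \<in> eq_obj \<and> bimodule X}"

definition eq_completion ::
    "('o \<times> ('m, 'c) alg, ('o, 'm, 'c) bimod, ('o, 'm, 'c) bimod_map) bicat" where
  "eq_completion = \<lparr>
     Obj = eq_obj,
     Mor1 = eq_mor1,
     src1 = bsrc,
     trg1 = btrg,
     Mor2 = {F. mdom F \<in> eq_mor1 \<and> mcod F \<in> eq_mor1 \<and> bimodule_map F},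
     dom2 = mdom,
     cod2 = mcod,
     id2 = (\<lambda>X. \<lparr>mdom = X, mcod = X, mfun = \<^bold>1 (bcar X)\<rparr>),
     comp2 = (\<lambda>G F. \<lparr>mdom = mdom F, mcod = mcod G, mfun = mfun G \<cdot> mfun F\<rparr>),
     unit1 = regular_bimod,
     tens1 = rel_tens,
     tens2 = rel_tens_map,
     assoc = rel_assoc,
     lun = rel_lun,
     run = rel_run\<rparr>"

end

section \<open>The algebra \<open>X\<^sup>\<dagger> \<otimes> X\<close>\<close>

context
  fixes B :: "('o, 'm, 'c, 'x) pivotal_bicat_scheme" (structure)
begin

definition symmetric :: "('m, 'c) alg \<Rightarrow> bool" where
  "symmetric A \<longleftrightarrow>
     (let M = acar A; \<kappa> = counit A \<cdot> mult A in
       zigR B (M\<^sup>\<dagger>) M (coev B M) (\<^bold>1 M) \<kappa> = zigL B (M\<^sup>\<dagger>) M (coevt B M) (\<^bold>1 M) \<kappa>)"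

definition end_alg :: "'m \<Rightarrow> ('m, 'c) alg" where
  "end_alg X = \<lparr>
     acar = X\<^sup>\<dagger> \<otimes> X,
     mult = (\<^bold>1 (X\<^sup>\<dagger>) \<star> \<l> X) \<cdot> (\<^bold>1 (X\<^sup>\<dagger>) \<star> (evt B X \<star> \<^bold>1 X)) \<cdot>
       (\<^bold>1 (X\<^sup>\<dagger>) \<star> inv2 B (\<alpha> X (X\<^sup>\<dagger>) X)) \<cdot> \<alpha> (X\<^sup>\<dagger>) X (X\<^sup>\<dagger> \<otimes> X),
     munit = coevt B X,
     comult = inv2 B (\<alpha> (X\<^sup>\<dagger>) X (X\<^sup>\<dagger> \<otimes> X)) \<cdot> (\<^bold>1 (X\<^sup>\<dagger>) \<star> \<alpha> X (X\<^sup>\<dagger>) X) \<cdot>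
       (\<^bold>1 (X\<^sup>\<dagger>) \<star> ((coev B X \<cdot> inv2 B (dim_r B X)) \<star> \<^bold>1 X)) \<cdot> (\<^bold>1 (X\<^sup>\<dagger>) \<star> inv2 B (\<l> X)),
     counit = ev B X \<cdot> (\<^bold>1 (X\<^sup>\<dagger>) \<star> \<l> X) \<cdot> (\<^bold>1 (X\<^sup>\<dagger>) \<star> (dim_r B X \<star> \<^bold>1 X)) \<cdot>
       (\<^bold>1 (X\<^sup>\<dagger>) \<star> inv2 B (\<l> X))\<rparr>"

text \<open>\<open>X\<close> as a 1-morphism \<open>(a, X\<^sup>\<dagger> \<otimes> X) \<rightarrow> (b, I b)\<close>, and \<open>X\<^sup>\<dagger>\<close> as one in the other direction.\<close>

definition mod_of :: "'m \<Rightarrow> ('o, 'm, 'c) bimod" where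
  "mod_of X = \<lparr>
     bsrc = (src1 B X, end_alg X),
     btrg = (trg1 B X, unit_alg B (trg1 B X)),
     bcar = X,
     lact = \<l> X,
     ract = \<l> X \<cdot> (evt B X \<star> \<^bold>1 X) \<cdot> inv2 B (\<alpha> X (X\<^sup>\<dagger>) X)\<rparr>"

definition dual_mod_of :: "'m \<Rightarrow> ('o, 'm, 'c) bimod" where
  "dual_mod_of X = \<lparr>
     bsrc = (trg1 B X, unit_alg B (trg1 B X)),
     btrg = (src1 B X, end_alg X),
     bcar = X\<^sup>\<dagger>,
     lact = \<r> (X\<^sup>\<dagger>) \<cdot> (\<^bold>1 (X\<^sup>\<dagger>) \<star> evt B X) \<cdot> \<alpha> (X\<^sup>\<dagger>) X (X\<^sup>\<dagger>),
     ract = \<r> (X\<^sup>\<dagger>)\<rparr>"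

end

end

theory Submission
  imports Defs
begin

text \<open>
  Composition with \<open>X\<close> on the left is a functor \<open>F V = X \<otimes> V\<close> between categories of 1-morphisms, and
  composition with \<open>X\<^sup>\<dagger>\<close> is a functor \<open>G\<close> in the other direction. The (co)evaluations of \<open>X\<close> become
  natural transformations \<open>E : F G \<Rightarrow> 1\<close>, \<open>N : 1 \<Rightarrow> G F\<close>, \<open>C : 1 \<Rightarrow> F G\<close>, \<open>D : G F \<Rightarrow> 1\<close> that satisfy
  strict triangle identities, and \<open>A = X\<^sup>\<dagger> \<otimes> X\<close> becomes the monad \<open>G F\<close> with multiplication \<open>G E F\<close>
  and unit \<open>N\<close>. The dimension becomes a natural automorphism \<open>d = E C\<close> of the identity functor, so that
  \<open>K = C d\<^sup>-\<^sup>1\<close> is a natural section of \<open>E\<close> and the comultiplication is \<open>G K F\<close>. In this form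
  associativity, coassociativity and the Frobenius relations are naturality of \<open>E\<close> or \<open>K\<close>, the unit
  and counit laws are triangle identities, and separability is \<open>E K = 1\<close>. No associator or unitor is
  left. The relation \<open>represents\<close> makes the translation precise, and \<open>rep_faithful\<close> brings
  equations back to the bicategory.

  Symmetry compares two transposes \<open>A \<Rightarrow> A\<^sup>\<dagger>\<close> of the Frobenius form. After the identification of
  \<open>A\<^sup>\<dagger>\<close> with \<open>X\<^sup>\<dagger> \<otimes> X\<^sup>\<dagger>\<^sup>\<dagger>\<close>, each of them is \<open>X\<^sup>\<dagger>\<close> tensored with the dimension and a canonical map
  \<open>X \<Rightarrow> X\<^sup>\<dagger>\<^sup>\<dagger>\<close>. One such map is built from \<open>evt X\<close> and \<open>coev X\<^sup>\<dagger>\<close>, the other from \<open>coevt X\<^sup>\<dagger>\<close> and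
  \<open>ev X\<close>. The two maps agree (\<open>double_dual_mirror\<close>) because the 2-morphism \<open>evt X\<close> itself has only
  one transpose.
  To compare its transposes the two evaluations of the unit 1-morphism must coincide
  (\<open>unit_evaluations\<close>), which follows in turn because \<open>\<l> : I \<otimes> I \<Rightarrow> I\<close> has only one transpose.

  For the equivalence, relative tensor products are only determined up to isomorphism, so each is
  compared with a concrete model. Over the unit algebra nothing is identified, so \<open>X\<^sup>\<dagger> \<otimes> X = A\<close> is a
  model of the product of \<open>X\<^sup>\<dagger>\<close> and \<open>X\<close>. The map \<open>evt X : X \<otimes> X\<^sup>\<dagger> \<Rightarrow> I\<close> is split by
  \<open>coev X \<cdot> dim\<^sup>-\<^sup>1\<close> and is a split coequaliser of the two actions of \<open>A\<close>, so \<open>I\<close> is a model of the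
  product of \<open>X\<close> and \<open>X\<^sup>\<dagger>\<close> over \<open>A\<close>. These two comparisons are the (co)unit of the adjunction, and
  both are invertible. All composites in a triangle identity are again modelled by \<open>X\<close> or all by
  \<open>X\<^sup>\<dagger>\<close>, and every arrow between them is a quotient \<open>k'\<^sup>-\<^sup>1 k\<close> of comparison isomorphisms. The triangle
  identities therefore telescope.
\<close>

section \<open>Working in a bicategory\<close>

context bicategory
begin

abbreviation (input) Arr where "Arr \<equiv> Mor2 B"
abbreviation (input) Dom where "Dom \<equiv> dom2 B"
abbreviation (input) Cod where "Cod \<equiv> cod2 B"

text \<open>The axioms are restated with domains, codomains, sources and targets as functions and without
  quantified hom-sets, so that the simplifier can discharge all typing conditions by itself.\<close>

lemma mor1_obj [simp]:
  "X \<in> Mor1 B \<Longrightarrow> src1 B X \<in> Obj B"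
  "X \<in> Mor1 B \<Longrightarrow> trg1 B X \<in> Obj B"
  using src1_trg1 by auto

lemma mor2_mor1 [simp]:
  "\<phi> \<in> Arr \<Longrightarrow> Dom \<phi> \<in> Mor1 B"
  "\<phi> \<in> Arr \<Longrightarrow> Cod \<phi> \<in> Mor1 B"
  "\<phi> \<in> Arr \<Longrightarrow> src1 B (Cod \<phi>) = src1 B (Dom \<phi>)"
  "\<phi> \<in> Arr \<Longrightarrow> trg1 B (Cod \<phi>) = trg1 B (Dom \<phi>)"
  using dom2_cod2 by auto

lemma id2_simps [simp]:
  assumes "X \<in> Mor1 B"
  shows "\<^bold>1 X \<in> Arr" "Dom (\<^bold>1 X) = X" "Cod (\<^bold>1 X) = X"
  using id2_hom[OF assms] by (auto simp: hom2_def)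

lemma comp2_simps [simp]:
  assumes "\<phi> \<in> Arr" "\<psi> \<in> Arr" "Dom \<psi> = Cod \<phi>"
  shows "\<psi> \<cdot> \<phi> \<in> Arr" "Dom (\<psi> \<cdot> \<phi>) = Dom \<phi>" "Cod (\<psi> \<cdot> \<phi>) = Cod \<psi>"
  using comp2_hom[of \<phi> "Dom \<phi>" "Cod \<phi>" \<psi> "Cod \<psi>"] assms by (auto simp: hom2_def)

lemma comp2_id' [simp]:
  "\<phi> \<in> Arr \<Longrightarrow> Dom \<phi> = X \<Longrightarrow> \<phi> \<cdot> \<^bold>1 X = \<phi>"
  using comp2_id[of \<phi> X "Cod \<phi>"] by (auto simp: hom2_def)

lemma id_comp2' [simp]:
  "\<phi> \<in> Arr \<Longrightarrow> Cod \<phi> = X \<Longrightarrow> \<^bold>1 X \<cdot> \<phi> = \<phi>"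
  using id_comp2[of \<phi> "Dom \<phi>" X] by (auto simp: hom2_def)

lemma comp2_assoc' [simp]:
  assumes "\<phi> \<in> Arr" "\<psi> \<in> Arr" "\<chi> \<in> Arr" "Dom \<psi> = Cod \<phi>" "Dom \<chi> = Cod \<psi>"
  shows "(\<chi> \<cdot> \<psi>) \<cdot> \<phi> = \<chi> \<cdot> \<psi> \<cdot> \<phi>"
  using comp2_assoc[of \<phi> "Dom \<phi>" "Cod \<phi>" \<psi> "Cod \<psi>" \<chi> "Cod \<chi>"] assms
  by (auto simp: hom2_def)

lemma unit1_simps [simp]:
  assumes "a \<in> Obj B"
  shows "\<I> a \<in> Mor1 B" "src1 B (\<I> a) = a" "trg1 B (\<I> a) = a"
  using unit1_hom[OF assms] by (auto simp: hom1_def)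

lemma tens1_simps [simp]:
  assumes "X \<in> Mor1 B" "Y \<in> Mor1 B" "src1 B Y = trg1 B X"
  shows "Y \<otimes> X \<in> Mor1 B" "src1 B (Y \<otimes> X) = src1 B X" "trg1 B (Y \<otimes> X) = trg1 B Y"
  using tens1_hom[of X "src1 B X" "trg1 B X" Y "trg1 B Y"] assms by (auto simp: hom1_def)

lemma tens2_simps [simp]:
  assumes "\<phi> \<in> Arr" "\<psi> \<in> Arr" "src1 B (Dom \<psi>) = trg1 B (Dom \<phi>)"
  shows "\<psi> \<star> \<phi> \<in> Arr" "Dom (\<psi> \<star> \<phi>) = Dom \<psi> \<otimes> Dom \<phi>"
    "Cod (\<psi> \<star> \<phi>) = Cod \<psi> \<otimes> Cod \<phi>"
  using tens2_hom[of "Dom \<phi>" "src1 B (Dom \<phi>)" "trg1 B (Dom \<phi>)" "Dom \<psi>"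
      "trg1 B (Dom \<psi>)" \<phi> "Cod \<phi>" \<psi> "Cod \<psi>"] assms
  by (auto simp: hom1_def hom2_def)

lemma tens2_id' [simp]:
  assumes "X \<in> Mor1 B" "Y \<in> Mor1 B" "src1 B Y = trg1 B X"
  shows "\<^bold>1 Y \<star> \<^bold>1 X = \<^bold>1 (Y \<otimes> X)"
  using tens2_id[of X "src1 B X" "trg1 B X" Y "trg1 B Y"] assms by (auto simp: hom1_def)

lemma interchange':
  assumes "\<phi> \<in> Arr" "\<phi>' \<in> Arr" "\<psi> \<in> Arr" "\<psi>' \<in> Arr"
    "Dom \<phi>' = Cod \<phi>" "Dom \<psi>' = Cod \<psi>" "src1 B (Dom \<psi>) = trg1 B (Dom \<phi>)"
  shows "(\<psi>' \<cdot> \<psi>) \<star> (\<phi>' \<cdot> \<phi>) = (\<psi>' \<star> \<phi>') \<cdot> (\<psi> \<star> \<phi>)"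
  using interchange[of "Dom \<phi>" "src1 B (Dom \<phi>)" "trg1 B (Dom \<phi>)" "Dom \<psi>"
      "trg1 B (Dom \<psi>)" \<phi> "Cod \<phi>" \<phi>' "Cod \<phi>'" \<psi> "Cod \<psi>" \<psi>' "Cod \<psi>'"] assms
  by (auto simp: hom1_def hom2_def)

lemma whiskerL:
  assumes "\<phi> \<in> Arr" "\<phi>' \<in> Arr" "Dom \<phi>' = Cod \<phi>" "Y \<in> Mor1 B"
    "src1 B Y = trg1 B (Dom \<phi>)"
  shows "\<^bold>1 Y \<star> (\<phi>' \<cdot> \<phi>) = (\<^bold>1 Y \<star> \<phi>') \<cdot> (\<^bold>1 Y \<star> \<phi>)"
  using interchange'[of \<phi> \<phi>' "\<^bold>1 Y" "\<^bold>1 Y"] assms by simp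

lemma whiskerR:
  assumes "\<psi> \<in> Arr" "\<psi>' \<in> Arr" "Dom \<psi>' = Cod \<psi>" "X \<in> Mor1 B"
    "src1 B (Dom \<psi>) = trg1 B X"
  shows "(\<psi>' \<cdot> \<psi>) \<star> \<^bold>1 X = (\<psi>' \<star> \<^bold>1 X) \<cdot> (\<psi> \<star> \<^bold>1 X)"
  using interchange'[of "\<^bold>1 X" "\<^bold>1 X" \<psi> \<psi>'] assms by simp

lemma tens2_left_right:
  assumes "\<phi> \<in> Arr" "\<psi> \<in> Arr" "src1 B (Dom \<psi>) = trg1 B (Dom \<phi>)"
  shows "(\<psi> \<star> \<^bold>1 (Cod \<phi>)) \<cdot> (\<^bold>1 (Dom \<psi>) \<star> \<phi>) = \<psi> \<star> \<phi>"
  using interchange'[of \<phi> "\<^bold>1 (Cod \<phi>)" "\<^bold>1 (Dom \<psi>)" \<psi>] assms by simp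

lemma tens2_right_left:
  assumes "\<phi> \<in> Arr" "\<psi> \<in> Arr" "src1 B (Dom \<psi>) = trg1 B (Dom \<phi>)"
  shows "(\<^bold>1 (Cod \<psi>) \<star> \<phi>) \<cdot> (\<psi> \<star> \<^bold>1 (Dom \<phi>)) = \<psi> \<star> \<phi>"
  using interchange'[of "\<^bold>1 (Dom \<phi>)" \<phi> \<psi> "\<^bold>1 (Cod \<psi>)"] assms by simp

subsection \<open>Invertible 2-morphisms\<close>

lemma inverse2_unique:
  assumes "inverse2 B f g" "inverse2 B f h"
  shows "g = h"
proof -
  have m: "f \<in> Arr" "g \<in> Arr" "h \<in> Arr" "Dom g = Cod f" "Cod g = Dom f"
    "Dom h = Cod f" "Cod h = Dom f"
    and e: "g \<cdot> f = \<^bold>1 (Dom f)" "f \<cdot> h = \<^bold>1 (Cod f)"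
    using assms by (auto simp: inverse2_def hom2_def)
  have "(g \<cdot> f) \<cdot> h = g \<cdot> (f \<cdot> h)" using m by (intro comp2_assoc') auto
  then show ?thesis using m e by simp
qed

lemma inverse2_inv2: "invertible2 B f \<Longrightarrow> inverse2 B f (inv2 B f)"
  unfolding invertible2_def inv2_def by (metis inverse2_unique theI)

lemma inv2_eqI: "inverse2 B f g \<Longrightarrow> inv2 B f = g"
  using inverse2_unique inverse2_inv2 unfolding invertible2_def by blast

lemma inv2_simps [simp]:
  assumes "invertible2 B f"
  shows "inv2 B f \<in> Arr" "Dom (inv2 B f) = Cod f" "Cod (inv2 B f) = Dom f"
    "inv2 B f \<cdot> f = \<^bold>1 (Dom f)" "f \<cdot> inv2 B f = \<^bold>1 (Cod f)"
  using inverse2_inv2[OF assms] by (auto simp: inverse2_def hom2_def)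

lemma invertible2_mor2: "invertible2 B f \<Longrightarrow> f \<in> Arr"
  by (auto simp: invertible2_def inverse2_def)

lemma inv2_cancel [simp]:
  assumes "invertible2 B f" "g \<in> Arr"
  shows "Cod g = Dom f \<Longrightarrow> inv2 B f \<cdot> f \<cdot> g = g"
    "Cod g = Cod f \<Longrightarrow> f \<cdot> inv2 B f \<cdot> g = g"
proof -
  have f: "f \<in> Arr" using assms(1) by (rule invertible2_mor2)
  { assume "Cod g = Dom f"
    then have "inv2 B f \<cdot> f \<cdot> g = (inv2 B f \<cdot> f) \<cdot> g" using assms f
      by (simp del: inv2_simps(4,5))
    then show "inv2 B f \<cdot> f \<cdot> g = g" using assms f \<open>Cod g = Dom f\<close> by simp }
  { assume "Cod g = Cod f"
    then have "f \<cdot> inv2 B f \<cdot> g = (f \<cdot> inv2 B f) \<cdot> g" using assms f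
      by (simp del: inv2_simps(4,5))
    then show "f \<cdot> inv2 B f \<cdot> g = g" using assms f \<open>Cod g = Cod f\<close> by simp }
qed

lemma inverse2I:
  assumes "f \<in> Arr" "g \<in> Arr" "Dom g = Cod f" "Cod g = Dom f"
    "g \<cdot> f = \<^bold>1 (Dom f)" "f \<cdot> g = \<^bold>1 (Cod f)"
  shows "inverse2 B f g"
  using assms by (auto simp: inverse2_def hom2_def)

lemma invertible2I:
  assumes "f \<in> Arr" "g \<in> Arr" "Dom g = Cod f" "Cod g = Dom f"
    "g \<cdot> f = \<^bold>1 (Dom f)" "f \<cdot> g = \<^bold>1 (Cod f)"
  shows "invertible2 B f"
  using inverse2I[OF assms] by (auto simp: invertible2_def)

lemma invertible2_comp [simp]:
  assumes "invertible2 B f" "invertible2 B g" "Dom g = Cod f"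
  shows "invertible2 B (g \<cdot> f)"
  using assms invertible2_mor2[OF assms(1)] invertible2_mor2[OF assms(2)]
  by (intro invertible2I[where g = "inv2 B f \<cdot> inv2 B g"]) auto

lemma invertible2_id [simp]: "X \<in> Mor1 B \<Longrightarrow> invertible2 B (\<^bold>1 X)"
  by (intro invertible2I[where g = "\<^bold>1 X"]) auto

lemma invertible2_inv2 [simp]: "invertible2 B f \<Longrightarrow> invertible2 B (inv2 B f)"
  using invertible2_mor2[of f] by (intro invertible2I[where g = f]) auto

lemma invertible2_tens [simp]:
  assumes "invertible2 B f" "invertible2 B g" "src1 B (Dom g) = trg1 B (Dom f)"
  shows "invertible2 B (g \<star> f)"
  using assms invertible2_mor2[OF assms(1)] invertible2_mor2[OF assms(2)]
    mor2_mor1(3,4)[OF invertible2_mor2[OF assms(1)]] mor2_mor1(3,4)[OF invertible2_mor2[OF assms(2)]]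
  by (intro invertible2I[where g = "inv2 B g \<star> inv2 B f"])
    (auto simp: interchange'[symmetric])

lemma invertible2_epi:
  assumes "invertible2 B f" "g \<cdot> f = h \<cdot> f" "g \<in> Arr" "h \<in> Arr"
    "Dom g = Cod f" "Dom h = Cod f"
  shows "g = h"
proof -
  have "(g \<cdot> f) \<cdot> inv2 B f = (h \<cdot> f) \<cdot> inv2 B f" using assms by simp
  then show ?thesis using assms(1,3-) invertible2_mor2[OF assms(1)] by simp
qed

lemma invertible2_mono:
  assumes "invertible2 B f" "f \<cdot> g = f \<cdot> h" "g \<in> Arr" "h \<in> Arr"
    "Cod g = Dom f" "Cod h = Dom f"
  shows "g = h"
  using assms by (metis inv2_cancel(1))

subsection \<open>Associators and unitors\<close>

lemma assoc_simps [simp]: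
  assumes "X \<in> Mor1 B" "Y \<in> Mor1 B" "Z \<in> Mor1 B" "src1 B Y = trg1 B X" "src1 B Z = trg1 B Y"
  shows "\<alpha> Z Y X \<in> Arr" "Dom (\<alpha> Z Y X) = (Z \<otimes> Y) \<otimes> X"
    "Cod (\<alpha> Z Y X) = Z \<otimes> (Y \<otimes> X)" "invertible2 B (\<alpha> Z Y X)"
  using assoc_hom[of X "src1 B X" "trg1 B X" Y "trg1 B Y" Z "trg1 B Z"] assms
  by (auto simp: hom1_def hom2_def)

lemma assoc_nat':
  assumes "\<phi> \<in> Arr" "\<psi> \<in> Arr" "\<chi> \<in> Arr"
    "src1 B (Dom \<psi>) = trg1 B (Dom \<phi>)" "src1 B (Dom \<chi>) = trg1 B (Dom \<psi>)"
    "Z' = Cod \<chi>" "Y' = Cod \<psi>" "X' = Cod \<phi>"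
  shows "\<alpha> Z' Y' X' \<cdot> ((\<chi> \<star> \<psi>) \<star> \<phi>) =
    (\<chi> \<star> (\<psi> \<star> \<phi>)) \<cdot> \<alpha> (Dom \<chi>) (Dom \<psi>) (Dom \<phi>)"
  using assoc_nat[of "Dom \<phi>" "src1 B (Dom \<phi>)" "trg1 B (Dom \<phi>)" "Dom \<psi>"
      "trg1 B (Dom \<psi>)" "Dom \<chi>" "trg1 B (Dom \<chi>)" \<phi> "Cod \<phi>" \<psi> "Cod \<psi>" \<chi> "Cod \<chi>"] assms
  by (auto simp: hom1_def hom2_def)

lemma lun_simps [simp]:
  assumes "X \<in> Mor1 B"
  shows "\<l> X \<in> Arr" "Dom (\<l> X) = \<I> (trg1 B X) \<otimes> X" "Cod (\<l> X) = X" "invertible2 B (\<l> X)"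
  using lun_hom[of X "src1 B X" "trg1 B X"] assms by (auto simp: hom1_def hom2_def)

lemma run_simps [simp]:
  assumes "X \<in> Mor1 B"
  shows "\<r> X \<in> Arr" "Dom (\<r> X) = X \<otimes> \<I> (src1 B X)" "Cod (\<r> X) = X" "invertible2 B (\<r> X)"
  using run_hom[of X "src1 B X" "trg1 B X"] assms by (auto simp: hom1_def hom2_def)

lemma lun_nat':
  assumes "\<phi> \<in> Arr" "c = trg1 B (Dom \<phi>)" "X' = Cod \<phi>"
  shows "\<l> X' \<cdot> (\<^bold>1 (\<I> c) \<star> \<phi>) = \<phi> \<cdot> \<l> (Dom \<phi>)"
  using lun_nat[of "Dom \<phi>" "src1 B (Dom \<phi>)" "trg1 B (Dom \<phi>)" \<phi> "Cod \<phi>"] assms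
  by (auto simp: hom1_def hom2_def)

lemma run_nat':
  assumes "\<phi> \<in> Arr" "c = src1 B (Dom \<phi>)" "X' = Cod \<phi>"
  shows "\<r> X' \<cdot> (\<phi> \<star> \<^bold>1 (\<I> c)) = \<phi> \<cdot> \<r> (Dom \<phi>)"
  using run_nat[of "Dom \<phi>" "src1 B (Dom \<phi>)" "trg1 B (Dom \<phi>)" \<phi> "Cod \<phi>"] assms
  by (auto simp: hom1_def hom2_def)

lemma pentagon':
  assumes "X \<in> Mor1 B" "Y \<in> Mor1 B" "Z \<in> Mor1 B" "W \<in> Mor1 B"
    "src1 B Y = trg1 B X" "src1 B Z = trg1 B Y" "src1 B W = trg1 B Z"
  shows "\<alpha> W Z (Y \<otimes> X) \<cdot> \<alpha> (W \<otimes> Z) Y X =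
      (\<^bold>1 W \<star> \<alpha> Z Y X) \<cdot> \<alpha> W (Z \<otimes> Y) X \<cdot> (\<alpha> W Z Y \<star> \<^bold>1 X)"
  using pentagon[of X "src1 B X" "trg1 B X" Y "trg1 B Y" Z "trg1 B Z" W "trg1 B W"] assms
  by (auto simp: hom1_def)

lemma triangle':
  assumes "X \<in> Mor1 B" "Y \<in> Mor1 B" "c = trg1 B X" "src1 B Y = trg1 B X"
  shows "(\<^bold>1 Y \<star> \<l> X) \<cdot> \<alpha> Y (\<I> c) X = \<r> Y \<star> \<^bold>1 X"
  using triangle[of X "src1 B X" "trg1 B X" Y "trg1 B Y"] assms by (auto simp: hom1_def)

lemma whisker_unit_left_faithful:
  assumes "\<^bold>1 (\<I> c) \<star> f = \<^bold>1 (\<I> c) \<star> g" "f \<in> Arr" "g \<in> Arr"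
    "Dom f = Dom g" "Cod f = Cod g" "c = trg1 B (Dom f)"
  shows "f = g"
proof (rule invertible2_epi)
  show "f \<cdot> \<l> (Dom f) = g \<cdot> \<l> (Dom f)"
    using lun_nat'[of f c "Cod f"] lun_nat'[of g c "Cod f"] assms by simp
qed (use assms in auto)

lemma whisker_unit_right_faithful:
  assumes "f \<star> \<^bold>1 (\<I> c) = g \<star> \<^bold>1 (\<I> c)" "f \<in> Arr" "g \<in> Arr"
    "Dom f = Dom g" "Cod f = Cod g" "c = src1 B (Dom f)"
  shows "f = g"
proof (rule invertible2_epi)
  show "f \<cdot> \<r> (Dom f) = g \<cdot> \<r> (Dom f)"
    using run_nat'[of f c "Cod f"] run_nat'[of g c "Cod f"] assms by simp
qed (use assms in auto)

text \<open>Kelly's argument: after tensoring with the unit on the left, the claim follows from the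
  pentagon for \<open>I, I, Y, X\<close> and two triangles, and tensoring with the unit is faithful.\<close>

lemma lun_tens:
  assumes X: "X \<in> Mor1 B" and Y: "Y \<in> Mor1 B" and YX: "src1 B Y = trg1 B X" and c: "c = trg1 B Y"
  shows "\<l> (Y \<otimes> X) \<cdot> \<alpha> (\<I> c) Y X = \<l> Y \<star> \<^bold>1 X"
proof (rule whisker_unit_left_faithful[where c = c])
  let ?I = "\<I> c"
  have [simp]: "c \<in> Obj B" using c Y by simp
  note s = X Y YX c
  show "\<^bold>1 ?I \<star> (\<l> (Y \<otimes> X) \<cdot> \<alpha> ?I Y X) = \<^bold>1 ?I \<star> (\<l> Y \<star> \<^bold>1 X)"
  proof (rule invertible2_epi)
    let ?p = "\<alpha> ?I (?I \<otimes> Y) X \<cdot> (\<alpha> ?I ?I Y \<star> \<^bold>1 X)"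
    show "invertible2 B ?p" using s by simp
    have "(\<^bold>1 ?I \<star> (\<l> (Y \<otimes> X) \<cdot> \<alpha> ?I Y X)) \<cdot> ?p =
      (\<^bold>1 ?I \<star> \<l> (Y \<otimes> X)) \<cdot> ((\<^bold>1 ?I \<star> \<alpha> ?I Y X) \<cdot> ?p)"
      using s by (simp add: whiskerL)
    also have "\<dots> = (\<^bold>1 ?I \<star> \<l> (Y \<otimes> X)) \<cdot> (\<alpha> ?I ?I (Y \<otimes> X) \<cdot> \<alpha> (?I \<otimes> ?I) Y X)"
      using pentagon'[of X Y ?I ?I] s by simp
    also have "\<dots> = ((\<^bold>1 ?I \<star> \<l> (Y \<otimes> X)) \<cdot> \<alpha> ?I ?I (Y \<otimes> X)) \<cdot> \<alpha> (?I \<otimes> ?I) Y X"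
      using s by simp
    also have "\<dots> = (\<r> ?I \<star> (\<^bold>1 Y \<star> \<^bold>1 X)) \<cdot> \<alpha> (?I \<otimes> ?I) Y X"
      using s triangle'[of "Y \<otimes> X" ?I c] by simp
    also have "\<dots> = \<alpha> ?I Y X \<cdot> ((\<r> ?I \<star> \<^bold>1 Y) \<star> \<^bold>1 X)"
      using s assoc_nat'[of "\<^bold>1 X" "\<^bold>1 Y" "\<r> ?I" ?I Y X] by simp
    also have "(\<r> ?I \<star> \<^bold>1 Y) = (\<^bold>1 ?I \<star> \<l> Y) \<cdot> \<alpha> ?I ?I Y"
      using s triangle'[of Y ?I c] by simp
    also have "\<alpha> ?I Y X \<cdot> (\<dots> \<star> \<^bold>1 X) =
      (\<alpha> ?I Y X \<cdot> ((\<^bold>1 ?I \<star> \<l> Y) \<star> \<^bold>1 X)) \<cdot> (\<alpha> ?I ?I Y \<star> \<^bold>1 X)"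
      using s by (simp add: whiskerR)
    also have "\<dots> = (\<^bold>1 ?I \<star> (\<l> Y \<star> \<^bold>1 X)) \<cdot> ?p"
      using s assoc_nat'[of "\<^bold>1 X" "\<l> Y" "\<^bold>1 ?I" ?I Y X] by simp
    finally show "(\<^bold>1 ?I \<star> (\<l> (Y \<otimes> X) \<cdot> \<alpha> ?I Y X)) \<cdot> ?p = (\<^bold>1 ?I \<star> (\<l> Y \<star> \<^bold>1 X)) \<cdot> ?p" .
  qed (use s in auto)
qed (use X Y YX c in auto)

end

section \<open>Acting by whiskering\<close>

text \<open>A \<open>word\<close> is a formal bracketed composite. It acts on 1-morphisms (\<open>act\<close>) and 2-morphisms (\<open>act2\<close>)
  by whiskering with its atoms one after the other, so that all bracketings of the same atoms act
  in literally the same way and units act as the identity. The coherence isomorphism \<open>can P V\<close> goes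
  from the true composite \<open>val P \<otimes> V\<close> to this strict version.\<close>

datatype ('o, 'm) word = Unit 'o | Atom 'm | Tens "('o, 'm) word" "('o, 'm) word" (infixr \<open>\<odot>\<close> 75)

context bicategory
begin

fun val :: "('o, 'm) word \<Rightarrow> 'm" where
  "val (Unit a) = \<I> a"
| "val (Atom X) = X"
| "val (P \<odot> Q) = val P \<otimes> val Q"

fun wsrc :: "('o, 'm) word \<Rightarrow> 'o" where
  "wsrc (Unit a) = a"
| "wsrc (Atom X) = src1 B X"
| "wsrc (P \<odot> Q) = wsrc Q"

fun wtrg :: "('o, 'm) word \<Rightarrow> 'o" where
  "wtrg (Unit a) = a"
| "wtrg (Atom X) = trg1 B X"
| "wtrg (P \<odot> Q) = wtrg P"

fun composable :: "('o, 'm) word \<Rightarrow> bool" where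
  "composable (Unit a) \<longleftrightarrow> a \<in> Obj B"
| "composable (Atom X) \<longleftrightarrow> X \<in> Mor1 B"
| "composable (P \<odot> Q) \<longleftrightarrow> composable P \<and> composable Q \<and> wsrc P = wtrg Q"

fun act :: "('o, 'm) word \<Rightarrow> 'm \<Rightarrow> 'm" where
  "act (Unit a) V = V"
| "act (Atom X) V = X \<otimes> V"
| "act (P \<odot> Q) V = act P (act Q V)"

fun act2 :: "('o, 'm) word \<Rightarrow> 'c \<Rightarrow> 'c" where
  "act2 (Unit a) \<phi> = \<phi>"
| "act2 (Atom X) \<phi> = \<^bold>1 X \<star> \<phi>"
| "act2 (P \<odot> Q) \<phi> = act2 P (act2 Q \<phi>)"

fun can :: "('o, 'm) word \<Rightarrow> 'm \<Rightarrow> 'c" where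
  "can (Unit a) V = \<l> V"
| "can (Atom X) V = \<^bold>1 (X \<otimes> V)"
| "can (P \<odot> Q) V = can P (act Q V) \<cdot> (\<^bold>1 (val P) \<star> can Q V) \<cdot> \<alpha> (val P) (val Q) V"

lemma val_simps [simp]:
  assumes "composable P"
  shows "val P \<in> Mor1 B" "src1 B (val P) = wsrc P" "trg1 B (val P) = wtrg P"
proof -
  have "val P \<in> Mor1 B \<and> src1 B (val P) = wsrc P \<and> trg1 B (val P) = wtrg P"
    using assms by (induction P) auto
  then show "val P \<in> Mor1 B" "src1 B (val P) = wsrc P" "trg1 B (val P) = wtrg P" by auto
qed

lemma word_obj [simp]: "composable P \<Longrightarrow> wsrc P \<in> Obj B" "composable P \<Longrightarrow> wtrg P \<in> Obj B"
  by (metis mor1_obj val_simps)+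

lemma act_simps [simp]:
  assumes "composable P" "V \<in> Mor1 B" "trg1 B V = wsrc P"
  shows "act P V \<in> Mor1 B" "src1 B (act P V) = src1 B V" "trg1 B (act P V) = wtrg P"
proof -
  have "act P V \<in> Mor1 B \<and> src1 B (act P V) = src1 B V \<and> trg1 B (act P V) = wtrg P"
    using assms by (induction P arbitrary: V) auto
  then show "act P V \<in> Mor1 B" "src1 B (act P V) = src1 B V" "trg1 B (act P V) = wtrg P" by auto
qed

lemma act2_simps [simp]:
  assumes "composable P" "\<phi> \<in> Arr" "trg1 B (Dom \<phi>) = wsrc P"
  shows "act2 P \<phi> \<in> Arr" "Dom (act2 P \<phi>) = act P (Dom \<phi>)"
    "Cod (act2 P \<phi>) = act P (Cod \<phi>)"
proof -
  have "act2 P \<phi> \<in> Arr \<and> Dom (act2 P \<phi>) = act P (Dom \<phi>) \<and>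
    Cod (act2 P \<phi>) = act P (Cod \<phi>)"
    using assms by (induction P arbitrary: \<phi>) auto
  then show "act2 P \<phi> \<in> Arr" "Dom (act2 P \<phi>) = act P (Dom \<phi>)"
    "Cod (act2 P \<phi>) = act P (Cod \<phi>)" by auto
qed

lemma act2_id [simp]:
  "composable P \<Longrightarrow> V \<in> Mor1 B \<Longrightarrow> trg1 B V = wsrc P \<Longrightarrow> act2 P (\<^bold>1 V) = \<^bold>1 (act P V)"
  by (induction P arbitrary: V) auto

lemma act2_comp:
  assumes "composable P" "\<phi> \<in> Arr" "\<psi> \<in> Arr" "Dom \<psi> = Cod \<phi>"
    "trg1 B (Dom \<phi>) = wsrc P"
  shows "act2 P (\<psi> \<cdot> \<phi>) = act2 P \<psi> \<cdot> act2 P \<phi>"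
  using assms by (induction P arbitrary: \<phi> \<psi>) (auto simp: whiskerL)

lemma can_simps [simp]:
  assumes "composable P" "V \<in> Mor1 B" "trg1 B V = wsrc P"
  shows "can P V \<in> Arr" "Dom (can P V) = val P \<otimes> V" "Cod (can P V) = act P V"
    "invertible2 B (can P V)"
proof -
  have "can P V \<in> Arr \<and> Dom (can P V) = val P \<otimes> V \<and> Cod (can P V) = act P V \<and>
    invertible2 B (can P V)"
    using assms by (induction P arbitrary: V) auto
  then show "can P V \<in> Arr" "Dom (can P V) = val P \<otimes> V" "Cod (can P V) = act P V"
    "invertible2 B (can P V)" by auto
qed

lemma can_natural:
  assumes "composable P" "\<phi> \<in> Arr" "trg1 B (Dom \<phi>) = wsrc P"
  shows "can P (Cod \<phi>) \<cdot> (\<^bold>1 (val P) \<star> \<phi>) = act2 P \<phi> \<cdot> can P (Dom \<phi>)"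
  using assms
proof (induction P arbitrary: \<phi>)
  case (Unit a)
  then show ?case by (simp add: lun_nat')
next
  case (Atom X)
  then show ?case by simp
next
  case (Tens P Q)
  let ?V = "Dom \<phi>" and ?W = "Cod \<phi>"
  note s = Tens.prems
  have "can (P \<odot> Q) ?W \<cdot> (\<^bold>1 (val (P \<odot> Q)) \<star> \<phi>) =
    can P (act Q ?W) \<cdot> (\<^bold>1 (val P) \<star> can Q ?W) \<cdot>
      (\<alpha> (val P) (val Q) ?W \<cdot> ((\<^bold>1 (val P) \<star> \<^bold>1 (val Q)) \<star> \<phi>))"
    using s by simp
  also have "\<dots> = can P (act Q ?W) \<cdot> ((\<^bold>1 (val P) \<star> can Q ?W) \<cdot> (\<^bold>1 (val P) \<star> (\<^bold>1 (val Q) \<star> \<phi>))) \<cdot>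
      \<alpha> (val P) (val Q) ?V"
    using s by (subst assoc_nat') auto
  also have "(\<^bold>1 (val P) \<star> can Q ?W) \<cdot> (\<^bold>1 (val P) \<star> (\<^bold>1 (val Q) \<star> \<phi>)) =
    (\<^bold>1 (val P) \<star> act2 Q \<phi>) \<cdot> (\<^bold>1 (val P) \<star> can Q ?V)"
    using s Tens.IH(2)[of \<phi>] by (simp add: whiskerL[symmetric])
  also have "can P (act Q ?W) \<cdot> (\<dots>) \<cdot> \<alpha> (val P) (val Q) ?V =
    (can P (act Q ?W) \<cdot> (\<^bold>1 (val P) \<star> act2 Q \<phi>)) \<cdot> (\<^bold>1 (val P) \<star> can Q ?V) \<cdot> \<alpha> (val P) (val Q) ?V"
    using s by simp
  also have "can P (act Q ?W) \<cdot> (\<^bold>1 (val P) \<star> act2 Q \<phi>) = act2 (P \<odot> Q) \<phi> \<cdot> can P (act Q ?V)"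
    using s Tens.IH(1)[of "act2 Q \<phi>"] by simp
  finally show ?case using s by simp
qed

text \<open>\<open>represents P Q f \<phi>\<close> says that whiskering with \<open>f : val P \<Rightarrow> val Q\<close> becomes, under the coherence
  isomorphisms, the family \<open>\<phi> V : act P V \<Rightarrow> act Q V\<close>. The words are part of the relation because
  a 1-morphism does not know how it was composed.\<close>

definition represents ::
    "('o, 'm) word \<Rightarrow> ('o, 'm) word \<Rightarrow> 'c \<Rightarrow> ('m \<Rightarrow> 'c) \<Rightarrow> bool" where
  "represents P Q f \<phi> \<longleftrightarrow> composable P \<and> composable Q \<and>
     f \<in> Arr \<and> Dom f = val P \<and> Cod f = val Q \<and>
     (\<forall>V. V \<in> Mor1 B \<and> trg1 B V = wsrc P \<longrightarrow>
        \<phi> V \<in> Arr \<and> Dom (\<phi> V) = act P V \<and> Cod (\<phi> V) = act Q V \<and>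
        \<phi> V \<cdot> can P V = can Q V \<cdot> (f \<star> \<^bold>1 V))"

lemma representsD:
  assumes "represents P Q f \<phi>"
  shows "composable P" "composable Q" "f \<in> Arr" "Dom f = val P" "Cod f = val Q"
    "wsrc Q = wsrc P" "wtrg Q = wtrg P"
    "V \<in> Mor1 B \<Longrightarrow> trg1 B V = wsrc P \<Longrightarrow> \<phi> V \<in> Arr"
    "V \<in> Mor1 B \<Longrightarrow> trg1 B V = wsrc P \<Longrightarrow> Dom (\<phi> V) = act P V"
    "V \<in> Mor1 B \<Longrightarrow> trg1 B V = wsrc P \<Longrightarrow> Cod (\<phi> V) = act Q V"
    "V \<in> Mor1 B \<Longrightarrow> trg1 B V = wsrc P \<Longrightarrow> \<phi> V \<cdot> can P V = can Q V \<cdot> (f \<star> \<^bold>1 V)"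
proof -
  show a: "composable P" "composable Q" "f \<in> Arr" "Dom f = val P" "Cod f = val Q"
    using assms by (auto simp: represents_def)
  show "wsrc Q = wsrc P" "wtrg Q = wtrg P"
    using a by (metis mor2_mor1(3,4) val_simps(2,3))+
qed (use assms in \<open>auto simp: represents_def\<close>)

lemma rep_cong:
  assumes "represents P Q f \<phi>" "\<And>V. V \<in> Mor1 B \<Longrightarrow> trg1 B V = wsrc P \<Longrightarrow> \<phi> V = \<psi> V"
  shows "represents P Q f \<psi>"
  using assms by (auto simp: represents_def)

lemma rep_self:
  assumes "composable P" "composable Q" "f \<in> Arr" "Dom f = val P" "Cod f = val Q"
  shows "represents P Q f (\<lambda>V. can Q V \<cdot> (f \<star> \<^bold>1 V) \<cdot> inv2 B (can P V))"
proof -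
  have "wsrc Q = wsrc P" "wtrg Q = wtrg P"
    using assms by (metis mor2_mor1(3,4) val_simps(2,3))+
  then show ?thesis using assms by (auto simp: represents_def)
qed

text \<open>Naturality comes for free: it is the interchange of \<open>f\<close> on the left with \<open>\<psi>\<close> on the right.\<close>

lemma rep_natural:
  assumes r: "represents P Q f \<phi>" and m: "\<psi> \<in> Arr" "trg1 B (Dom \<psi>) = wsrc P"
    and VW: "V = Dom \<psi>" "W = Cod \<psi>"
  shows "\<phi> W \<cdot> act2 P \<psi> = act2 Q \<psi> \<cdot> \<phi> V"
proof -
  note d [simp] = representsD[OF r]
  have V: "V \<in> Mor1 B" "trg1 B V = wsrc P" "W \<in> Mor1 B" "trg1 B W = wsrc P"
    using m VW by auto
  show ?thesis
  proof (rule invertible2_epi)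
    show "invertible2 B (can P V)" using V by simp
    have "(\<phi> W \<cdot> act2 P \<psi>) \<cdot> can P V = (\<phi> W \<cdot> can P W) \<cdot> (\<^bold>1 (val P) \<star> \<psi>)"
      using can_natural[of P \<psi>] m V VW by (simp del: d(11))
    also have "\<dots> = can Q W \<cdot> ((f \<star> \<^bold>1 W) \<cdot> (\<^bold>1 (val P) \<star> \<psi>))"
      using m V VW by simp
    also have "(f \<star> \<^bold>1 W) \<cdot> (\<^bold>1 (val P) \<star> \<psi>) = (\<^bold>1 (val Q) \<star> \<psi>) \<cdot> (f \<star> \<^bold>1 V)"
      using tens2_left_right[of \<psi> f] tens2_right_left[of \<psi> f] m V VW by simp
    also have "can Q W \<cdot> \<dots> = (can Q W \<cdot> (\<^bold>1 (val Q) \<star> \<psi>)) \<cdot> (f \<star> \<^bold>1 V)"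
      using m V VW by simp
    also have "\<dots> = (act2 Q \<psi> \<cdot> \<phi> V) \<cdot> can P V"
      using can_natural[of Q \<psi>] m V VW by simp
    finally show "(\<phi> W \<cdot> act2 P \<psi>) \<cdot> can P V = (act2 Q \<psi> \<cdot> \<phi> V) \<cdot> can P V" .
  qed (use m V VW in auto)
qed

text \<open>The family determines \<open>f\<close> since whiskering with a unit 1-morphism is faithful. This is the step that
  turns an equation between strict families into an equation in the bicategory.\<close>

lemma rep_faithful:
  assumes f: "represents P Q f \<phi>" and g: "represents P Q g \<psi>"
    and eq: "\<And>V. V \<in> Mor1 B \<Longrightarrow> trg1 B V = wsrc P \<Longrightarrow> \<phi> V = \<psi> V"
  shows "f = g"
proof -
  note df [simp] = representsD[OF f] and dg [simp] = representsD[OF g]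
  let ?I = "\<I> (wsrc P)"
  have V: "?I \<in> Mor1 B" "trg1 B ?I = wsrc P" by auto
  show ?thesis
  proof (rule whisker_unit_right_faithful)
    show "f \<star> \<^bold>1 ?I = g \<star> \<^bold>1 ?I"
      by (rule invertible2_mono[of "can Q ?I"]) (use df(11)[OF V] dg(11)[OF V] eq[OF V] in auto)
  qed auto
qed

lemma rep_id: "composable P \<Longrightarrow> represents P P (\<^bold>1 (val P)) (\<lambda>V. \<^bold>1 (act P V))"
  by (auto simp: represents_def)

lemma rep_comp:
  assumes f: "represents P Q f \<phi>" and g: "represents Q R g \<psi>"
  shows "represents P R (g \<cdot> f) (\<lambda>V. \<psi> V \<cdot> \<phi> V)"
proof -
  note df [simp] = representsD[OF f] and dg [simp] = representsD[OF g]
  have "(\<psi> V \<cdot> \<phi> V) \<cdot> can P V = can R V \<cdot> ((g \<cdot> f) \<star> \<^bold>1 V)"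
    if V: "V \<in> Mor1 B" "trg1 B V = wsrc P" for V
  proof -
    have "(\<psi> V \<cdot> \<phi> V) \<cdot> can P V = \<psi> V \<cdot> (\<phi> V \<cdot> can P V)"
      using V by (subst comp2_assoc') auto
    also have "\<dots> = \<psi> V \<cdot> (can Q V \<cdot> (f \<star> \<^bold>1 V))" using V df(11) by simp
    also have "\<dots> = (\<psi> V \<cdot> can Q V) \<cdot> (f \<star> \<^bold>1 V)"
      using V by (subst comp2_assoc') auto
    also have "\<dots> = (can R V \<cdot> (g \<star> \<^bold>1 V)) \<cdot> (f \<star> \<^bold>1 V)" using V dg(11) by simp
    finally show ?thesis using V by (simp add: whiskerR)
  qed
  then show ?thesis by (auto simp: represents_def)
qed

lemma rep_tens:
  assumes f: "represents P P' f \<phi>" and g: "represents Q Q' g \<psi>" and PQ: "wsrc P = wtrg Q"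
  shows "represents (P \<odot> Q) (P' \<odot> Q') (f \<star> g) (\<lambda>V. \<phi> (act Q' V) \<cdot> act2 P (\<psi> V))"
proof -
  note df [simp] = representsD[OF f] and dg [simp] = representsD[OF g] and PQ [simp]
  have "(\<phi> (act Q' V) \<cdot> act2 P (\<psi> V)) \<cdot> can (P \<odot> Q) V = can (P' \<odot> Q') V \<cdot> ((f \<star> g) \<star> \<^bold>1 V)"
    if V: "V \<in> Mor1 B" "trg1 B V = wsrc Q" for V
  proof -
    note [simp] = V
    let ?a = "\<alpha> (val P) (val Q) V"
    have "(\<phi> (act Q' V) \<cdot> act2 P (\<psi> V)) \<cdot> can (P \<odot> Q) V =
      \<phi> (act Q' V) \<cdot> (act2 P (\<psi> V) \<cdot> can P (act Q V)) \<cdot> (\<^bold>1 (val P) \<star> can Q V) \<cdot> ?a"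
      by simp
    also have "act2 P (\<psi> V) \<cdot> can P (act Q V) = can P (act Q' V) \<cdot> (\<^bold>1 (val P) \<star> \<psi> V)"
      using can_natural[of P "\<psi> V"] by simp
    also have "\<phi> (act Q' V) \<cdot> \<dots> \<cdot> (\<^bold>1 (val P) \<star> can Q V) \<cdot> ?a =
      (\<phi> (act Q' V) \<cdot> can P (act Q' V)) \<cdot> ((\<^bold>1 (val P) \<star> \<psi> V) \<cdot> (\<^bold>1 (val P) \<star> can Q V)) \<cdot> ?a"
      by (simp del: df(11))
    also have "(\<^bold>1 (val P) \<star> \<psi> V) \<cdot> (\<^bold>1 (val P) \<star> can Q V) = \<^bold>1 (val P) \<star> (\<psi> V \<cdot> can Q V)"
      by (simp add: whiskerL del: dg(11))
    also have "\<psi> V \<cdot> can Q V = can Q' V \<cdot> (g \<star> \<^bold>1 V)" by simp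
    also have "\<phi> (act Q' V) \<cdot> can P (act Q' V) = can P' (act Q' V) \<cdot> (f \<star> \<^bold>1 (act Q' V))" by simp
    also have "(\<dots>) \<cdot> (\<^bold>1 (val P) \<star> (can Q' V \<cdot> (g \<star> \<^bold>1 V))) \<cdot> ?a =
      can P' (act Q' V) \<cdot> ((f \<star> \<^bold>1 (act Q' V)) \<cdot> (\<^bold>1 (val P) \<star> (can Q' V \<cdot> (g \<star> \<^bold>1 V)))) \<cdot> ?a"
      by simp
    also have "(f \<star> \<^bold>1 (act Q' V)) \<cdot> (\<^bold>1 (val P) \<star> (can Q' V \<cdot> (g \<star> \<^bold>1 V))) =
      (\<^bold>1 (val P') \<star> can Q' V) \<cdot> (f \<star> (g \<star> \<^bold>1 V))"
      by (simp add: interchange'[symmetric])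
    also have "can P' (act Q' V) \<cdot> (\<dots>) \<cdot> ?a =
      can P' (act Q' V) \<cdot> (\<^bold>1 (val P') \<star> can Q' V) \<cdot> ((f \<star> (g \<star> \<^bold>1 V)) \<cdot> ?a)"
      by simp
    also have "(f \<star> (g \<star> \<^bold>1 V)) \<cdot> ?a = \<alpha> (val P') (val Q') V \<cdot> ((f \<star> g) \<star> \<^bold>1 V)"
      by (subst assoc_nat') auto
    finally show ?thesis by simp
  qed
  then show ?thesis by (auto simp: represents_def)
qed

lemma rep_inv:
  assumes f: "represents P Q f \<phi>" and i: "invertible2 B f"
    and \<psi>: "\<And>V. V \<in> Mor1 B \<Longrightarrow> trg1 B V = wsrc P \<Longrightarrow> inverse2 B (\<phi> V) (\<psi> V)"
  shows "represents Q P (inv2 B f) \<psi>"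
proof -
  note df [simp] = representsD[OF f] and i [simp]
  have "\<psi> V \<cdot> can Q V = can P V \<cdot> (inv2 B f \<star> \<^bold>1 V)"
    and "\<psi> V \<in> Arr" "Dom (\<psi> V) = act Q V" "Cod (\<psi> V) = act P V"
    if V: "V \<in> Mor1 B" "trg1 B V = wsrc P" for V
  proof -
    note [simp] = V
    have j: "inverse2 B (\<phi> V) (\<psi> V)" using \<psi> V by simp
    then show p [simp]: "\<psi> V \<in> Arr" "Dom (\<psi> V) = act Q V" "Cod (\<psi> V) = act P V"
      by (auto simp: inverse2_def hom2_def)
    have [simp]: "invertible2 B (\<phi> V)" using j by (auto simp: invertible2_def)
    have e: "\<phi> V \<cdot> \<psi> V = \<^bold>1 (act Q V)" using j by (auto simp: inverse2_def)
    show "\<psi> V \<cdot> can Q V = can P V \<cdot> (inv2 B f \<star> \<^bold>1 V)"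
    proof (rule invertible2_mono[of "\<phi> V"])
      have "\<phi> V \<cdot> \<psi> V \<cdot> can Q V = (\<phi> V \<cdot> \<psi> V) \<cdot> can Q V"
        by (subst comp2_assoc') auto
      also have "\<dots> = can Q V \<cdot> ((f \<cdot> inv2 B f) \<star> \<^bold>1 V)" using e by simp
      also have "\<dots> = (can Q V \<cdot> (f \<star> \<^bold>1 V)) \<cdot> (inv2 B f \<star> \<^bold>1 V)"
        by (simp add: whiskerR del: inv2_simps(4,5))
      also have "\<dots> = (\<phi> V \<cdot> can P V) \<cdot> (inv2 B f \<star> \<^bold>1 V)" by simp
      finally show "\<phi> V \<cdot> \<psi> V \<cdot> can Q V = \<phi> V \<cdot> can P V \<cdot> (inv2 B f \<star> \<^bold>1 V)"
        by (simp del: df(11))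
    qed auto
  qed
  then show ?thesis by (auto simp: represents_def)
qed

lemma rep_inv_id:
  assumes f: "represents P Q f (\<lambda>V. \<^bold>1 (act P V))" and i: "invertible2 B f"
  shows "represents Q P (inv2 B f) (\<lambda>V. \<^bold>1 (act P V))"
proof (rule rep_inv[OF f i])
  fix V assume V: "V \<in> Mor1 B" "trg1 B V = wsrc P"
  have "act P V \<in> Mor1 B" using V representsD[OF f] by simp
  then show "inverse2 B (\<^bold>1 (act P V)) (\<^bold>1 (act P V))" by (intro inverse2I) auto
qed

text \<open>Associators and unitors act as identities. For the associator this is the pentagon, for \<open>\<l>\<close> it is
  \<open>lun_tens\<close>, for \<open>\<r>\<close> it is the triangle axiom.\<close>

lemma rep_assoc:
  assumes [simp]: "composable P" "composable Q" "composable R" "wsrc P = wtrg Q" "wsrc Q = wtrg R"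
  shows "represents ((P \<odot> Q) \<odot> R) (P \<odot> (Q \<odot> R)) (\<alpha> (val P) (val Q) (val R))
    (\<lambda>V. \<^bold>1 (act P (act Q (act R V))))"
proof -
  have "can ((P \<odot> Q) \<odot> R) V = can (P \<odot> (Q \<odot> R)) V \<cdot> (\<alpha> (val P) (val Q) (val R) \<star> \<^bold>1 V)"
    if [simp]: "V \<in> Mor1 B" "trg1 B V = wsrc R" for V
  proof -
    let ?P = "val P" and ?Q = "val Q" and ?R = "val R"
    have "can ((P \<odot> Q) \<odot> R) V = can P (act Q (act R V)) \<cdot> (\<^bold>1 ?P \<star> can Q (act R V)) \<cdot>
      (\<alpha> ?P ?Q (act R V) \<cdot> ((\<^bold>1 ?P \<star> \<^bold>1 ?Q) \<star> can R V)) \<cdot> \<alpha> (?P \<otimes> ?Q) ?R V"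
      by simp
    also have "\<alpha> ?P ?Q (act R V) \<cdot> ((\<^bold>1 ?P \<star> \<^bold>1 ?Q) \<star> can R V) =
      (\<^bold>1 ?P \<star> (\<^bold>1 ?Q \<star> can R V)) \<cdot> \<alpha> ?P ?Q (?R \<otimes> V)"
      by (subst assoc_nat') auto
    also have "can P (act Q (act R V)) \<cdot> (\<^bold>1 ?P \<star> can Q (act R V)) \<cdot> (\<dots>) \<cdot> \<alpha> (?P \<otimes> ?Q) ?R V =
      can P (act Q (act R V)) \<cdot> (\<^bold>1 ?P \<star> can Q (act R V)) \<cdot> (\<^bold>1 ?P \<star> (\<^bold>1 ?Q \<star> can R V)) \<cdot>
       (\<alpha> ?P ?Q (?R \<otimes> V) \<cdot> \<alpha> (?P \<otimes> ?Q) ?R V)"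
      by simp
    also have "\<alpha> ?P ?Q (?R \<otimes> V) \<cdot> \<alpha> (?P \<otimes> ?Q) ?R V =
      (\<^bold>1 ?P \<star> \<alpha> ?Q ?R V) \<cdot> \<alpha> ?P (?Q \<otimes> ?R) V \<cdot> (\<alpha> ?P ?Q ?R \<star> \<^bold>1 V)"
      by (subst pentagon') auto
    finally show ?thesis by (simp add: whiskerL)
  qed
  then show ?thesis by (auto simp: represents_def simp del: can.simps)
qed

lemma rep_assoc_inv:
  assumes "composable P" "composable Q" "composable R" "wsrc P = wtrg Q" "wsrc Q = wtrg R"
  shows "represents (P \<odot> (Q \<odot> R)) ((P \<odot> Q) \<odot> R) (inv2 B (\<alpha> (val P) (val Q) (val R)))
    (\<lambda>V. \<^bold>1 (act P (act Q (act R V))))"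
  using rep_inv_id[of "(P \<odot> Q) \<odot> R" "P \<odot> (Q \<odot> R)"] rep_assoc[OF assms] assms by simp

lemma rep_lun:
  assumes [simp]: "composable P" "a = wtrg P"
  shows "represents (Unit a \<odot> P) P (\<l> (val P)) (\<lambda>V. \<^bold>1 (act P V))"
proof -
  have "can (Unit a \<odot> P) V = can P V \<cdot> (\<l> (val P) \<star> \<^bold>1 V)"
    if [simp]: "V \<in> Mor1 B" "trg1 B V = wsrc P" for V
  proof -
    have "can (Unit a \<odot> P) V = (\<l> (act P V) \<cdot> (\<^bold>1 (\<I> a) \<star> can P V)) \<cdot> \<alpha> (\<I> a) (val P) V"
      by simp
    also have "\<l> (act P V) \<cdot> (\<^bold>1 (\<I> a) \<star> can P V) = can P V \<cdot> \<l> (val P \<otimes> V)"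
      using lun_nat'[of "can P V" a "act P V"] by simp
    also have "(\<dots>) \<cdot> \<alpha> (\<I> a) (val P) V = can P V \<cdot> (\<l> (val P \<otimes> V) \<cdot> \<alpha> (\<I> a) (val P) V)"
      by simp
    finally show ?thesis using lun_tens[of V "val P" a] by simp
  qed
  then show ?thesis by (auto simp: represents_def simp del: can.simps)
qed

lemma rep_run:
  assumes [simp]: "composable P" "a = wsrc P"
  shows "represents (P \<odot> Unit a) P (\<r> (val P)) (\<lambda>V. \<^bold>1 (act P V))"
  by (auto simp: represents_def triangle')

lemma rep_lun_inv:
  assumes "composable P" "a = wtrg P"
  shows "represents P (Unit a \<odot> P) (inv2 B (\<l> (val P))) (\<lambda>V. \<^bold>1 (act P V))"
  using rep_inv_id[of "Unit a \<odot> P" P] rep_lun[OF assms] assms by simp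

lemma rep_run_inv:
  assumes "composable P" "a = wsrc P"
  shows "represents P (P \<odot> Unit a) (inv2 B (\<r> (val P))) (\<lambda>V. \<^bold>1 (act P V))"
  using rep_inv_id[of "P \<odot> Unit a" P] rep_run[OF assms] assms by simp

text \<open>Both sides of either equation act by identities, so faithfulness gives the remaining coherence laws
  for unitors.\<close>

lemma lun_run_unit: "a \<in> Obj B \<Longrightarrow> \<l> (\<I> a) = \<r> (\<I> a)"
  using rep_faithful[OF rep_lun[of "Unit a" a] rep_run[of "Unit a" a]] by simp

lemma run_tens:
  assumes "X \<in> Mor1 B" "Y \<in> Mor1 B" "src1 B Y = trg1 B X" "c = src1 B X"
  shows "(\<^bold>1 Y \<star> \<r> X) \<cdot> \<alpha> Y X (\<I> c) = \<r> (Y \<otimes> X)"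
proof (rule rep_faithful)
  let ?Y = "Atom Y :: ('o, 'm) word" and ?X = "Atom X :: ('o, 'm) word"
  show "represents ((?Y \<odot> ?X) \<odot> Unit c) (?Y \<odot> ?X) ((\<^bold>1 Y \<star> \<r> X) \<cdot> \<alpha> Y X (\<I> c))
    (\<lambda>V. (\<^bold>1 (Y \<otimes> (X \<otimes> V)) \<cdot> (\<^bold>1 Y \<star> \<^bold>1 (X \<otimes> V))) \<cdot> \<^bold>1 (Y \<otimes> (X \<otimes> V)))"
    using rep_comp[OF rep_assoc[of ?Y ?X "Unit c"]
        rep_tens[OF rep_id[of ?Y] rep_run[of ?X c]]] assms by simp
  show "represents ((?Y \<odot> ?X) \<odot> Unit c) (?Y \<odot> ?X) (\<r> (Y \<otimes> X)) (\<lambda>V. \<^bold>1 (Y \<otimes> (X \<otimes> V)))"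
    using rep_run[of "?Y \<odot> ?X" c] assms by simp
qed (use assms in simp)

lemma rep_adapt:
  assumes "represents P Q f \<phi>" "f' = f"
    "\<And>V. V \<in> Mor1 B \<Longrightarrow> trg1 B V = wsrc P \<Longrightarrow> \<psi> V = \<phi> V"
  shows "represents P Q f' \<psi>"
  using assms by (auto intro: rep_cong)

lemma rep_equal:
  assumes "represents P Q f \<phi>" "represents P Q g \<psi>" "f' = f" "g' = g"
    "\<And>V. V \<in> Mor1 B \<Longrightarrow> trg1 B V = wsrc P \<Longrightarrow> \<phi> V = \<psi> V"
  shows "f' = g'"
  using rep_faithful[OF assms(1,2)] assms by simp

lemma rep_invertible:
  assumes r: "represents P Q f \<phi>" and i: "invertible2 B f" and V: "V \<in> Mor1 B" "trg1 B V = wsrc P"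
  shows "invertible2 B (\<phi> V)"
proof -
  note d [simp] = representsD[OF r] and V [simp] and i [simp]
  have "\<phi> V = \<phi> V \<cdot> (can P V \<cdot> inv2 B (can P V))" by simp
  also have "\<dots> = (can Q V \<cdot> (f \<star> \<^bold>1 V)) \<cdot> inv2 B (can P V)"
    by (subst comp2_assoc'[symmetric]) (simp_all del: inv2_simps(5))
  finally show ?thesis by simp
qed

text \<open>In the strict form a zig-zag loses all its coherence isomorphisms and unit insertions.\<close>

lemma rep_zigR:
  assumes \<eta>: "represents (Unit e) (Z \<odot> W) \<eta> \<eta>'" and \<phi>: "represents Z X \<phi> \<phi>'"
    and \<epsilon>: "represents (V \<odot> X) (Unit c) \<epsilon> \<epsilon>'"
    and u: "u = val W" and v: "v = val V"
  shows "represents V W (zigR B u v \<eta> \<phi> \<epsilon>)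
    (\<lambda>U. \<epsilon>' (act W U) \<cdot> act2 V (\<phi>' (act W U)) \<cdot> act2 V (\<eta>' U))"
proof -
  have [simp]: "composable Z" "composable X" "composable V" "composable W"
    and [simp]: "wsrc Z = wtrg W" "wsrc X = wtrg W" "wtrg Z = wtrg X" "wsrc V = wtrg X"
      "wsrc W = e" "e = wtrg X" "wtrg V = c" "wtrg W = c" "Cod \<phi> = val X"
    using representsD(1,2,5,6,7)[OF \<eta>] representsD(1,2,5,6,7)[OF \<phi>] representsD(1,2,5,6,7)[OF \<epsilon>] by auto
  note [simp] = representsD(8-10)[OF \<eta>] representsD(8-10)[OF \<phi>] representsD(8-10)[OF \<epsilon>]
  show ?thesis
    by (rule rep_adapt[OF rep_comp[OF rep_comp[OF rep_comp[OF
          rep_comp[OF rep_comp[OF rep_run_inv[of V e]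
            rep_tens[OF rep_id[of V] \<eta>]]
            rep_tens[OF rep_id[of V] rep_tens[OF \<phi> rep_id[of W]]]]
            rep_assoc_inv[of V X W]]
            rep_tens[OF \<epsilon> rep_id[of W]]]
            rep_lun[of W c]]])
      (simp_all add: zigR_def u v)
qed

lemma rep_zigL:
  assumes \<eta>: "represents (Unit e) (W \<odot> Z) \<eta> \<eta>'" and \<phi>: "represents Z X \<phi> \<phi>'"
    and \<epsilon>: "represents (X \<odot> V) (Unit c) \<epsilon> \<epsilon>'"
    and u: "u = val W" and v: "v = val V"
  shows "represents V W (zigL B u v \<eta> \<phi> \<epsilon>)
    (\<lambda>U. act2 W (\<epsilon>' U) \<cdot> act2 W (\<phi>' (act V U)) \<cdot> \<eta>' (act V U))"
proof -
  have [simp]: "composable Z" "composable X" "composable V" "composable W"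
    and [simp]: "wsrc Z = e" "wsrc X = e" "wtrg V = e" "wtrg Z = wtrg X" "wsrc W = wtrg X"
      "wsrc V = wtrg X" "wtrg W = e" "c = wtrg X" "Cod \<phi> = val X"
    using representsD(1,2,5,6,7)[OF \<eta>] representsD(1,2,5,6,7)[OF \<phi>] representsD(1,2,5,6,7)[OF \<epsilon>] by auto
  note [simp] = representsD(8-10)[OF \<eta>] representsD(8-10)[OF \<phi>] representsD(8-10)[OF \<epsilon>]
  show ?thesis
    by (rule rep_adapt[OF rep_comp[OF rep_comp[OF rep_comp[OF
          rep_comp[OF rep_comp[OF rep_lun_inv[of V e]
            rep_tens[OF \<eta> rep_id[of V]]]
            rep_tens[OF rep_tens[OF rep_id[of W] \<phi>] rep_id[of V]]]
            rep_assoc[of W X V]]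
            rep_tens[OF rep_id[of W] \<epsilon>]]
            rep_run[of W c]]])
      (simp_all add: zigL_def u v)
qed

text \<open>The simplifier associates composites to the right, where \<open>f \<cdot> g\<close> is no longer visible as a subterm;
  this rule applies an equation for \<open>f \<cdot> g\<close> at the head of such a composite.\<close>

lemma reassoc:
  assumes "f \<cdot> g = h" "f \<in> Arr" "g \<in> Arr" "k \<in> Arr" "Dom f = Cod g" "Dom g = Cod k"
  shows "f \<cdot> g \<cdot> k = h \<cdot> k"
  using comp2_assoc'[of k g f] assms by simp

end

section \<open>Adjunctions as natural transformations\<close>

context pivotal_bicategory
begin

lemma dual_simps [simp]:
  assumes "X \<in> Mor1 B"
  shows "X\<^sup>\<dagger> \<in> Mor1 B" "src1 B (X\<^sup>\<dagger>) = trg1 B X" "trg1 B (X\<^sup>\<dagger>) = src1 B X"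
  using dual_hom[of X "src1 B X" "trg1 B X"] assms by (auto simp: hom1_def)

text \<open>The strict families of the four (co)evaluations of \<open>val P\<close>. Here \<open>P\<close> may be composite, whereas its dual
  always counts as an atom: the dual of a composite is not the composite of the duals.\<close>

abbreviation dual_word :: "('o, 'm) word \<Rightarrow> ('o, 'm) word" where
  "dual_word P \<equiv> Atom ((val P)\<^sup>\<dagger>)"

definition evn :: "('o, 'm) word \<Rightarrow> 'm \<Rightarrow> 'c" where
  "evn P V = can (Unit (wsrc P)) V \<cdot> (ev B (val P) \<star> \<^bold>1 V) \<cdot> inv2 B (can (dual_word P \<odot> P) V)"

definition coevn :: "('o, 'm) word \<Rightarrow> 'm \<Rightarrow> 'c" where
  "coevn P V = can (P \<odot> dual_word P) V \<cdot> (coev B (val P) \<star> \<^bold>1 V) \<cdot> inv2 B (can (Unit (wtrg P)) V)"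

definition evtn :: "('o, 'm) word \<Rightarrow> 'm \<Rightarrow> 'c" where
  "evtn P V = can (Unit (wtrg P)) V \<cdot> (evt B (val P) \<star> \<^bold>1 V) \<cdot> inv2 B (can (P \<odot> dual_word P) V)"

definition coevtn :: "('o, 'm) word \<Rightarrow> 'm \<Rightarrow> 'c" where
  "coevtn P V = can (dual_word P \<odot> P) V \<cdot> (coevt B (val P) \<star> \<^bold>1 V) \<cdot> inv2 B (can (Unit (wsrc P)) V)"

lemma ev_simps [simp]:
  assumes "X \<in> Mor1 B"
  shows "ev B X \<in> Arr" "Dom (ev B X) = X\<^sup>\<dagger> \<otimes> X" "Cod (ev B X) = \<I> (src1 B X)"
    "coev B X \<in> Arr" "Dom (coev B X) = \<I> (trg1 B X)" "Cod (coev B X) = X \<otimes> X\<^sup>\<dagger>"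
    "evt B X \<in> Arr" "Dom (evt B X) = X \<otimes> X\<^sup>\<dagger>" "Cod (evt B X) = \<I> (trg1 B X)"
    "coevt B X \<in> Arr" "Dom (coevt B X) = \<I> (src1 B X)" "Cod (coevt B X) = X\<^sup>\<dagger> \<otimes> X"
  using adj_ev_coev[of X "src1 B X" "trg1 B X"] adj_evt_coevt[of X "src1 B X" "trg1 B X"] assms
  by (auto simp: adjunction_def hom1_def hom2_def)

lemma rep_ev:
  "composable P \<Longrightarrow> a = wsrc P \<Longrightarrow> represents (dual_word P \<odot> P) (Unit a) (ev B (val P)) (evn P)"
  using rep_self[of "dual_word P \<odot> P" "Unit a" "ev B (val P)"] by (simp add: evn_def[abs_def])

lemma rep_coev:
  "composable P \<Longrightarrow> b = wtrg P \<Longrightarrow> represents (Unit b) (P \<odot> dual_word P) (coev B (val P)) (coevn P)"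
  using rep_self[of "Unit b" "P \<odot> dual_word P" "coev B (val P)"] by (simp add: coevn_def[abs_def])

lemma rep_evt:
  "composable P \<Longrightarrow> b = wtrg P \<Longrightarrow> represents (P \<odot> dual_word P) (Unit b) (evt B (val P)) (evtn P)"
  using rep_self[of "P \<odot> dual_word P" "Unit b" "evt B (val P)"] by (simp add: evtn_def[abs_def])

lemma rep_coevt:
  "composable P \<Longrightarrow> a = wsrc P \<Longrightarrow> represents (Unit a) (dual_word P \<odot> P) (coevt B (val P)) (coevtn P)"
  using rep_self[of "Unit a" "dual_word P \<odot> P" "coevt B (val P)"] by (simp add: coevtn_def[abs_def])

lemma evn_simps [simp]:
  assumes "composable P" "V \<in> Mor1 B" "trg1 B V = wsrc P"
  shows "evn P V \<in> Arr" "Dom (evn P V) = (val P)\<^sup>\<dagger> \<otimes> act P V" "Cod (evn P V) = V"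
    "coevtn P V \<in> Arr" "Dom (coevtn P V) = V" "Cod (coevtn P V) = (val P)\<^sup>\<dagger> \<otimes> act P V"
  using representsD(8-10)[OF rep_ev[of P]] representsD(8-10)[OF rep_coevt[of P]] assms
  by simp_all

lemma evtn_simps [simp]:
  assumes "composable P" "V \<in> Mor1 B" "trg1 B V = wtrg P"
  shows "evtn P V \<in> Arr" "Dom (evtn P V) = act P ((val P)\<^sup>\<dagger> \<otimes> V)" "Cod (evtn P V) = V"
    "coevn P V \<in> Arr" "Dom (coevn P V) = V" "Cod (coevn P V) = act P ((val P)\<^sup>\<dagger> \<otimes> V)"
  using representsD(8-10)[OF rep_coev[of P]] representsD(8-10)[OF rep_evt[of P]] assms
  by simp_all

lemma rep_unique:
  assumes "represents P Q f \<phi>" "represents P Q f \<psi>" "V \<in> Mor1 B" "trg1 B V = wsrc P"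
  shows "\<phi> V = \<psi> V"
  by (rule invertible2_epi[of "can P V"])
    (use representsD[OF assms(1)] representsD[OF assms(2)] assms(3,4) in auto)

lemma triangles:
  assumes P [simp]: "composable P"
  shows "V \<in> Mor1 B \<Longrightarrow> trg1 B V = wtrg P \<Longrightarrow>
      evn P ((val P)\<^sup>\<dagger> \<otimes> V) \<cdot> (\<^bold>1 ((val P)\<^sup>\<dagger>) \<star> coevn P V) = \<^bold>1 ((val P)\<^sup>\<dagger> \<otimes> V)"
    and "V \<in> Mor1 B \<Longrightarrow> trg1 B V = wsrc P \<Longrightarrow>
      act2 P (evn P V) \<cdot> coevn P (act P V) = \<^bold>1 (act P V)"
    and "V \<in> Mor1 B \<Longrightarrow> trg1 B V = wsrc P \<Longrightarrow>
      evtn P (act P V) \<cdot> act2 P (coevtn P V) = \<^bold>1 (act P V)"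
    and "V \<in> Mor1 B \<Longrightarrow> trg1 B V = wtrg P \<Longrightarrow>
      (\<^bold>1 ((val P)\<^sup>\<dagger>) \<star> evtn P V) \<cdot> coevtn P ((val P)\<^sup>\<dagger> \<otimes> V) = \<^bold>1 ((val P)\<^sup>\<dagger> \<otimes> V)"
proof -
  let ?D = "dual_word P"
  have a: "adjunction B (wtrg P) (wsrc P) ((val P)\<^sup>\<dagger>) (val P) (coev B (val P)) (ev B (val P))"
    and b: "adjunction B (wsrc P) (wtrg P) (val P) ((val P)\<^sup>\<dagger>) (coevt B (val P)) (evt B (val P))"
    by (auto intro!: adj_ev_coev adj_evt_coevt simp: hom1_def)
  note rev = rep_ev[OF P refl] and rcoev = rep_coev[OF P refl]
    and revt = rep_evt[OF P refl] and rcoevt = rep_coevt[OF P refl]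
  have 1: "represents ?D ?D (\<^bold>1 (val ?D)) (\<lambda>U. evn P (act ?D U) \<cdot> act2 ?D (\<^bold>1 (act P (act ?D U)))
      \<cdot> act2 ?D (coevn P U))"
    using rep_zigR[OF rcoev rep_id[of P] rev] a by (simp add: adjunction_def)
  have 2: "represents P P (\<^bold>1 (val P)) (\<lambda>U. act2 P (evn P U) \<cdot> act2 P (\<^bold>1 (act ?D (act P U))) \<cdot>
      coevn P (act P U))"
    using rep_zigL[OF rcoev rep_id[of ?D] rev] a by (simp add: adjunction_def)
  have 3: "represents P P (\<^bold>1 (val P)) (\<lambda>U. evtn P (act P U) \<cdot> act2 P (\<^bold>1 (act ?D (act P U))) \<cdot>
      act2 P (coevtn P U))"
    using rep_zigR[OF rcoevt rep_id[of ?D] revt] b by (simp add: adjunction_def)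
  have 4: "represents ?D ?D (\<^bold>1 (val ?D)) (\<lambda>U. act2 ?D (evtn P U) \<cdot> act2 ?D (\<^bold>1 (act P (act ?D
      U))) \<cdot> coevtn P (act ?D U))"
    using rep_zigL[OF rcoevt rep_id[of P] revt] b by (simp add: adjunction_def)
  show "evn P ((val P)\<^sup>\<dagger> \<otimes> V) \<cdot> (\<^bold>1 ((val P)\<^sup>\<dagger>) \<star> coevn P V) = \<^bold>1 ((val P)\<^sup>\<dagger> \<otimes> V)"
    if "V \<in> Mor1 B" "trg1 B V = wtrg P"
    using rep_unique[OF 1 rep_id[of ?D], of V] that by simp
  show "act2 P (evn P V) \<cdot> coevn P (act P V) = \<^bold>1 (act P V)" if "V \<in> Mor1 B" "trg1 B V = wsrc P"
    using rep_unique[OF 2 rep_id[of P], of V] that by simp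
  show "evtn P (act P V) \<cdot> act2 P (coevtn P V) = \<^bold>1 (act P V)" if "V \<in> Mor1 B" "trg1 B V = wsrc P"
    using rep_unique[OF 3 rep_id[of P], of V] that by simp
  show "(\<^bold>1 ((val P)\<^sup>\<dagger>) \<star> evtn P V) \<cdot> coevtn P ((val P)\<^sup>\<dagger> \<otimes> V) = \<^bold>1 ((val P)\<^sup>\<dagger> \<otimes> V)"
    if "V \<in> Mor1 B" "trg1 B V = wtrg P"
    using rep_unique[OF 4 rep_id[of ?D], of V] that by simp
qed

lemma evn_natural:
  assumes P [simp]: "composable P" and \<phi> [simp]: "\<phi> \<in> Arr" and t: "trg1 B (Dom \<phi>) = wsrc P"
  shows "evn P (Cod \<phi>) \<cdot> (\<^bold>1 ((val P)\<^sup>\<dagger>) \<star> act2 P \<phi>) = \<phi> \<cdot> evn P (Dom \<phi>)"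
    and "coevtn P (Cod \<phi>) \<cdot> \<phi> = (\<^bold>1 ((val P)\<^sup>\<dagger>) \<star> act2 P \<phi>) \<cdot> coevtn P (Dom \<phi>)"
  using rep_natural[OF rep_ev[OF P refl], of \<phi>]
    rep_natural[OF rep_coevt[OF P refl], of \<phi>] t by auto

lemma evtn_natural:
  assumes P [simp]: "composable P" and \<phi> [simp]: "\<phi> \<in> Arr" and t: "trg1 B (Dom \<phi>) = wtrg P"
  shows "evtn P (Cod \<phi>) \<cdot> act2 P (\<^bold>1 ((val P)\<^sup>\<dagger>) \<star> \<phi>) = \<phi> \<cdot> evtn P (Dom \<phi>)"
    and "coevn P (Cod \<phi>) \<cdot> \<phi> = act2 P (\<^bold>1 ((val P)\<^sup>\<dagger>) \<star> \<phi>) \<cdot> coevn P (Dom \<phi>)"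
  using rep_natural[OF rep_evt[OF P refl], of \<phi>]
    rep_natural[OF rep_coev[OF P refl], of \<phi>] t by auto

end

section \<open>The Frobenius algebra of a 1-morphism with invertible dimension\<close>

text \<open>The letters of this locale are those of the introduction: \<open>E, N, C, D\<close> are the strict families
  of \<open>evt X\<close>, \<open>coevt X\<close>, \<open>coev X\<close>, \<open>ev X\<close>, while \<open>d\<close> is that of the dimension and \<open>K\<close> that of
  \<open>coev X \<cdot> dim\<^sup>-\<^sup>1\<close>.\<close>

locale invertible_dimension = pivotal_bicategory B
  for B :: "('o, 'm, 'c, 'x) pivotal_bicat_scheme" (structure) +
  fixes X :: 'm and a b :: 'o
  assumes X_hom: "X \<in> hom1 B a b"
    and dim_invertible: "invertible2 B (dim_r B X)"
begin

abbreviation (input) Xd :: 'm where "Xd \<equiv> X\<^sup>\<dagger>"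

abbreviation F where "F f \<equiv> \<^bold>1 X \<star> f"
abbreviation G where "G f \<equiv> \<^bold>1 Xd \<star> f"

definition E where "E = evtn (Atom X)"
definition N where "N = coevtn (Atom X)"
definition C where "C = coevn (Atom X)"
definition D where "D = evn (Atom X)"
definition d where "d V = E V \<cdot> C V"
definition K where "K V = C V \<cdot> inv2 B (d V)"

lemma X_simps [simp]: "X \<in> Mor1 B" "src1 B X = a" "trg1 B X = b" "a \<in> Obj B" "b \<in> Obj B"
  using X_hom src1_trg1[of X] by (auto simp: hom1_def)

lemma ED_simps [simp]:
  assumes "V \<in> Mor1 B"
  shows "trg1 B V = b \<Longrightarrow> E V \<in> Arr" "trg1 B V = b \<Longrightarrow> Dom (E V) = X \<otimes> (Xd \<otimes> V)"
    "trg1 B V = b \<Longrightarrow> Cod (E V) = V"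
    "trg1 B V = b \<Longrightarrow> C V \<in> Arr" "trg1 B V = b \<Longrightarrow> Cod (C V) = X \<otimes> (Xd \<otimes> V)"
    "trg1 B V = b \<Longrightarrow> Dom (C V) = V"
    "trg1 B V = a \<Longrightarrow> D V \<in> Arr" "trg1 B V = a \<Longrightarrow> Dom (D V) = Xd \<otimes> (X \<otimes> V)"
    "trg1 B V = a \<Longrightarrow> Cod (D V) = V"
    "trg1 B V = a \<Longrightarrow> N V \<in> Arr" "trg1 B V = a \<Longrightarrow> Cod (N V) = Xd \<otimes> (X \<otimes> V)"
    "trg1 B V = a \<Longrightarrow> Dom (N V) = V"
  using evn_simps[of "Atom X" V] evtn_simps[of "Atom X" V] assms
  by (auto simp: E_def C_def D_def N_def)

lemma E_nat:
  assumes "\<phi> \<in> Arr" "trg1 B (Dom \<phi>) = b" "W = Cod \<phi>"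
  shows "E W \<cdot> F (G \<phi>) = \<phi> \<cdot> E (Dom \<phi>)"
  using evtn_natural(1)[of "Atom X" \<phi>] assms by (simp add: E_def)

lemma XdE_N: "V \<in> Mor1 B \<Longrightarrow> trg1 B V = b \<Longrightarrow> G (E V) \<cdot> N (Xd \<otimes> V) = \<^bold>1 (Xd \<otimes> V)"
  using triangles(4)[of "Atom X" V] by (simp add: E_def N_def)

lemma E_XN: "V \<in> Mor1 B \<Longrightarrow> trg1 B V = a \<Longrightarrow> E (X \<otimes> V) \<cdot> F (N V) = \<^bold>1 (X \<otimes> V)"
  using triangles(3)[of "Atom X" V] by (simp add: E_def N_def)

lemma D_XdC: "V \<in> Mor1 B \<Longrightarrow> trg1 B V = b \<Longrightarrow> D (Xd \<otimes> V) \<cdot> G (C V) = \<^bold>1 (Xd \<otimes> V)"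
  using triangles(1)[of "Atom X" V] by (simp add: D_def C_def)

lemma XD_C: "V \<in> Mor1 B \<Longrightarrow> trg1 B V = a \<Longrightarrow> F (D V) \<cdot> C (X \<otimes> V) = \<^bold>1 (X \<otimes> V)"
  using triangles(2)[of "Atom X" V] by (simp add: D_def C_def)

lemma rep_E: "represents (Atom X \<odot> Atom Xd) (Unit b) (evt B X) E"
  using rep_evt[of "Atom X" b] by (simp add: E_def)

lemma rep_C: "represents (Unit b) (Atom X \<odot> Atom Xd) (coev B X) C"
  using rep_coev[of "Atom X" b] by (simp add: C_def)

lemma rep_D: "represents (Atom Xd \<odot> Atom X) (Unit a) (ev B X) D"
  using rep_ev[of "Atom X" a] by (simp add: D_def)

lemma rep_N: "represents (Unit a) (Atom Xd \<odot> Atom X) (coevt B X) N"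
  using rep_coevt[of "Atom X" a] by (simp add: N_def)

lemma rep_dim: "represents (Unit b) (Unit b) (dim_r B X) d"
  using rep_comp[OF rep_C rep_E] by (simp add: dim_r_def d_def[abs_def])

lemma d_simps [simp]:
  assumes "V \<in> Mor1 B" "trg1 B V = b"
  shows "d V \<in> Arr" "Dom (d V) = V" "Cod (d V) = V" "invertible2 B (d V)"
  using assms rep_invertible[OF rep_dim dim_invertible, of V] by (auto simp: d_def)

lemma d_nat:
  assumes "\<phi> \<in> Arr" "trg1 B (Dom \<phi>) = b"
  shows "d (Cod \<phi>) \<cdot> \<phi> = \<phi> \<cdot> d (Dom \<phi>)"
  using rep_natural[OF rep_dim, of \<phi>] assms by auto

lemma rep_K: "represents (Unit b) (Atom X \<odot> Atom Xd) (coev B X \<cdot> inv2 B (dim_r B X)) K"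
proof -
  have "represents (Unit b) (Unit b) (inv2 B (dim_r B X)) (\<lambda>V. inv2 B (d V))"
    by (rule rep_inv[OF rep_dim dim_invertible]) (auto intro: inverse2_inv2)
  from rep_comp[OF this rep_C] show ?thesis by (simp add: K_def[abs_def])
qed

lemma K_simps [simp]:
  assumes "V \<in> Mor1 B" "trg1 B V = b"
  shows "K V \<in> Arr" "Dom (K V) = V" "Cod (K V) = X \<otimes> (Xd \<otimes> V)"
  using assms by (auto simp: K_def)

lemma E_K: "V \<in> Mor1 B \<Longrightarrow> trg1 B V = b \<Longrightarrow> E V \<cdot> K V = \<^bold>1 V"
  using reassoc[of "E V" "C V" "d V" "inv2 B (d V)"] by (simp add: K_def d_def[symmetric])

lemma K_nat:
  assumes "\<phi> \<in> Arr" "trg1 B (Dom \<phi>) = b" "V = Dom \<phi>"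
  shows "F (G \<phi>) \<cdot> K V = K (Cod \<phi>) \<cdot> \<phi>"
  using rep_natural[OF rep_K, of \<phi>] assms by simp

text \<open>The factor \<open>dim\<^sup>-\<^sup>1\<close> in the comultiplication cancels the factor \<open>dim\<close> in the counit, since \<open>d\<close>, being
  natural, slides along \<open>K\<close>.\<close>

lemma d_K:
  assumes [simp]: "V \<in> Mor1 B" "trg1 B V = b"
  shows "d (X \<otimes> (Xd \<otimes> V)) \<cdot> K V = C V"
proof -
  have "d (X \<otimes> (Xd \<otimes> V)) \<cdot> K V = K V \<cdot> d V" using d_nat[of "K V"] by simp
  also have "\<dots> = C V" by (simp add: K_def)
  finally show ?thesis .
qed

abbreviation A where "A \<equiv> end_alg B X"
abbreviation (input) M where "M \<equiv> Atom Xd \<odot> Atom X"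

lemma acar_A [simp]: "acar A = Xd \<otimes> X"
  by (simp add: end_alg_def)

text \<open>The structure of \<open>A\<close> in strict form: the multiplication is \<open>G E F\<close>, the comultiplication \<open>G K F\<close>.\<close>

lemma rep_mult:
  "represents (M \<odot> M) M (mult A) (\<lambda>V. G (E (X \<otimes> V)))"
  by (rule rep_adapt[OF rep_comp[OF rep_comp[OF rep_comp[OF
        rep_assoc[of "Atom Xd" "Atom X" M]
        rep_tens[OF rep_id[of "Atom Xd"] rep_assoc_inv[of "Atom X" "Atom Xd" "Atom X"]]]
        rep_tens[OF rep_id[of "Atom Xd"] rep_tens[OF rep_E rep_id[of "Atom X"]]]]
        rep_tens[OF rep_id[of "Atom Xd"] rep_lun[of "Atom X" b]]]])
    (simp_all add: end_alg_def)

lemma rep_munit: "represents (Unit a) M (munit A) N"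
  using rep_N by (simp add: end_alg_def)

lemma rep_comult:
  "represents M (M \<odot> M) (comult A) (\<lambda>V. G (K (X \<otimes> V)))"
  by (rule rep_adapt[OF rep_comp[OF rep_comp[OF rep_comp[OF
        rep_tens[OF rep_id[of "Atom Xd"] rep_lun_inv[of "Atom X" b]]
        rep_tens[OF rep_id[of "Atom Xd"] rep_tens[OF rep_K rep_id[of "Atom X"]]]]
        rep_tens[OF rep_id[of "Atom Xd"] rep_assoc[of "Atom X" "Atom Xd" "Atom X"]]]
        rep_assoc_inv[of "Atom Xd" "Atom X" M]]])
    (simp_all add: end_alg_def)

lemma rep_counit:
  "represents M (Unit a) (counit A) (\<lambda>V. D V \<cdot> G (d (X \<otimes> V)))"
  by (rule rep_adapt[OF rep_comp[OF rep_comp[OF rep_comp[OF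
        rep_tens[OF rep_id[of "Atom Xd"] rep_lun_inv[of "Atom X" b]]
        rep_tens[OF rep_id[of "Atom Xd"] rep_tens[OF rep_dim rep_id[of "Atom X"]]]]
        rep_tens[OF rep_id[of "Atom Xd"] rep_lun[of "Atom X" b]]]
        rep_D]])
    (simp_all add: end_alg_def)

lemma end_alg_simps [simp]:
  "mult A \<in> Arr" "Dom (mult A) = (Xd \<otimes> X) \<otimes> (Xd \<otimes> X)" "Cod (mult A) = Xd \<otimes> X"
  "comult A \<in> Arr" "Cod (comult A) = (Xd \<otimes> X) \<otimes> (Xd \<otimes> X)" "Dom (comult A) = Xd \<otimes> X"
  "munit A \<in> Arr" "Dom (munit A) = \<I> a" "Cod (munit A) = Xd \<otimes> X"
  "counit A \<in> Arr" "Dom (counit A) = Xd \<otimes> X" "Cod (counit A) = \<I> a"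
  using representsD(3-5)[OF rep_mult] representsD(3-5)[OF rep_munit]
    representsD(3-5)[OF rep_comult] representsD(3-5)[OF rep_counit] by simp_all

lemma algebra_end_alg: "algebra B a A"
  unfolding algebra_def Let_def acar_A
proof (intro conjI)
  let ?M = "Xd \<otimes> X"
  note m = rep_mult and u = rep_munit and i = rep_id[of M]
  show "?M \<in> hom1 B a a" by (simp add: hom1_def)
  show "mult A \<in> hom2 B (?M \<otimes> ?M) ?M" by (simp add: hom2_def)
  show "munit A \<in> hom2 B (\<I> a) ?M" by (simp add: hom2_def)
  have e: "E V \<cdot> F (G (E V)) = E V \<cdot> E (X \<otimes> (Xd \<otimes> V))"
    if "V \<in> Mor1 B" "trg1 B V = b" for V using E_nat[of "E V" V] that by simp
  show "mult A \<cdot> (mult A \<star> \<^bold>1 ?M) = mult A \<cdot> (\<^bold>1 ?M \<star> mult A) \<cdot> \<alpha> ?M ?M ?M"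
    by (rule rep_equal[OF rep_comp[OF rep_tens[OF m i] m]
          rep_comp[OF rep_comp[OF rep_assoc[of M M M] rep_tens[OF i m]] m]])
      (simp_all add: whiskerL[symmetric] e)
  show "mult A \<cdot> (munit A \<star> \<^bold>1 ?M) = \<l> ?M"
    by (rule rep_equal[OF rep_comp[OF rep_tens[OF u i] m] rep_lun[of M a]])
      (simp_all add: XdE_N)
  show "mult A \<cdot> (\<^bold>1 ?M \<star> munit A) = \<r> ?M"
    by (rule rep_equal[OF rep_comp[OF rep_tens[OF i u] m] rep_run[of M a]])
      (simp_all add: whiskerL[symmetric] E_XN)
qed

lemma coalgebra_end_alg: "coalgebra B a A"
  unfolding coalgebra_def Let_def acar_A
proof (intro conjI)
  let ?M = "Xd \<otimes> X"
  note m = rep_comult and u = rep_counit and i = rep_id[of M]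
  show "?M \<in> hom1 B a a" by (simp add: hom1_def)
  show "comult A \<in> hom2 B ?M (?M \<otimes> ?M)" by (simp add: hom2_def)
  show "counit A \<in> hom2 B ?M (\<I> a)" by (simp add: hom2_def)
  have e: "F (G (K V)) \<cdot> K V = K (X \<otimes> (Xd \<otimes> V)) \<cdot> K V"
    if "V \<in> Mor1 B" "trg1 B V = b" for V using K_nat[of "K V" V] that by simp
  show "\<alpha> ?M ?M ?M \<cdot> (comult A \<star> \<^bold>1 ?M) \<cdot> comult A = (\<^bold>1 ?M \<star> comult A) \<cdot> comult A"
    by (rule rep_equal[OF rep_comp[OF rep_comp[OF m rep_tens[OF m i]]
          rep_assoc[of M M M]] rep_comp[OF m rep_tens[OF i m]]])
      (simp_all add: whiskerL[symmetric] e)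
  show "\<l> ?M \<cdot> (counit A \<star> \<^bold>1 ?M) \<cdot> comult A = \<^bold>1 ?M"
    by (rule rep_equal[OF rep_comp[OF rep_comp[OF m rep_tens[OF u i]]
          rep_lun[of M a]] rep_id[of M]])
      (simp_all add: whiskerL[symmetric] d_K D_XdC)
  have c: "F (D V \<cdot> G (d (X \<otimes> V))) \<cdot> K (X \<otimes> V) = \<^bold>1 (X \<otimes> V)"
    if [simp]: "V \<in> Mor1 B" "trg1 B V = a" for V
  proof -
    have "F (G (d (X \<otimes> V))) \<cdot> K (X \<otimes> V) = K (X \<otimes> V) \<cdot> d (X \<otimes> V)"
      using K_nat[of "d (X \<otimes> V)"] by simp
    also have "\<dots> = C (X \<otimes> V)" by (simp add: K_def)
    finally show ?thesis using XD_C by (simp add: whiskerL)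
  qed
  show "\<r> ?M \<cdot> (\<^bold>1 ?M \<star> counit A) \<cdot> comult A = \<^bold>1 ?M"
    by (rule rep_equal[OF rep_comp[OF rep_comp[OF m rep_tens[OF i u]]
          rep_run[of M a]] rep_id[of M]])
      (simp_all add: whiskerL[symmetric] c)
qed

lemma frobenius_end_alg: "frobenius_algebra B a A"
  unfolding frobenius_algebra_def Let_def acar_A
proof (intro conjI algebra_end_alg coalgebra_end_alg)
  let ?M = "Xd \<otimes> X"
  note m = rep_mult and c = rep_comult and i = rep_id[of M]
  have e: "F (G (E V)) \<cdot> K (X \<otimes> (Xd \<otimes> V)) = K V \<cdot> E V"
    "E (X \<otimes> (Xd \<otimes> V)) \<cdot> F (G (K V)) = K V \<cdot> E V"
    if "V \<in> Mor1 B" "trg1 B V = b" for V using K_nat[of "E V"] E_nat[of "K V"] that by simp_all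
  show "(\<^bold>1 ?M \<star> mult A) \<cdot> \<alpha> ?M ?M ?M \<cdot> (comult A \<star> \<^bold>1 ?M) = comult A \<cdot> mult A"
    by (rule rep_equal[OF rep_comp[OF rep_comp[OF rep_tens[OF c i]
          rep_assoc[of M M M]] rep_tens[OF i m]] rep_comp[OF m c]])
      (simp_all add: whiskerL[symmetric] e)
  show "comult A \<cdot> mult A = (mult A \<star> \<^bold>1 ?M) \<cdot> inv2 B (\<alpha> ?M ?M ?M) \<cdot> (\<^bold>1 ?M \<star> comult A)"
    by (rule rep_equal[OF rep_comp[OF m c] rep_comp[OF rep_comp[OF
          rep_tens[OF i c] rep_assoc_inv[of M M M]] rep_tens[OF m i]]])
      (simp_all add: whiskerL[symmetric] e)
qed

lemma separable_end_alg: "separable B A"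
  unfolding separable_def
  by (rule rep_equal[OF rep_comp[OF rep_comult rep_mult] rep_id[of M]])
    (simp_all add: whiskerL[symmetric] E_K)

end

section \<open>Duals of composites\<close>

context pivotal_bicategory
begin

text \<open>The two pivotality axioms are put into strict form: first that a 2-morphism has only one transpose, then
  (\<open>dual_cmp_coevt\<close>) that the dual of a composite is identified with the composite of the
  duals in only one way.\<close>

lemma dual_mor_natural:
  assumes \<phi>: "represents Z X \<phi> \<phi>'" and U: "U \<in> Mor1 B" "trg1 B U = wtrg Z"
  shows "(\<^bold>1 ((val Z)\<^sup>\<dagger>) \<star> evtn X U) \<cdot> (\<^bold>1 ((val Z)\<^sup>\<dagger>) \<star> \<phi>' ((val X)\<^sup>\<dagger> \<otimes> U)) \<cdot> coevtn Z ((val X)\<^sup>\<dagger>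
      \<otimes> U) =
    evn X ((val Z)\<^sup>\<dagger> \<otimes> U) \<cdot> (\<^bold>1 ((val X)\<^sup>\<dagger>) \<star> \<phi>' ((val Z)\<^sup>\<dagger> \<otimes> U)) \<cdot> (\<^bold>1 ((val X)\<^sup>\<dagger>) \<star> coevn Z U)"
proof -
  note [simp] = representsD(1-7)[OF \<phi>]
  have e: "zigL B ((val Z)\<^sup>\<dagger>) ((val X)\<^sup>\<dagger>) (coevt B (val Z)) \<phi> (evt B (val X)) =
    zigR B ((val Z)\<^sup>\<dagger>) ((val X)\<^sup>\<dagger>) (coev B (val Z)) \<phi> (ev B (val X))"
    by (rule dual_mor[of _ "wsrc Z" "wtrg Z"]) (auto simp: hom1_def hom2_def)
  have L: "represents (dual_word X) (dual_word Z)
      (zigL B ((val Z)\<^sup>\<dagger>) ((val X)\<^sup>\<dagger>) (coevt B (val Z)) \<phi> (evt B (val X)))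
      (\<lambda>U. act2 (dual_word Z) (evtn X U) \<cdot> act2 (dual_word Z) (\<phi>' (act (dual_word X) U)) \<cdot>
        coevtn Z (act (dual_word X) U))"
    by (rule rep_zigL[OF rep_coevt[of Z "wsrc Z"] \<phi> rep_evt[of X "wtrg X"]]) auto
  have R: "represents (dual_word X) (dual_word Z)
      (zigR B ((val Z)\<^sup>\<dagger>) ((val X)\<^sup>\<dagger>) (coev B (val Z)) \<phi> (ev B (val X)))
      (\<lambda>U. evn X (act (dual_word Z) U) \<cdot> act2 (dual_word X) (\<phi>' (act (dual_word Z) U)) \<cdot>
        act2 (dual_word X) (coevn Z U))"
    by (rule rep_zigR[OF rep_coev[of Z "wtrg Z"] \<phi> rep_ev[of X "wsrc X"]]) auto
  show ?thesis using rep_unique[OF L R[folded e], of U] U by simp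
qed

definition nested_coev :: "('o, 'm) word \<Rightarrow> ('o, 'm) word \<Rightarrow> 'm \<Rightarrow> 'c" where
  "nested_coev Q P V = act2 Q (coevn P ((val Q)\<^sup>\<dagger> \<otimes> V)) \<cdot> coevn Q V"

definition nested_coevt :: "('o, 'm) word \<Rightarrow> ('o, 'm) word \<Rightarrow> 'm \<Rightarrow> 'c" where
  "nested_coevt Q P V = (\<^bold>1 ((val P)\<^sup>\<dagger>) \<star> coevtn Q (act P V)) \<cdot> coevtn P V"

text \<open>This is the family of the canonical 2-morphism \<open>(Y \<otimes> X)\<^sup>\<dagger> \<Rightarrow> X\<^sup>\<dagger> \<otimes> Y\<^sup>\<dagger>\<close> with \<open>Y = val Q\<close> and \<open>X = val P\<close>.\<close>

definition dual_cmp :: "('o, 'm) word \<Rightarrow> ('o, 'm) word \<Rightarrow> 'm \<Rightarrow> 'c" where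
  "dual_cmp Q P V = evn (Q \<odot> P) ((val P)\<^sup>\<dagger> \<otimes> ((val Q)\<^sup>\<dagger> \<otimes> V)) \<cdot>
     (\<^bold>1 ((val Q \<otimes> val P)\<^sup>\<dagger>) \<star> nested_coev Q P V)"

context
  fixes P Q :: "('o, 'm) word"
  assumes PQ [simp]: "composable P" "composable Q" "wsrc Q = wtrg P"
begin

abbreviation (input) Pd where "Pd \<equiv> (val P)\<^sup>\<dagger>"
abbreviation (input) Qd where "Qd \<equiv> (val Q)\<^sup>\<dagger>"
abbreviation (input) PdQd where "PdQd V \<equiv> Pd \<otimes> (Qd \<otimes> V)"
abbreviation (input) Td where "Td \<equiv> (val Q \<otimes> val P)\<^sup>\<dagger>"

lemma rep_nested_coev:
  "represents (Unit (wtrg Q)) ((Q \<odot> P) \<odot> (dual_word P \<odot> dual_word Q)) (coev_nest B (val Q) (val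
      P)) (nested_coev Q P)"
  by (rule rep_adapt[OF rep_comp[OF rep_comp[OF rep_comp[OF rep_comp[OF
        rep_coev[of Q "wtrg Q"]
        rep_tens[OF rep_run_inv[of Q "wsrc Q"] rep_id[of "dual_word Q"]]]
        rep_tens[OF rep_tens[OF rep_id[of Q] rep_coev[of P "wsrc Q"]] rep_id[of "dual_word Q"]]]
        rep_tens[OF rep_assoc_inv[of Q P "dual_word P"] rep_id[of "dual_word Q"]]]
        rep_assoc[of "Q \<odot> P" "dual_word P" "dual_word Q"]]])
    (simp_all add: coev_nest_def nested_coev_def)

lemma rep_nested_coevt:
  "represents (Unit (wsrc P)) ((dual_word P \<odot> dual_word Q) \<odot> (Q \<odot> P)) (coevt_nest B (val Q) (val
      P)) (nested_coevt Q P)"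
  by (rule rep_adapt[OF rep_comp[OF rep_comp[OF rep_comp[OF rep_comp[OF
        rep_coevt[of P "wsrc P"]
        rep_tens[OF rep_id[of "dual_word P"] rep_lun_inv[of P "wtrg P"]]]
        rep_tens[OF rep_id[of "dual_word P"] rep_tens[OF rep_coevt[of Q "wtrg P"] rep_id[of P]]]]
        rep_tens[OF rep_id[of "dual_word P"] rep_assoc[of "dual_word Q" Q P]]]
        rep_assoc_inv[of "dual_word P" "dual_word Q" "Q \<odot> P"]]])
    (simp_all add: coevt_nest_def nested_coevt_def)

lemma nested_coev_simps [simp]:
  assumes "V \<in> Mor1 B"
  shows "trg1 B V = wtrg Q \<Longrightarrow> nested_coev Q P V \<in> Arr" "trg1 B V = wtrg Q \<Longrightarrow> Dom (nested_coev Q P V) = V"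
    "trg1 B V = wtrg Q \<Longrightarrow> Cod (nested_coev Q P V) = act Q (act P (PdQd V))"
    "trg1 B V = wsrc P \<Longrightarrow> nested_coevt Q P V \<in> Arr" "trg1 B V = wsrc P \<Longrightarrow> Dom (nested_coevt Q P V) = V"
    "trg1 B V = wsrc P \<Longrightarrow> Cod (nested_coevt Q P V) = PdQd (act Q (act P V))"
  using assms by (auto simp: nested_coev_def nested_coevt_def)

lemma nested_coev_natural:
  assumes "\<phi> \<in> Arr" "trg1 B (Dom \<phi>) = wtrg Q"
  shows "nested_coev Q P (Cod \<phi>) \<cdot> \<phi> =
    act2 Q (act2 P (\<^bold>1 Pd \<star> (\<^bold>1 Qd \<star> \<phi>))) \<cdot> nested_coev Q P (Dom \<phi>)"
  using rep_natural[OF rep_nested_coev, of \<phi>] assms by simp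

lemma nested_coevt_natural:
  assumes "\<phi> \<in> Arr" "trg1 B (Dom \<phi>) = wsrc P"
  shows "nested_coevt Q P (Cod \<phi>) \<cdot> \<phi> =
    (\<^bold>1 Pd \<star> (\<^bold>1 Qd \<star> act2 Q (act2 P \<phi>))) \<cdot> nested_coevt Q P (Dom \<phi>)"
  using rep_natural[OF rep_nested_coevt, of \<phi>] assms by simp

lemma rep_dual_cmp:
  "represents (dual_word (Q \<odot> P)) (dual_word P \<odot> dual_word Q)
     (zigR B (Pd \<otimes> Qd) Td (coev_nest B (val Q) (val P)) (\<^bold>1 (val Q \<otimes> val P)) (ev B (val Q \<otimes> val P)))
     (dual_cmp Q P)"
  by (rule rep_adapt[OF rep_zigR[OF rep_nested_coev rep_id[of "Q \<odot> P"]
        rep_ev[of "Q \<odot> P" "wsrc P"], where v = Td]])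
    (simp_all add: dual_cmp_def)

lemma dual_cmp_simps [simp]:
  assumes "V \<in> Mor1 B" "trg1 B V = wtrg Q"
  shows "dual_cmp Q P V \<in> Arr" "Dom (dual_cmp Q P V) = Td \<otimes> V" "Cod (dual_cmp Q P V) = PdQd V"
  using representsD(8-10)[OF rep_dual_cmp, of V] assms by auto

lemma dual_cmp_natural:
  assumes "\<phi> \<in> Arr" "trg1 B (Dom \<phi>) = wtrg Q"
  shows "dual_cmp Q P (Cod \<phi>) \<cdot> (\<^bold>1 Td \<star> \<phi>) = (\<^bold>1 Pd \<star> (\<^bold>1 Qd \<star> \<phi>)) \<cdot> dual_cmp Q P (Dom \<phi>)"
  using rep_natural[OF rep_dual_cmp, of \<phi>] assms by simp

lemma dual_cmp_coevt:
  assumes V: "V \<in> Mor1 B" "trg1 B V = wtrg Q"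
  shows "dual_cmp Q P V = (\<^bold>1 Pd \<star> (\<^bold>1 Qd \<star> evtn (Q \<odot> P) V)) \<cdot> nested_coevt Q P (Td \<otimes> V)"
proof -
  have "represents (dual_word (Q \<odot> P)) (dual_word P \<odot> dual_word Q)
     (zigL B (Pd \<otimes> Qd) Td (coevt_nest B (val Q) (val P)) (\<^bold>1 (val Q \<otimes> val P)) (evt B (val Q \<otimes> val P)))
     (\<lambda>V. (\<^bold>1 Pd \<star> (\<^bold>1 Qd \<star> evtn (Q \<odot> P) V)) \<cdot> nested_coevt Q P (Td \<otimes> V))"
    by (rule rep_adapt[OF rep_zigL[OF rep_nested_coevt rep_id[of "Q \<odot> P"]
          rep_evt[of "Q \<odot> P" "wtrg Q"], where v = Td]])
      simp_all
  moreover have "zigL B (Pd \<otimes> Qd) Td (coevt_nest B (val Q) (val P)) (\<^bold>1 (val Q \<otimes> val P)) (evt B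
      (val Q \<otimes> val P)) =
    zigR B (Pd \<otimes> Qd) Td (coev_nest B (val Q) (val P)) (\<^bold>1 (val Q \<otimes> val P)) (ev B (val Q \<otimes> val P))"
    by (rule dual_tens[of _ "wsrc P" "wtrg P" _ "wtrg Q"]) (auto simp: hom1_def)
  ultimately show ?thesis using rep_unique[OF rep_dual_cmp] V by simp
qed

text \<open>The comparison carries both coevaluations of the composite to the nested ones. For \<open>coev\<close> this is a
  triangle identity applied to the definition through \<open>ev\<close>; for \<open>coevt\<close>, in the lemma after this one, the
  description through \<open>evt\<close> is needed, and this is where pivotality enters.\<close>

lemma dual_cmp_coevn:
  assumes [simp]: "V \<in> Mor1 B" "trg1 B V = wtrg Q"
  shows "act2 Q (act2 P (dual_cmp Q P V)) \<cdot> coevn (Q \<odot> P) V = nested_coev Q P V"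
proof -
  let ?T = "Q \<odot> P"
  have "act2 ?T (dual_cmp Q P V) \<cdot> coevn ?T V =
    act2 ?T (evn ?T (PdQd V)) \<cdot> act2 ?T (\<^bold>1 Td \<star> nested_coev Q P V) \<cdot> coevn ?T V"
    by (simp add: dual_cmp_def act2_comp)
  also have "act2 ?T (\<^bold>1 Td \<star> nested_coev Q P V) \<cdot> coevn ?T V = coevn ?T (act ?T (PdQd V)) \<cdot>
      nested_coev Q P V"
    using evtn_natural(2)[of ?T "nested_coev Q P V"] by simp
  also have "act2 ?T (evn ?T (PdQd V)) \<cdot> \<dots> = \<^bold>1 (act ?T (PdQd V)) \<cdot> nested_coev Q P V"
    by (rule reassoc[OF triangles(2)[of ?T "PdQd V"]]) auto
  finally show ?thesis by simp
qed

lemma dual_cmp_coevtn: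
  assumes [simp]: "V \<in> Mor1 B" "trg1 B V = wsrc P"
  shows "dual_cmp Q P (act Q (act P V)) \<cdot> coevtn (Q \<odot> P) V = nested_coevt Q P V"
proof -
  let ?T = "Q \<odot> P"
  let ?W = "\<lambda>f. \<^bold>1 Pd \<star> (\<^bold>1 Qd \<star> f)"
  have "dual_cmp Q P (act Q (act P V)) \<cdot> coevtn (Q \<odot> P) V =
    ?W (evtn ?T (act ?T V)) \<cdot> nested_coevt Q P (Td \<otimes> act ?T V) \<cdot> coevtn ?T V"
    by (simp add: dual_cmp_coevt)
  also have "nested_coevt Q P (Td \<otimes> act ?T V) \<cdot> coevtn ?T V = ?W (act2 ?T (coevtn ?T V)) \<cdot>
      nested_coevt Q P V"
    using nested_coevt_natural[of "coevtn ?T V"] by simp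
  also have "?W (evtn ?T (act ?T V)) \<cdot> \<dots> = ?W (\<^bold>1 (act ?T V)) \<cdot> nested_coevt Q P V"
    by (rule reassoc) (use triangles(3)[of ?T V] in \<open>simp_all add: whiskerL[symmetric]\<close>)
  finally show ?thesis by simp
qed

lemma nested_coev_triangle:
  assumes [simp]: "W \<in> Mor1 B" "trg1 B W = wsrc P"
  shows "act2 Q (act2 P (evn P W \<cdot> (\<^bold>1 Pd \<star> evn Q (act P W)))) \<cdot> nested_coev Q P (act Q (act P W)) =
    \<^bold>1 (act Q (act P W))"
proof -
  let ?QW = "Qd \<otimes> act Q (act P W)"
  have "act2 P (evn P W \<cdot> (\<^bold>1 Pd \<star> evn Q (act P W))) \<cdot> coevn P ?QW =
    act2 P (evn P W) \<cdot> act2 P (\<^bold>1 Pd \<star> evn Q (act P W)) \<cdot> coevn P ?QW"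
    by (simp add: act2_comp)
  also have "act2 P (\<^bold>1 Pd \<star> evn Q (act P W)) \<cdot> coevn P ?QW = coevn P (act P W) \<cdot> evn Q (act P W)"
    using evtn_natural(2)[of P "evn Q (act P W)"] by simp
  also have "act2 P (evn P W) \<cdot> \<dots> = \<^bold>1 (act P W) \<cdot> evn Q (act P W)"
    by (rule reassoc[OF triangles(2)[of P W]]) auto
  finally have e: "act2 P (evn P W \<cdot> (\<^bold>1 Pd \<star> evn Q (act P W))) \<cdot> coevn P ?QW = evn Q (act P W)"
    by simp
  have "act2 Q (act2 P (evn P W \<cdot> (\<^bold>1 Pd \<star> evn Q (act P W)))) \<cdot> nested_coev Q P (act Q (act P W)) =
    act2 Q (act2 P (evn P W \<cdot> (\<^bold>1 Pd \<star> evn Q (act P W))) \<cdot> coevn P ?QW) \<cdot> coevn Q (act Q (act P W))"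
    by (simp add: nested_coev_def act2_comp)
  also have "\<dots> = \<^bold>1 (act Q (act P W))"
    using triangles(2)[of Q "act P W"] e by simp
  finally show ?thesis .
qed

text \<open>A left inverse \<open>v\<close> of the comparison is the transpose, in the other direction, along the nested
  evaluation \<open>e\<close>.\<close>

lemma dual_cmp_mono:
  assumes V [simp]: "V \<in> Mor1 B" "trg1 B V = wtrg Q"
    and f: "dual_cmp Q P V \<cdot> f = dual_cmp Q P V \<cdot> g" "f \<in> Arr" "g \<in> Arr" "Cod f = Td \<otimes> V" "Cod g =
        Td \<otimes> V"
  shows "f = g"
proof -
  let ?T = "Q \<odot> P" and ?W = "Td \<otimes> V"
  define e where "e = evn P ?W \<cdot> (\<^bold>1 Pd \<star> evn Q (act P ?W))"
  (* e evaluates the nested duals against Q and P, so v is a map back to the dual of the composite *)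
  define v where "v = e \<cdot> (\<^bold>1 Pd \<star> (\<^bold>1 Qd \<star> coevn ?T V))"
  have e_simps [simp]: "e \<in> Arr" "Dom e = PdQd (act Q (act P ?W))" "Cod e = ?W"
    by (simp_all add: e_def)
  have v_simps [simp]: "v \<in> Arr" "Dom v = PdQd V" "Cod v = ?W"
    by (simp_all add: v_def)
  have "act2 ?T v \<cdot> nested_coev Q P V = act2 ?T e \<cdot>
      act2 ?T (\<^bold>1 Pd \<star> (\<^bold>1 Qd \<star> coevn ?T V)) \<cdot> nested_coev Q P V"
    by (simp add: v_def act2_comp)
  also have "\<dots> = act2 ?T e \<cdot> nested_coev Q P (act ?T ?W) \<cdot> coevn ?T V"
    using nested_coev_natural[of "coevn ?T V"] by simp
  also have "\<dots> = \<^bold>1 (act ?T ?W) \<cdot> coevn ?T V"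
    by (rule reassoc) (use nested_coev_triangle[of ?W, folded e_def] in simp_all)
  finally have n: "act2 Q (act2 P v) \<cdot> nested_coev Q P V = coevn ?T V" by simp
  have "v \<cdot> dual_cmp Q P V = (v \<cdot> evn ?T (PdQd V)) \<cdot> (\<^bold>1 Td \<star> nested_coev Q P V)"
    by (simp add: dual_cmp_def)
  also have "v \<cdot> evn ?T (PdQd V) = evn ?T ?W \<cdot> (\<^bold>1 Td \<star> act2 Q (act2 P v))"
    using evn_natural(1)[of ?T v] by simp
  also have "(\<dots>) \<cdot> (\<^bold>1 Td \<star> nested_coev Q P V) = evn ?T ?W \<cdot> (\<^bold>1 Td \<star> coevn ?T V)"
    by (simp add: whiskerL[symmetric] n)
  also have "\<dots> = \<^bold>1 ?W" using triangles(1)[of ?T V] by simp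
  finally have v: "v \<cdot> dual_cmp Q P V = \<^bold>1 ?W" .
  have "f = v \<cdot> dual_cmp Q P V \<cdot> f" by (subst reassoc[OF v]) (use f(2-) in auto)
  also have "\<dots> = v \<cdot> dual_cmp Q P V \<cdot> g" by (simp only: f(1))
  also have "\<dots> = g" by (subst reassoc[OF v]) (use f(2-) in auto)
  finally show "f = g" .
qed

end

section \<open>Evaluations of the unit agree\<close>

text \<open>Let \<open>J\<close> be the dual of the unit and let \<open>c\<close>, \<open>ct\<close> be the inverses of its two evaluations \<open>p\<close>, \<open>q\<close>.
  The 2-morphism \<open>\<l> : I \<otimes> I \<Rightarrow> I\<close> has a single transpose \<open>J \<Rightarrow> (I \<otimes> I)\<^sup>\<dagger>\<close>. Followed by the comparison
  with \<open>J \<otimes> J\<close>, it is \<open>ct \<otimes> J\<close> when computed with \<open>q\<close> and \<open>ct\<close>, and \<open>c \<otimes> J\<close> when computed with \<open>p\<close>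
  and \<open>c\<close>. Cancelling the invertible \<open>p\<close> gives \<open>ct = c\<close>, hence \<open>q = p\<close>.\<close>

lemma unit_evaluations:
  assumes V [simp]: "V \<in> Mor1 B"
  shows "evtn (Unit (trg1 B V)) V = evn (Unit (trg1 B V)) V"
    and "coevn (Unit (trg1 B V)) V \<cdot> evn (Unit (trg1 B V)) V = \<^bold>1 ((\<I> (trg1 B V))\<^sup>\<dagger> \<otimes> V)"
    and "evn (Unit (trg1 B V)) V \<cdot> coevn (Unit (trg1 B V)) V = \<^bold>1 V"
proof -
  define e where "e = trg1 B V"
  have t [simp]: "trg1 B V = e" "e \<in> Obj B" by (simp_all add: e_def[symmetric]) (simp add: e_def)
  let ?U = "Unit e" and ?J = "(\<I> e)\<^sup>\<dagger>" and ?Md = "(\<I> e \<otimes> \<I> e)\<^sup>\<dagger>"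
  define p where "p = evn ?U"
  define q where "q = evtn ?U"
  define c where "c = coevn ?U"
  define ct where "ct = coevtn ?U"
  have [simp]: "p W \<in> Arr" "Dom (p W) = ?J \<otimes> W" "Cod (p W) = W"
    "q W \<in> Arr" "Dom (q W) = ?J \<otimes> W" "Cod (q W) = W"
    "c W \<in> Arr" "Cod (c W) = ?J \<otimes> W" "Dom (c W) = W"
    "ct W \<in> Arr" "Cod (ct W) = ?J \<otimes> W" "Dom (ct W) = W"
    if "W \<in> Mor1 B" "trg1 B W = e" for W
    using that evn_simps[of ?U W] evtn_simps[of ?U W] by (simp_all add: p_def q_def c_def ct_def)
  have nat: "p (Cod \<phi>) \<cdot> (\<^bold>1 ?J \<star> \<phi>) = \<phi> \<cdot> p (Dom \<phi>)"
    "(\<^bold>1 ?J \<star> \<phi>) \<cdot> c (Dom \<phi>) = c (Cod \<phi>) \<cdot> \<phi>"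
    "(\<^bold>1 ?J \<star> \<phi>) \<cdot> ct (Dom \<phi>) = ct (Cod \<phi>) \<cdot> \<phi>"
    if "\<phi> \<in> Arr" "trg1 B (Dom \<phi>) = e" for \<phi>
    using evn_natural[of ?U \<phi>] evtn_natural[of ?U \<phi>] that by (simp_all add: p_def c_def ct_def)
  have pc: "p V \<cdot> c V = \<^bold>1 V" using triangles(2)[of ?U V] by (simp add: p_def c_def)
  have cp: "c V \<cdot> p V = \<^bold>1 (?J \<otimes> V)"
    using triangles(1)[of ?U V] nat(1)[of "c V"] by (simp add: p_def c_def)
  have qct: "q V \<cdot> ct V = \<^bold>1 V" using triangles(3)[of ?U V] by (simp add: q_def ct_def)
  have Jq: "(\<^bold>1 ?J \<star> q V) \<cdot> ct (?J \<otimes> V) = \<^bold>1 (?J \<otimes> V)"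
    using triangles(4)[of ?U V] by (simp add: q_def ct_def)
  let ?T = "?U \<odot> ?U"
  let ?k = "dual_cmp ?U ?U"
  have k [simp]: "?k W \<in> Arr" "Dom (?k W) = ?Md \<otimes> W" "Cod (?k W) = ?J \<otimes> (?J \<otimes> W)"
    if "W \<in> Mor1 B" "trg1 B W = e" for W using dual_cmp_simps[of ?U ?U W] that by simp_all
  (* \<l> : I \<otimes> I \<Rightarrow> I acts as the identity, so its two transposes lose their middle factor *)
  have m: "(\<^bold>1 ?Md \<star> q V) \<cdot> coevtn ?T (?J \<otimes> V) = p (?Md \<otimes> V) \<cdot> (\<^bold>1 ?J \<star> coevn ?T V)"
    using dual_mor_natural[OF rep_lun[of ?U e], of V] by (simp add: p_def q_def)
  have "?k V \<cdot> (\<^bold>1 ?Md \<star> q V) \<cdot> coevtn ?T (?J \<otimes> V) =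
    (\<^bold>1 ?J \<star> (\<^bold>1 ?J \<star> q V)) \<cdot> ?k (?J \<otimes> V) \<cdot> coevtn ?T (?J \<otimes> V)"
    using reassoc[OF dual_cmp_natural[of ?U ?U "q V"], of "coevtn ?T (?J \<otimes> V)"] by simp
  also have "?k (?J \<otimes> V) \<cdot> coevtn ?T (?J \<otimes> V) = (\<^bold>1 ?J \<star> ct (?J \<otimes> V)) \<cdot> ct (?J \<otimes> V)"
    using dual_cmp_coevtn[of ?U ?U "?J \<otimes> V"] by (simp add: nested_coevt_def ct_def)
  also have "(\<^bold>1 ?J \<star> (\<^bold>1 ?J \<star> q V)) \<cdot> \<dots> = (\<^bold>1 ?J \<star> \<^bold>1 (?J \<otimes> V)) \<cdot> ct (?J \<otimes> V)"
    by (rule reassoc) (use Jq in \<open>simp_all add: whiskerL[symmetric]\<close>)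
  finally have l: "?k V \<cdot> (\<^bold>1 ?Md \<star> q V) \<cdot> coevtn ?T (?J \<otimes> V) = ct (?J \<otimes> V)" by simp
  have "?k V \<cdot> p (?Md \<otimes> V) \<cdot> (\<^bold>1 ?J \<star> coevn ?T V) =
    (?k V \<cdot> p (?Md \<otimes> V)) \<cdot> (\<^bold>1 ?J \<star> coevn ?T V)" by simp
  also have "?k V \<cdot> p (?Md \<otimes> V) = p (?J \<otimes> (?J \<otimes> V)) \<cdot> (\<^bold>1 ?J \<star> ?k V)"
    using nat(1)[of "?k V"] by simp
  also have "(\<dots>) \<cdot> (\<^bold>1 ?J \<star> coevn ?T V) = p (?J \<otimes> (?J \<otimes> V)) \<cdot> (\<^bold>1 ?J \<star> (?k V \<cdot> coevn ?T V))"
    by (simp add: whiskerL)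
  also have "?k V \<cdot> coevn ?T V = c (?J \<otimes> V) \<cdot> c V"
    using dual_cmp_coevn[of ?U ?U V] by (simp add: nested_coev_def c_def)
  also have "p (?J \<otimes> (?J \<otimes> V)) \<cdot> (\<^bold>1 ?J \<star> (c (?J \<otimes> V) \<cdot> c V)) = c (?J \<otimes> V) \<cdot> c V \<cdot> p V"
    using nat(1)[of "c (?J \<otimes> V) \<cdot> c V"] by simp
  also have "\<dots> = c (?J \<otimes> V)" using cp by simp
  finally have "ct (?J \<otimes> V) = c (?J \<otimes> V)" using l m by simp
  then have "ct V \<cdot> p V = c V \<cdot> p V" using nat(2)[of "p V"] nat(3)[of "p V"] by simp
  then have "ct V \<cdot> p V \<cdot> c V = c V \<cdot> p V \<cdot> c V"
    using reassoc[of "ct V" "p V" "c V \<cdot> p V" "c V"] by simp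
  then have "ct V = c V" using pc by simp
  then have "q V \<cdot> c V \<cdot> p V = p V" using qct reassoc[of "q V" "c V" "\<^bold>1 V" "p V"] by simp
  then have "q V = p V" using cp by simp
  then show "evtn (Unit (trg1 B V)) V = evn (Unit (trg1 B V)) V"
    and "coevn (Unit (trg1 B V)) V \<cdot> evn (Unit (trg1 B V)) V = \<^bold>1 ((\<I> (trg1 B V))\<^sup>\<dagger> \<otimes> V)"
    and "evn (Unit (trg1 B V)) V \<cdot> coevn (Unit (trg1 B V)) V = \<^bold>1 V"
    using pc cp by (simp_all add: p_def q_def c_def)
qed

end

section \<open>Symmetry\<close>

context invertible_dimension
begin

abbreviation (input) Xdd :: 'm where "Xdd \<equiv> Xd\<^sup>\<dagger>"

abbreviation H where "H f \<equiv> \<^bold>1 Xdd \<star> f"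

text \<open>\<open>Cd\<close> and \<open>Nd\<close> are the families of \<open>coev X\<^sup>\<dagger>\<close> and \<open>coevt X\<^sup>\<dagger>\<close>.\<close>

definition Cd where "Cd = coevn (Atom Xd)"
definition Nd where "Nd = coevtn (Atom Xd)"

lemma Cd_simps [simp]:
  assumes "V \<in> Mor1 B"
  shows "trg1 B V = a \<Longrightarrow> Cd V \<in> Arr" "trg1 B V = a \<Longrightarrow> Cod (Cd V) = Xd \<otimes> (Xdd \<otimes> V)"
    "trg1 B V = a \<Longrightarrow> Dom (Cd V) = V"
    "trg1 B V = b \<Longrightarrow> Nd V \<in> Arr" "trg1 B V = b \<Longrightarrow> Cod (Nd V) = Xdd \<otimes> (Xd \<otimes> V)"
    "trg1 B V = b \<Longrightarrow> Dom (Nd V) = V"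
  using evn_simps[of "Atom Xd" V] evtn_simps[of "Atom Xd" V] assms by (auto simp: Cd_def Nd_def)

lemma Cd_nat:
  assumes "\<phi> \<in> Arr" "trg1 B (Dom \<phi>) = a"
  shows "G (H \<phi>) \<cdot> Cd (Dom \<phi>) = Cd (Cod \<phi>) \<cdot> \<phi>"
  using evtn_natural(2)[of "Atom Xd" \<phi>] assms by (simp add: Cd_def)

lemma Nd_nat:
  assumes "\<phi> \<in> Arr" "trg1 B (Dom \<phi>) = b"
  shows "H (G \<phi>) \<cdot> Nd (Dom \<phi>) = Nd (Cod \<phi>) \<cdot> \<phi>"
  using evn_natural(2)[of "Atom Xd" \<phi>] assms by (simp add: Nd_def)

text \<open>The two transposes of \<open>evt X : X \<otimes> X\<^sup>\<dagger> \<Rightarrow> I\<close> agree as 2-morphisms out of \<open>I\<^sup>\<dagger>\<close>. Since both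
  evaluations of \<open>I\<close> are the same isomorphism \<open>p\<close>, it can be cancelled.\<close>

lemma evt_natural_dual:
  assumes V [simp]: "V \<in> Mor1 B" "trg1 B V = b"
  shows "(\<^bold>1 ((X \<otimes> Xd)\<^sup>\<dagger>) \<star> E V) \<cdot> coevtn (Atom X \<odot> Atom Xd) V =
    E ((X \<otimes> Xd)\<^sup>\<dagger> \<otimes> V) \<cdot> coevn (Atom X \<odot> Atom Xd) V"
proof -
  let ?T = "Atom X \<odot> Atom Xd" and ?Md = "(X \<otimes> Xd)\<^sup>\<dagger>" and ?J = "(\<I> b)\<^sup>\<dagger>"
  define p where "p = evn (Unit b)"
  define c where "c = coevn (Unit b)"
  have [simp]: "p W \<in> Arr" "Dom (p W) = ?J \<otimes> W" "Cod (p W) = W"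
    "c W \<in> Arr" "Cod (c W) = ?J \<otimes> W" "Dom (c W) = W"
    if "W \<in> Mor1 B" "trg1 B W = b" for W
    using that evn_simps[of "Unit b" W] evtn_simps[of "Unit b" W] by (simp_all add: p_def c_def)
  have p_nat: "p (Cod \<phi>) \<cdot> (\<^bold>1 ?J \<star> \<phi>) = \<phi> \<cdot> p (Dom \<phi>)"
    if "\<phi> \<in> Arr" "trg1 B (Dom \<phi>) = b" for \<phi>
    using evn_natural[of "Unit b" \<phi>] that by (simp add: p_def)
  have pc: "p V \<cdot> c V = \<^bold>1 V" using unit_evaluations(3)[of V] by (simp add: p_def c_def)
  have m: "(\<^bold>1 ?Md \<star> p V) \<cdot> (\<^bold>1 ?Md \<star> E (?J \<otimes> V)) \<cdot> coevtn ?T (?J \<otimes> V) =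
    p (?Md \<otimes> V) \<cdot> (\<^bold>1 ?J \<star> E (?Md \<otimes> V)) \<cdot> (\<^bold>1 ?J \<star> coevn ?T V)"
    using dual_mor_natural[OF rep_E, of V] unit_evaluations(1)[of V] by (simp add: p_def)
  have "(\<^bold>1 ?Md \<star> p V) \<cdot> (\<^bold>1 ?Md \<star> E (?J \<otimes> V)) \<cdot> coevtn ?T (?J \<otimes> V) =
    (\<^bold>1 ?Md \<star> (p V \<cdot> E (?J \<otimes> V))) \<cdot> coevtn ?T (?J \<otimes> V)"
    by (simp add: whiskerL)
  also have "p V \<cdot> E (?J \<otimes> V) = E V \<cdot> F (G (p V))"
    using E_nat[of "p V" V] by simp
  also have "(\<^bold>1 ?Md \<star> (\<dots>)) \<cdot> coevtn ?T (?J \<otimes> V) =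
    (\<^bold>1 ?Md \<star> E V) \<cdot> (\<^bold>1 ?Md \<star> F (G (p V))) \<cdot> coevtn ?T (?J \<otimes> V)"
    by (simp add: whiskerL)
  also have "(\<^bold>1 ?Md \<star> F (G (p V))) \<cdot> coevtn ?T (?J \<otimes> V) = coevtn ?T V \<cdot> p V"
    using evn_natural(2)[of ?T "p V"] by simp
  finally have l: "(\<^bold>1 ?Md \<star> p V) \<cdot> (\<^bold>1 ?Md \<star> E (?J \<otimes> V)) \<cdot> coevtn ?T (?J \<otimes> V) =
    (\<^bold>1 ?Md \<star> E V) \<cdot> coevtn ?T V \<cdot> p V" .
  have r: "p (?Md \<otimes> V) \<cdot> (\<^bold>1 ?J \<star> E (?Md \<otimes> V)) \<cdot> (\<^bold>1 ?J \<star> coevn ?T V) =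
    E (?Md \<otimes> V) \<cdot> coevn ?T V \<cdot> p V"
    using p_nat[of "E (?Md \<otimes> V) \<cdot> coevn ?T V"] by (simp add: whiskerL)
  have "((\<^bold>1 ?Md \<star> E V) \<cdot> coevtn ?T V) \<cdot> p V \<cdot> c V = (E (?Md \<otimes> V) \<cdot> coevn ?T V) \<cdot> p V \<cdot> c V"
  proof -
    have "(((\<^bold>1 ?Md \<star> E V) \<cdot> coevtn ?T V) \<cdot> p V) \<cdot> c V = ((E (?Md \<otimes> V) \<cdot> coevn ?T V) \<cdot> p V) \<cdot> c V"
      using l r m by simp
    then show ?thesis by simp
  qed
  then show ?thesis using pc by simp
qed

text \<open>The candidate for \<open>X \<Rightarrow> X\<^sup>\<dagger>\<^sup>\<dagger>\<close> built from \<open>evt X\<close> and \<open>coev X\<^sup>\<dagger>\<close>; \<open>double_dual_mirror\<close> shows that the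
  mirror-image construction from \<open>coevt X\<^sup>\<dagger>\<close> and \<open>ev X\<close> gives the same map.\<close>

definition double_dual :: "'m \<Rightarrow> 'c" where
  "double_dual W = E (Xdd \<otimes> W) \<cdot> F (Cd W)"

lemma double_dual_simps [simp]:
  assumes "W \<in> Mor1 B" "trg1 B W = a"
  shows "double_dual W \<in> Arr" "Dom (double_dual W) = X \<otimes> W" "Cod (double_dual W) = Xdd \<otimes> W"
  using assms by (simp_all add: double_dual_def)

lemma double_dual_nat:
  assumes [simp]: "\<phi> \<in> Arr" and t: "trg1 B (Dom \<phi>) = a"
  shows "H \<phi> \<cdot> double_dual (Dom \<phi>) = double_dual (Cod \<phi>) \<cdot> F \<phi>"
proof -
  note [simp] = t
  have "H \<phi> \<cdot> double_dual (Dom \<phi>) =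
    (H \<phi> \<cdot> E (Xdd \<otimes> Dom \<phi>)) \<cdot> F (Cd (Dom \<phi>))"
    by (simp add: double_dual_def)
  also have "H \<phi> \<cdot> E (Xdd \<otimes> Dom \<phi>) =
    E (Xdd \<otimes> Cod \<phi>) \<cdot> F (G (H \<phi>))"
    using E_nat[of "H \<phi>"] by simp
  also have "(\<dots>) \<cdot> F (Cd (Dom \<phi>)) =
    E (Xdd \<otimes> Cod \<phi>) \<cdot> F (G (H \<phi>) \<cdot> Cd (Dom \<phi>))"
    by (simp add: whiskerL)
  finally show ?thesis using Cd_nat[of \<phi>] by (simp add: double_dual_def whiskerL)
qed

text \<open>Both sides of \<open>evt_natural_dual\<close> are pushed along the comparison \<open>(X \<otimes> X\<^sup>\<dagger>)\<^sup>\<dagger> \<Rightarrow> X\<^sup>\<dagger>\<^sup>\<dagger> \<otimes> X\<^sup>\<dagger>\<close>. On the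
  left the nested coevaluation meets \<open>E\<close> in a triangle identity, which leaves \<open>coevt X\<^sup>\<dagger>\<close>. On the right
  \<open>E\<close> and \<open>Cd\<close> combine to \<open>double_dual\<close>.\<close>

lemma Nd_via_double_dual:
  assumes V [simp]: "V \<in> Mor1 B" "trg1 B V = b"
  shows "Nd V = double_dual (Xd \<otimes> V) \<cdot> C V"
proof -
  let ?T = "Atom X \<odot> Atom Xd" and ?Md = "(X \<otimes> Xd)\<^sup>\<dagger>"
  let ?k = "dual_cmp (Atom X) (Atom Xd)"
  have k [simp]: "?k W \<in> Arr" "Dom (?k W) = ?Md \<otimes> W" "Cod (?k W) = Xdd \<otimes> (Xd \<otimes> W)"
    if "W \<in> Mor1 B" "trg1 B W = b" for W using dual_cmp_simps[of "Atom Xd" "Atom X" W] that by simp_all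
  have "?k V \<cdot> (\<^bold>1 ?Md \<star> E V) \<cdot> coevtn ?T V =
    H (G (E V)) \<cdot> ?k (X \<otimes> (Xd \<otimes> V)) \<cdot> coevtn ?T V"
    using reassoc[OF dual_cmp_natural[of "Atom Xd" "Atom X" "E V"], of "coevtn ?T V"] by simp
  also have "?k (X \<otimes> (Xd \<otimes> V)) \<cdot> coevtn ?T V = H (N (Xd \<otimes> V)) \<cdot> Nd V"
    using dual_cmp_coevtn[of "Atom Xd" "Atom X" V] by (simp add: nested_coevt_def N_def Nd_def)
  also have "H (G (E V)) \<cdot> \<dots> = H (\<^bold>1 (Xd \<otimes> V)) \<cdot> Nd V"
    by (rule reassoc) (use XdE_N[of V] in \<open>simp_all add: whiskerL[symmetric]\<close>)
  finally have l: "?k V \<cdot> (\<^bold>1 ?Md \<star> E V) \<cdot> coevtn ?T V = Nd V" by simp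
  have "?k V \<cdot> E (?Md \<otimes> V) \<cdot> coevn ?T V = (?k V \<cdot> E (?Md \<otimes> V)) \<cdot> coevn ?T V"
    by simp
  also have "?k V \<cdot> E (?Md \<otimes> V) = E (Xdd \<otimes> (Xd \<otimes> V)) \<cdot> F (G (?k V))"
    using E_nat[of "?k V"] by simp
  also have "(\<dots>) \<cdot> coevn ?T V = E (Xdd \<otimes> (Xd \<otimes> V)) \<cdot> F (G (?k V)) \<cdot> coevn ?T V"
    by simp
  also have "F (G (?k V)) \<cdot> coevn ?T V = F (Cd (Xd \<otimes> V)) \<cdot> C V"
    using dual_cmp_coevn[of "Atom Xd" "Atom X" V] by (simp add: nested_coev_def C_def Cd_def)
  finally have r: "?k V \<cdot> E (?Md \<otimes> V) \<cdot> coevn ?T V = double_dual (Xd \<otimes> V) \<cdot> C V"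
    by (simp add: double_dual_def)
  show ?thesis using l r evt_natural_dual[OF V] by simp
qed

lemma double_dual_mirror:
  assumes [simp]: "W \<in> Mor1 B" "trg1 B W = a"
  shows "H (D W) \<cdot> Nd (X \<otimes> W) = double_dual W"
proof -
  have "H (D W) \<cdot> Nd (X \<otimes> W) =
    (H (D W) \<cdot> double_dual (Xd \<otimes> (X \<otimes> W))) \<cdot> C (X \<otimes> W)"
    by (simp add: Nd_via_double_dual)
  also have "H (D W) \<cdot> double_dual (Xd \<otimes> (X \<otimes> W)) = double_dual W \<cdot> F (D W)"
    using double_dual_nat[of "D W"] by simp
  finally show ?thesis by (simp add: XD_C)
qed

text \<open>The strict family of the Frobenius form \<open>counit \<cdot> mult : A \<otimes> A \<Rightarrow> I\<close>.\<close>

definition pairing :: "'m \<Rightarrow> 'c" where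
  "pairing W = D W \<cdot> G (d (X \<otimes> W) \<cdot> E (X \<otimes> W))"

lemma pairing_simps [simp]:
  assumes "W \<in> Mor1 B" "trg1 B W = a"
  shows "pairing W \<in> Arr" "Dom (pairing W) = Xd \<otimes> (X \<otimes> (Xd \<otimes> (X \<otimes> W)))" "Cod (pairing W) = W"
  using assms by (simp_all add: pairing_def)

lemma rep_pairing: "represents (M \<odot> M) (Unit a) (counit A \<cdot> mult A) pairing"
  by (rule rep_adapt[OF rep_comp[OF rep_mult rep_counit]])
    (simp_all add: pairing_def whiskerL)

text \<open>The next two lemmas compute the transposes of the Frobenius form with respect to the nested
  coevaluations. In both a triangle identity for \<open>X\<close> straightens the strand \<open>X\<^sup>\<dagger>\<close>, and \<open>d\<close> slides freely by
  naturality; the strand \<open>X\<close> is bent into \<open>X\<^sup>\<dagger>\<^sup>\<dagger>\<close> by \<open>evt X\<close> in the first and by \<open>ev X\<close> in the second.\<close>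

lemma pairing_coev:
  assumes U [simp]: "U \<in> Mor1 B" "trg1 B U = a"
  shows "pairing (Xd \<otimes> (Xdd \<otimes> U)) \<cdot> G (F (nested_coev (Atom Xd) (Atom X) U)) =
    G (double_dual U \<cdot> d (X \<otimes> U))"
proof -
  let ?V = "Xdd \<otimes> U"
  have n: "nested_coev (Atom Xd) (Atom X) U = G (C ?V) \<cdot> Cd U"
    by (simp add: nested_coev_def C_def Cd_def)
  have "d (X \<otimes> (Xd \<otimes> ?V)) \<cdot> E (X \<otimes> (Xd \<otimes> ?V)) \<cdot> F (G (C ?V) \<cdot> Cd U) =
    d (X \<otimes> (Xd \<otimes> ?V)) \<cdot> (E (X \<otimes> (Xd \<otimes> ?V)) \<cdot> F (G (C ?V))) \<cdot> F (Cd U)"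
    by (simp add: whiskerL)
  also have "E (X \<otimes> (Xd \<otimes> ?V)) \<cdot> F (G (C ?V)) = C ?V \<cdot> E ?V"
    using E_nat[of "C ?V"] by simp
  also have "d (X \<otimes> (Xd \<otimes> ?V)) \<cdot> (C ?V \<cdot> E ?V) \<cdot> F (Cd U) =
    (d (X \<otimes> (Xd \<otimes> ?V)) \<cdot> C ?V) \<cdot> double_dual U"
    by (simp add: double_dual_def)
  also have "d (X \<otimes> (Xd \<otimes> ?V)) \<cdot> C ?V = C ?V \<cdot> d ?V"
    using d_nat[of "C ?V"] by simp
  also have "(C ?V \<cdot> d ?V) \<cdot> double_dual U = C ?V \<cdot> (double_dual U \<cdot> d (X \<otimes> U))"
    using d_nat[of "double_dual U"] by simp
  finally have e: "d (X \<otimes> (Xd \<otimes> ?V)) \<cdot> E (X \<otimes> (Xd \<otimes> ?V)) \<cdot> F (G (C ?V) \<cdot> Cd U) =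
    C ?V \<cdot> (double_dual U \<cdot> d (X \<otimes> U))" .
  have "pairing (Xd \<otimes> ?V) \<cdot> G (F (nested_coev (Atom Xd) (Atom X) U)) =
    D (Xd \<otimes> ?V) \<cdot> G (C ?V \<cdot> (double_dual U \<cdot> d (X \<otimes> U)))"
    unfolding n e[symmetric] by (simp add: pairing_def whiskerL)
  also have "\<dots> = D (Xd \<otimes> ?V) \<cdot> G (C ?V) \<cdot> G (double_dual U \<cdot> d (X \<otimes> U))"
    by (simp add: whiskerL)
  also have "\<dots> = \<^bold>1 (Xd \<otimes> ?V) \<cdot> G (double_dual U \<cdot> d (X \<otimes> U))"
    by (rule reassoc[OF D_XdC]) simp_all
  finally show ?thesis by simp
qed

lemma pairing_coevt:
  assumes U [simp]: "U \<in> Mor1 B" "trg1 B U = a"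
  shows "G (H (pairing U)) \<cdot> nested_coevt (Atom Xd) (Atom X) (Xd \<otimes> (X \<otimes> U)) =
    G (double_dual U \<cdot> d (X \<otimes> U))"
proof -
  let ?W = "Xd \<otimes> (X \<otimes> U)"
  let ?f = "d (X \<otimes> U) \<cdot> E (X \<otimes> U)"
  have n: "nested_coevt (Atom Xd) (Atom X) ?W = G (Nd (X \<otimes> ?W)) \<cdot> N ?W"
    by (simp add: nested_coevt_def Nd_def N_def)
  have "H (pairing U) \<cdot> Nd (X \<otimes> ?W) =
    H (D U) \<cdot> H (G ?f) \<cdot> Nd (X \<otimes> ?W)"
    by (simp add: pairing_def whiskerL)
  also have "H (G ?f) \<cdot> Nd (X \<otimes> ?W) = Nd (X \<otimes> U) \<cdot> ?f"
    using Nd_nat[of ?f] by simp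
  also have "H (D U) \<cdot> Nd (X \<otimes> U) \<cdot> ?f = double_dual U \<cdot> ?f"
    by (rule reassoc[OF double_dual_mirror]) simp_all
  finally have e: "H (pairing U) \<cdot> Nd (X \<otimes> ?W) = double_dual U \<cdot> ?f" .
  have "G (H (pairing U)) \<cdot> nested_coevt (Atom Xd) (Atom X) ?W =
    G (H (pairing U) \<cdot> Nd (X \<otimes> ?W)) \<cdot> N ?W"
    by (simp add: n whiskerL)
  also have "\<dots> = G (double_dual U \<cdot> d (X \<otimes> U)) \<cdot> G (E (X \<otimes> U)) \<cdot> N ?W"
    by (simp add: e whiskerL)
  finally show ?thesis by (simp add: XdE_N)
qed

text \<open>The comparison \<open>A\<^sup>\<dagger> \<Rightarrow> X\<^sup>\<dagger> \<otimes> X\<^sup>\<dagger>\<^sup>\<dagger>\<close> is mono, so the two sides may be compared after it, where the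
  coevaluations of \<open>A\<close> become nested.\<close>

lemma symmetric_end_alg: "symmetric B A"
  unfolding symmetric_def Let_def acar_A
proof -
  let ?Md = "(Xd \<otimes> X)\<^sup>\<dagger>" and ?k = "dual_cmp (Atom Xd) (Atom X)" and ?T = "Atom Xd \<odot> Atom X"
  let ?\<kappa> = "counit A \<cdot> mult A"
  have R: "represents M (dual_word ?T) (zigR B ?Md (Xd \<otimes> X) (coev B (Xd \<otimes> X)) (\<^bold>1 (Xd \<otimes> X)) ?\<kappa>)
    (\<lambda>U. pairing (?Md \<otimes> U) \<cdot> G (F (coevn ?T U)))"
    by (rule rep_adapt[OF rep_zigR[OF rep_coev[of M a] rep_id[of M]
          rep_pairing, where u = ?Md and v = "Xd \<otimes> X"]]) simp_all
  have L: "represents M (dual_word ?T) (zigL B ?Md (Xd \<otimes> X) (coevt B (Xd \<otimes> X)) (\<^bold>1 (Xd \<otimes> X)) ?\<kappa>)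
    (\<lambda>U. (\<^bold>1 ?Md \<star> pairing U) \<cdot> coevtn ?T (Xd \<otimes> (X \<otimes> U)))"
    by (rule rep_adapt[OF rep_zigL[OF rep_coevt[of M a] rep_id[of M]
          rep_pairing, where u = ?Md and v = "Xd \<otimes> X"]]) simp_all
  have k [simp]: "?k W \<in> Arr" "Dom (?k W) = ?Md \<otimes> W" "Cod (?k W) = Xd \<otimes> (Xdd \<otimes> W)"
    if "W \<in> Mor1 B" "trg1 B W = a" for W using dual_cmp_simps[of "Atom X" "Atom Xd" W] that by simp_all
  show "zigR B ?Md (Xd \<otimes> X) (coev B (Xd \<otimes> X)) (\<^bold>1 (Xd \<otimes> X)) ?\<kappa> =
    zigL B ?Md (Xd \<otimes> X) (coevt B (Xd \<otimes> X)) (\<^bold>1 (Xd \<otimes> X)) ?\<kappa>"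
  proof (rule rep_faithful[OF R L])
    fix U assume U: "U \<in> Mor1 B" "trg1 B U = wsrc M"
    then have [simp]: "U \<in> Mor1 B" "trg1 B U = a" by simp_all
    let ?l = "pairing (?Md \<otimes> U) \<cdot> G (F (coevn ?T U))"
    let ?r = "(\<^bold>1 ?Md \<star> pairing U) \<cdot> coevtn ?T (Xd \<otimes> (X \<otimes> U))"
    have p_nat: "pairing (Cod \<phi>) \<cdot> G (F (G (F \<phi>))) = \<phi> \<cdot> pairing (Dom \<phi>)"
      if "\<phi> \<in> Arr" "trg1 B (Dom \<phi>) = a" for \<phi>
      using rep_natural[OF rep_pairing, of \<phi>] that by simp
    have "?k U \<cdot> ?l = (?k U \<cdot> pairing (?Md \<otimes> U)) \<cdot> G (F (coevn ?T U))"
      by simp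
    also have "?k U \<cdot> pairing (?Md \<otimes> U) =
      pairing (Xd \<otimes> (Xdd \<otimes> U)) \<cdot> G (F (G (F (?k U))))"
      using p_nat[of "?k U"] by simp
    also have "(\<dots>) \<cdot> G (F (coevn ?T U)) =
      pairing (Xd \<otimes> (Xdd \<otimes> U)) \<cdot> G (F (G (F (?k U)) \<cdot> coevn ?T U))"
      by (simp add: whiskerL)
    also have "G (F (?k U)) \<cdot> coevn ?T U = nested_coev (Atom Xd) (Atom X) U"
      using dual_cmp_coevn[of "Atom X" "Atom Xd" U] by simp
    finally have l: "?k U \<cdot> ?l = G (double_dual U \<cdot> d (X \<otimes> U))"
      by (simp add: pairing_coev)
    have "?k U \<cdot> ?r = (?k U \<cdot> (\<^bold>1 ?Md \<star> pairing U)) \<cdot> coevtn ?T (Xd \<otimes> (X \<otimes> U))"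
      by simp
    also have "?k U \<cdot> (\<^bold>1 ?Md \<star> pairing U) =
      G (H (pairing U)) \<cdot> ?k (Xd \<otimes> (X \<otimes> (Xd \<otimes> (X \<otimes> U))))"
      using dual_cmp_natural[of "Atom X" "Atom Xd" "pairing U"] by simp
    also have "(\<dots>) \<cdot> coevtn ?T (Xd \<otimes> (X \<otimes> U)) =
      G (H (pairing U)) \<cdot> nested_coevt (Atom Xd) (Atom X) (Xd \<otimes> (X \<otimes> U))"
      using dual_cmp_coevtn[of "Atom X" "Atom Xd" "Xd \<otimes> (X \<otimes> U)"] by simp
    finally have r: "?k U \<cdot> ?r = G (double_dual U \<cdot> d (X \<otimes> U))"
      by (simp add: pairing_coevt)
    show "?l = ?r"
      by (rule dual_cmp_mono[of "Atom X" "Atom Xd" U]) (use l r in simp_all)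
  qed
qed

end

section \<open>Coequalisers\<close>

context bicategory
begin

lemma coequaliserD:
  assumes "coequaliser B f g q"
  shows "q \<in> Arr" "Dom q = Cod f" "q \<cdot> f = q \<cdot> g"
  using assms by (auto simp: coequaliser_def)

lemma coequaliser_universal:
  assumes "coequaliser B f g q" "h \<in> Arr" "Dom h = Cod f" "h \<cdot> f = h \<cdot> g"
  shows "\<exists>!k. k \<in> hom2 B (Cod q) (Cod h) \<and> k \<cdot> q = h"
  using assms unfolding coequaliser_def by blast

lemma coequaliser_factor:
  assumes "coequaliser B f g q" "h \<in> Arr" "Dom h = Cod f" "h \<cdot> f = h \<cdot> g"
  obtains k where "k \<in> Arr" "Dom k = Cod q" "Cod k = Cod h" "k \<cdot> q = h"
  using assms unfolding coequaliser_def hom2_def by blast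

lemma coequaliser_unique:
  assumes q: "coequaliser B f g q" and fg: "f \<in> Arr" "g \<in> Arr" "Cod g = Cod f"
    and k: "k \<in> Arr" "Dom k = Cod q" and l: "l \<in> Arr" "Dom l = Cod q"
    and e: "k \<cdot> q = l \<cdot> q"
  shows "k = l"
proof -
  note d = coequaliserD[OF q]
  have kl: "Cod k = Cod l" using arg_cong[OF e, of "Cod"] d k l by simp
  have "(k \<cdot> q) \<cdot> f = (k \<cdot> q) \<cdot> g" using d k fg by simp
  then have "\<exists>!j. j \<in> hom2 B (Cod q) (Cod (k \<cdot> q)) \<and> j \<cdot> q = k \<cdot> q"
    using d k by (intro coequaliser_universal[OF q]) simp_all
  moreover have "k \<in> hom2 B (Cod q) (Cod (k \<cdot> q))" "l \<in> hom2 B (Cod q) (Cod (k \<cdot> q))"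
    using d k l kl by (auto simp: hom2_def)
  ultimately show ?thesis using e by metis
qed

text \<open>A fork with a contraction \<open>t\<close>. The parallel pair may be contracted from either side: in the
  applications below sometimes \<open>f\<close> and sometimes \<open>g\<close> is the map that \<open>t\<close> splits.\<close>

lemma split_coequaliser:
  assumes f: "f \<in> Arr" "g \<in> Arr" "Dom g = Dom f" "Cod g = Cod f"
    and q: "q \<in> Arr" "Dom q = Cod f" "q \<cdot> f = q \<cdot> g"
    and s: "s \<in> Arr" "Dom s = Cod q" "Cod s = Cod f" "q \<cdot> s = \<^bold>1 (Cod q)"
    and t: "t \<in> Arr" "Dom t = Cod f" "Cod t = Dom f"
    and tt: "(f \<cdot> t = \<^bold>1 (Cod f) \<and> g \<cdot> t = s \<cdot> q) \<or> (g \<cdot> t = \<^bold>1 (Cod f) \<and> f \<cdot> t = s \<cdot> q)"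
  shows "coequaliser B f g q"
  unfolding coequaliser_def
proof (intro conjI ballI impI q)
  fix h assume h: "h \<in> Arr" and "Dom h = Cod f \<and> h \<cdot> f = h \<cdot> g"
  then have h': "Dom h = Cod f" "h \<cdot> f = h \<cdot> g" by auto
  have "h \<cdot> f \<cdot> t = h \<cdot> g \<cdot> t"
    using reassoc[OF h'(2), of t] f h h' t by simp
  then have hsq: "h \<cdot> s \<cdot> q = h" using tt h h' by auto
  show "\<exists>!k. k \<in> hom2 B (Cod q) (Cod h) \<and> k \<cdot> q = h"
  proof (intro ex1I[of _ "h \<cdot> s"] conjI)
    show "h \<cdot> s \<in> hom2 B (Cod q) (Cod h)" using h h' s by (simp add: hom2_def)
    show "(h \<cdot> s) \<cdot> q = h" using hsq h h' s q by simp
    fix k assume "k \<in> hom2 B (Cod q) (Cod h) \<and> k \<cdot> q = h"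
    then have k: "k \<in> Arr" "Dom k = Cod q" "k \<cdot> q = h" by (auto simp: hom2_def)
    show "k = h \<cdot> s" using reassoc[OF k(3), of s] comp2_assoc'[of s q k] k q s by simp
  qed
qed

lemma coequaliser_iso:
  assumes q: "coequaliser B f g q"
    and f: "f \<in> Arr" "g \<in> Arr" "Dom g = Dom f" "Cod g = Cod f"
    and f': "f' \<in> Arr" "g' \<in> Arr" "Dom g' = Dom f'" "Cod g' = Cod f'"
    and u: "invertible2 B u" "Dom u = Dom f'" "Cod u = Dom f"
    and w: "invertible2 B w" "Dom w = Cod f'" "Cod w = Cod f"
    and c: "w \<cdot> f' = f \<cdot> u" "w \<cdot> g' = g \<cdot> u"
  shows "coequaliser B f' g' (q \<cdot> w)"
proof -
  note d [simp] = coequaliserD(1,2)[OF q] and qfg = coequaliserD(3)[OF q]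
  have [simp]: "u \<in> Arr" "w \<in> Arr" using u w by (auto intro: invertible2_mor2)
  note [simp] = f f' u w
  show ?thesis
    unfolding coequaliser_def
  proof (intro conjI ballI impI)
    show "(q \<cdot> w) \<cdot> f' = (q \<cdot> w) \<cdot> g'"
      using reassoc[OF qfg, of u] c by simp
    fix h assume h [simp]: "h \<in> Arr" and "Dom h = Cod f' \<and> h \<cdot> f' = h \<cdot> g'"
    then have h' [simp]: "Dom h = Cod f'" and hh: "h \<cdot> f' = h \<cdot> g'" by auto
    let ?h = "h \<cdot> inv2 B w"
    have e: "?h \<cdot> f = ?h \<cdot> g"
    proof (rule invertible2_epi[of u])
      have "(?h \<cdot> f) \<cdot> u = h \<cdot> inv2 B w \<cdot> w \<cdot> f'" using c by simp
      also have "\<dots> = h \<cdot> inv2 B w \<cdot> w \<cdot> g'" using hh by simp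
      also have "\<dots> = (?h \<cdot> g) \<cdot> u" using c(2) by (simp del: inv2_cancel)
      finally show "(?h \<cdot> f) \<cdot> u = (?h \<cdot> g) \<cdot> u" .
    qed auto
    obtain k where k: "k \<in> Arr" "Dom k = Cod q" "Cod k = Cod ?h" "k \<cdot> q = ?h"
      by (rule coequaliser_factor[OF q _ _ e]) auto
    show "\<exists>!k. k \<in> hom2 B (Cod (q \<cdot> w)) (Cod h) \<and> k \<cdot> q \<cdot> w = h"
    proof (intro ex1I[of _ k] conjI)
      show "k \<in> hom2 B (Cod (q \<cdot> w)) (Cod h)" using k by (simp add: hom2_def)
      show "k \<cdot> q \<cdot> w = h" using reassoc[OF k(4), of w] k by simp
      fix l assume "l \<in> hom2 B (Cod (q \<cdot> w)) (Cod h) \<and> l \<cdot> q \<cdot> w = h"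
      then have l: "l \<in> Arr" "Dom l = Cod q" "l \<cdot> q \<cdot> w = h" by (auto simp: hom2_def)
      have "l \<cdot> q = ?h"
        by (rule invertible2_epi[of w]) (use l in auto)
      then show "l = k" using coequaliser_unique[OF q] k l by simp
    qed
  qed simp_all
qed

lemma factor2_eqI:
  assumes "p \<in> Arr" "s \<in> Arr" "Dom s = Cod p" "Cod s = Dom p" "p \<cdot> s = \<^bold>1 (Cod p)"
    and "k \<in> Arr" "Dom k = Cod p" "k \<cdot> p = h"
  shows "factor2 B p h = k"
  unfolding factor2_def
proof (rule the_equality)
  show "k \<in> hom2 B (Cod p) (Cod h) \<and> k \<cdot> p = h" using assms by (auto simp: hom2_def)
  fix l assume "l \<in> hom2 B (Cod p) (Cod h) \<and> l \<cdot> p = h"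
  then have l: "l \<in> Arr" "Dom l = Cod p" "l \<cdot> p = h" by (auto simp: hom2_def)
  have "(l \<cdot> p) \<cdot> s = l" using comp2_assoc'[of s p l] l(1,2) assms(1-5) by simp
  moreover have "(k \<cdot> p) \<cdot> s = k" using comp2_assoc'[of s p k] assms(1-7) by simp
  ultimately show "l = k" using l(3) assms(8) by simp
qed

section \<open>Bimodules and their relative tensor products\<close>

abbreviation sobj where "sobj X \<equiv> fst (bsrc X)"
abbreviation tobj where "tobj X \<equiv> fst (btrg X)"
abbreviation salg where "salg X \<equiv> acar (snd (bsrc X))"
abbreviation talg where "talg X \<equiv> acar (snd (btrg X))"

lemma eq_obj_algebra:
  "p \<in> eq_obj B \<Longrightarrow> fst p \<in> Obj B" "p \<in> eq_obj B \<Longrightarrow> algebra B (fst p) (snd p)"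
  unfolding eq_obj_def frobenius_algebra_def by (cases p; simp)+

lemma eq_objD [simp]:
  assumes "p \<in> eq_obj B"
  shows "fst p \<in> Obj B" and "acar (snd p) \<in> Mor1 B" "src1 B (acar (snd p)) = fst p" "trg1 B (acar
      (snd p)) = fst p"
    "mult (snd p) \<in> Arr" "Dom (mult (snd p)) = acar (snd p) \<otimes> acar (snd p)"
    "Cod (mult (snd p)) = acar (snd p)"
    "munit (snd p) \<in> Arr" "Dom (munit (snd p)) = \<I> (fst p)" "Cod (munit (snd p)) = acar (snd p)"
  using eq_obj_algebra[OF assms] unfolding algebra_def Let_def hom1_def hom2_def by blast+

lemma eq_obj_eqs:
  assumes "p \<in> eq_obj B"
  shows "mult (snd p) \<cdot> (mult (snd p) \<star> \<^bold>1 (acar (snd p))) =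
      mult (snd p) \<cdot> (\<^bold>1 (acar (snd p)) \<star> mult (snd p)) \<cdot> \<alpha> (acar (snd p)) (acar (snd p)) (acar
          (snd p))"
    "mult (snd p) \<cdot> (munit (snd p) \<star> \<^bold>1 (acar (snd p))) = \<l> (acar (snd p))"
    "mult (snd p) \<cdot> (\<^bold>1 (acar (snd p)) \<star> munit (snd p)) = \<r> (acar (snd p))"
  using eq_obj_algebra[OF assms] unfolding algebra_def Let_def hom1_def hom2_def by blast+

lemma eq_mor1D [simp]:
  assumes "X \<in> eq_mor1 B"
  shows "bsrc X \<in> eq_obj B" "btrg X \<in> eq_obj B"
    "bcar X \<in> Mor1 B" "src1 B (bcar X) = sobj X" "trg1 B (bcar X) = tobj X"
    "lact X \<in> Arr" "Dom (lact X) = talg X \<otimes> bcar X" "Cod (lact X) = bcar X"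
    "ract X \<in> Arr" "Dom (ract X) = bcar X \<otimes> salg X" "Cod (ract X) = bcar X"
  using assms
  unfolding eq_mor1_def bimodule_def left_module_def right_module_def Let_def hom1_def hom2_def
  by blast+

lemma eq_mor1_eqs:
  assumes "X \<in> eq_mor1 B"
  shows "lact X \<cdot> (mult (snd (btrg X)) \<star> \<^bold>1 (bcar X)) =
      lact X \<cdot> (\<^bold>1 (talg X) \<star> lact X) \<cdot> \<alpha> (talg X) (talg X) (bcar X)"
    "lact X \<cdot> (munit (snd (btrg X)) \<star> \<^bold>1 (bcar X)) = \<l> (bcar X)"
    "ract X \<cdot> (ract X \<star> \<^bold>1 (salg X)) =
      ract X \<cdot> (\<^bold>1 (bcar X) \<star> mult (snd (bsrc X))) \<cdot> \<alpha> (bcar X) (salg X) (salg X)"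
    "ract X \<cdot> (\<^bold>1 (bcar X) \<star> munit (snd (bsrc X))) = \<r> (bcar X)"
    "ract X \<cdot> (lact X \<star> \<^bold>1 (salg X)) =
      lact X \<cdot> (\<^bold>1 (talg X) \<star> ract X) \<cdot> \<alpha> (talg X) (bcar X) (salg X)"
  using assms
  unfolding eq_mor1_def bimodule_def left_module_def right_module_def Let_def hom1_def hom2_def
  by blast+

lemma regular_bimod_simps [simp]:
  "bsrc (regular_bimod p) = p" "btrg (regular_bimod p) = p" "bcar (regular_bimod p) = acar (snd p)"
  "lact (regular_bimod p) = mult (snd p)" "ract (regular_bimod p) = mult (snd p)"
  by (simp_all add: regular_bimod_def)

lemma regular_bimod_eq_mor1 [simp]:
  assumes p: "p \<in> eq_obj B"
  shows "regular_bimod p \<in> eq_mor1 B"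
  unfolding eq_mor1_def bimodule_def left_module_def right_module_def Let_def hom1_def hom2_def
  using eq_objD[OF p] eq_obj_eqs[OF p] p by simp

text \<open>The underlying 2-morphism of an isomorphism in the equivariant completion. Over equal sources and targets,
  equivariance of \<open>k\<close> implies that of its inverse (\<open>bimodule_iso_inv\<close>).\<close>

definition bimodule_iso :: "'c \<Rightarrow> ('o, 'm, 'c) bimod \<Rightarrow> ('o, 'm, 'c) bimod \<Rightarrow> bool" where
  "bimodule_iso k T Z \<longleftrightarrow> T \<in> eq_mor1 B \<and> Z \<in> eq_mor1 B \<and> bsrc T = bsrc Z \<and> btrg T = btrg Z \<and>
     invertible2 B k \<and> Dom k = bcar T \<and> Cod k = bcar Z \<and>
     k \<cdot> lact T = lact Z \<cdot> (\<^bold>1 (talg Z) \<star> k) \<and> k \<cdot> ract T = ract Z \<cdot> (k \<star> \<^bold>1 (salg Z))"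

lemma bimodule_isoD:
  assumes "bimodule_iso k T Z"
  shows "T \<in> eq_mor1 B" "Z \<in> eq_mor1 B" "bsrc T = bsrc Z" "btrg T = btrg Z" "invertible2 B k"
    "k \<in> Arr" "Dom k = bcar T" "Cod k = bcar Z"
    "k \<cdot> lact T = lact Z \<cdot> (\<^bold>1 (talg Z) \<star> k)" "k \<cdot> ract T = ract Z \<cdot> (k \<star> \<^bold>1 (salg Z))"
  using assms invertible2_mor2[of k] by (auto simp: bimodule_iso_def)

lemma bimodule_iso_id: "X \<in> eq_mor1 B \<Longrightarrow> bimodule_iso (\<^bold>1 (bcar X)) X X"
  by (auto simp: bimodule_iso_def)

lemma bimodule_iso_inv:
  assumes k: "bimodule_iso k T Z"
  shows "bimodule_iso (inv2 B k) Z T"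
proof -
  note d [simp] = bimodule_isoD(1-8)[OF k]
  have [simp]: "bsrc Z \<in> eq_obj B" "btrg Z \<in> eq_obj B" "src1 B (bcar T) = sobj Z" "trg1 B (bcar T)
      = tobj Z"
    using eq_mor1D[OF d(2)] eq_mor1D[OF d(1)] by auto
  have tt: "Dom (lact T) = talg Z \<otimes> bcar T" "Dom (ract T) = bcar T \<otimes> salg Z"
    using eq_mor1D[OF d(1)] by simp_all
  have "inv2 B k \<cdot> lact Z = lact T \<cdot> (\<^bold>1 (talg Z) \<star> inv2 B k)"
  proof (rule invertible2_mono[of k])
    have "k \<cdot> lact T \<cdot> (\<^bold>1 (talg Z) \<star> inv2 B k) = lact Z \<cdot> (\<^bold>1 (talg Z) \<star> k) \<cdot> (\<^bold>1 (talg Z) \<star> inv2 B k)"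
      using reassoc[OF bimodule_isoD(9)[OF k], of "\<^bold>1 (talg Z) \<star> inv2 B k"] tt by simp
    also have "\<dots> = lact Z" by (simp add: whiskerL[symmetric])
    finally show "k \<cdot> inv2 B k \<cdot> lact Z = k \<cdot> lact T \<cdot> (\<^bold>1 (talg Z) \<star> inv2 B k)" by simp
  qed (simp_all add: tt)
  moreover have "inv2 B k \<cdot> ract Z = ract T \<cdot> (inv2 B k \<star> \<^bold>1 (salg Z))"
  proof (rule invertible2_mono[of k])
    have "k \<cdot> ract T \<cdot> (inv2 B k \<star> \<^bold>1 (salg Z)) = ract Z \<cdot> (k \<star> \<^bold>1 (salg Z)) \<cdot> (inv2 B k \<star> \<^bold>1 (salg Z))"
      using reassoc[OF bimodule_isoD(10)[OF k], of "inv2 B k \<star> \<^bold>1 (salg Z)"] tt by simp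
    also have "\<dots> = ract Z" by (simp add: whiskerR[symmetric])
    finally show "k \<cdot> inv2 B k \<cdot> ract Z = k \<cdot> ract T \<cdot> (inv2 B k \<star> \<^bold>1 (salg Z))" by simp
  qed (simp_all add: tt)
  ultimately show ?thesis by (simp add: bimodule_iso_def)
qed

text \<open>Transport of structure: every module law for \<open>T\<close> holds after composition with the invertible \<open>k\<close>,
  where it becomes the law for \<open>Z\<close>.\<close>

lemma eq_mor1_transport:
  assumes Z [simp]: "Z \<in> eq_mor1 B" and b [simp]: "bsrc T = bsrc Z" "btrg T = btrg Z"
    and k [simp]: "invertible2 B k" "Dom k = bcar T" "Cod k = bcar Z"
    and l: "lact T \<in> Arr" "Dom (lact T) = talg Z \<otimes> bcar T" "Cod (lact T) = bcar T"
      "k \<cdot> lact T = lact Z \<cdot> (\<^bold>1 (talg Z) \<star> k)"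
    and r: "ract T \<in> Arr" "Dom (ract T) = bcar T \<otimes> salg Z" "Cod (ract T) = bcar T"
      "k \<cdot> ract T = ract Z \<cdot> (k \<star> \<^bold>1 (salg Z))"
  shows "bimodule_iso k T Z"
proof -
  have km [simp]: "k \<in> Arr" by (rule invertible2_mor2) simp
  note [simp] = l(1-3) r(1-3)
  have [simp]: "bcar T \<in> Mor1 B" "src1 B (bcar T) = sobj Z" "trg1 B (bcar T) = tobj Z"
    using mor2_mor1[OF km] eq_mor1D(4,5)[OF Z] by auto
  note zd [simp] = eq_mor1D[OF Z] eq_objD[OF eq_mor1D(1)[OF Z]] eq_objD[OF eq_mor1D(2)[OF Z]]
  note ze = eq_mor1_eqs[OF Z]
  let ?C = "talg Z" and ?A = "salg Z" and ?t = "bcar T" and ?z = "bcar Z"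
  let ?mC = "mult (snd (btrg Z))" and ?uC = "munit (snd (btrg Z))"
  let ?mA = "mult (snd (bsrc Z))" and ?uA = "munit (snd (bsrc Z))"
  have kl: "k \<cdot> lact T \<cdot> f = lact Z \<cdot> (\<^bold>1 ?C \<star> k) \<cdot> f" if "f \<in> Arr" "Cod f = ?C \<otimes> ?t" for f
    using reassoc[OF l(4), of f] that by simp
  have kr: "k \<cdot> ract T \<cdot> f = ract Z \<cdot> (k \<star> \<^bold>1 ?A) \<cdot> f" if "f \<in> Arr" "Cod f = ?t \<otimes> ?A" for f
    using reassoc[OF r(4), of f] that by simp
  have 1: "lact T \<cdot> (?mC \<star> \<^bold>1 ?t) = lact T \<cdot> (\<^bold>1 ?C \<star> lact T) \<cdot> \<alpha> ?C ?C ?t"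
  proof (rule invertible2_mono[of k])
    have "k \<cdot> lact T \<cdot> (?mC \<star> \<^bold>1 ?t) = lact Z \<cdot> ((\<^bold>1 ?C \<star> k) \<cdot> (?mC \<star> \<^bold>1 ?t))"
      by (simp add: kl)
    also have "(\<^bold>1 ?C \<star> k) \<cdot> (?mC \<star> \<^bold>1 ?t) = (?mC \<star> \<^bold>1 ?z) \<cdot> (\<^bold>1 (?C \<otimes> ?C) \<star> k)"
      using tens2_left_right[of k ?mC] tens2_right_left[of k ?mC] by simp
    also have "lact Z \<cdot> \<dots> = (lact Z \<cdot> (?mC \<star> \<^bold>1 ?z)) \<cdot> (\<^bold>1 (?C \<otimes> ?C) \<star> k)" by simp
    also have "lact Z \<cdot> (?mC \<star> \<^bold>1 ?z) = lact Z \<cdot> (\<^bold>1 ?C \<star> lact Z) \<cdot> \<alpha> ?C ?C ?z" by (rule ze)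
    also have "(\<dots>) \<cdot> (\<^bold>1 (?C \<otimes> ?C) \<star> k) =
      lact Z \<cdot> (\<^bold>1 ?C \<star> lact Z) \<cdot> (\<alpha> ?C ?C ?z \<cdot> ((\<^bold>1 ?C \<star> \<^bold>1 ?C) \<star> k))" by simp
    also have "\<alpha> ?C ?C ?z \<cdot> ((\<^bold>1 ?C \<star> \<^bold>1 ?C) \<star> k) = (\<^bold>1 ?C \<star> (\<^bold>1 ?C \<star> k)) \<cdot> \<alpha> ?C ?C ?t"
      by (subst assoc_nat') simp_all
    also have "lact Z \<cdot> (\<^bold>1 ?C \<star> lact Z) \<cdot> \<dots> = lact Z \<cdot> (\<^bold>1 ?C \<star> (lact Z \<cdot> (\<^bold>1 ?C \<star> k))) \<cdot> \<alpha> ?C ?C ?t"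
      by (simp add: whiskerL)
    also have "\<dots> = lact Z \<cdot> (\<^bold>1 ?C \<star> k) \<cdot> (\<^bold>1 ?C \<star> lact T) \<cdot> \<alpha> ?C ?C ?t"
      by (simp add: l(4)[symmetric] whiskerL)
    finally show "k \<cdot> lact T \<cdot> (?mC \<star> \<^bold>1 ?t) = k \<cdot> lact T \<cdot> (\<^bold>1 ?C \<star> lact T) \<cdot> \<alpha> ?C ?C ?t"
      by (simp add: kl)
  qed simp_all
  have 2: "lact T \<cdot> (?uC \<star> \<^bold>1 ?t) = \<l> ?t"
  proof (rule invertible2_mono[of k])
    have "k \<cdot> lact T \<cdot> (?uC \<star> \<^bold>1 ?t) = lact Z \<cdot> ((\<^bold>1 ?C \<star> k) \<cdot> (?uC \<star> \<^bold>1 ?t))"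
      by (simp add: kl)
    also have "(\<^bold>1 ?C \<star> k) \<cdot> (?uC \<star> \<^bold>1 ?t) = (?uC \<star> \<^bold>1 ?z) \<cdot> (\<^bold>1 (\<I> (tobj Z)) \<star> k)"
      using tens2_left_right[of k ?uC] tens2_right_left[of k ?uC] by simp
    also have "lact Z \<cdot> \<dots> = (lact Z \<cdot> (?uC \<star> \<^bold>1 ?z)) \<cdot> (\<^bold>1 (\<I> (tobj Z)) \<star> k)" by simp
    also have "\<dots> = k \<cdot> \<l> ?t" using lun_nat'[of k "tobj Z" ?z] ze(2) by simp
    finally show "k \<cdot> lact T \<cdot> (?uC \<star> \<^bold>1 ?t) = k \<cdot> \<l> ?t" .
  qed simp_all
  have 3: "ract T \<cdot> (ract T \<star> \<^bold>1 ?A) = ract T \<cdot> (\<^bold>1 ?t \<star> ?mA) \<cdot> \<alpha> ?t ?A ?A"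
  proof (rule invertible2_mono[of k])
    have "k \<cdot> ract T \<cdot> (ract T \<star> \<^bold>1 ?A) = ract Z \<cdot> ((k \<cdot> ract T) \<star> \<^bold>1 ?A)"
      by (simp add: kr whiskerR)
    also have "\<dots> = (ract Z \<cdot> (ract Z \<star> \<^bold>1 ?A)) \<cdot> ((k \<star> \<^bold>1 ?A) \<star> \<^bold>1 ?A)"
      by (simp add: r(4) whiskerR)
    also have "ract Z \<cdot> (ract Z \<star> \<^bold>1 ?A) = ract Z \<cdot> (\<^bold>1 ?z \<star> ?mA) \<cdot> \<alpha> ?z ?A ?A" by (rule ze)
    also have "(\<dots>) \<cdot> ((k \<star> \<^bold>1 ?A) \<star> \<^bold>1 ?A) = ract Z \<cdot> (\<^bold>1 ?z \<star> ?mA) \<cdot> (\<alpha> ?z ?A ?A \<cdot> ((k \<star> \<^bold>1 ?A) \<star>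
        \<^bold>1 ?A))"
      by simp
    also have "\<alpha> ?z ?A ?A \<cdot> ((k \<star> \<^bold>1 ?A) \<star> \<^bold>1 ?A) = (k \<star> \<^bold>1 (?A \<otimes> ?A)) \<cdot> \<alpha> ?t ?A ?A"
      by (subst assoc_nat') simp_all
    also have "ract Z \<cdot> (\<^bold>1 ?z \<star> ?mA) \<cdot> \<dots> = ract Z \<cdot> ((\<^bold>1 ?z \<star> ?mA) \<cdot> (k \<star> \<^bold>1 (?A \<otimes> ?A))) \<cdot> \<alpha> ?t ?A ?A"
      by simp
    also have "(\<^bold>1 ?z \<star> ?mA) \<cdot> (k \<star> \<^bold>1 (?A \<otimes> ?A)) = (k \<star> \<^bold>1 ?A) \<cdot> (\<^bold>1 ?t \<star> ?mA)"
      using tens2_left_right[of ?mA k] tens2_right_left[of ?mA k] by simp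
    finally show "k \<cdot> ract T \<cdot> (ract T \<star> \<^bold>1 ?A) = k \<cdot> ract T \<cdot> (\<^bold>1 ?t \<star> ?mA) \<cdot> \<alpha> ?t ?A ?A"
      by (simp add: kr)
  qed simp_all
  have 4: "ract T \<cdot> (\<^bold>1 ?t \<star> ?uA) = \<r> ?t"
  proof (rule invertible2_mono[of k])
    have "k \<cdot> ract T \<cdot> (\<^bold>1 ?t \<star> ?uA) = ract Z \<cdot> ((k \<star> \<^bold>1 ?A) \<cdot> (\<^bold>1 ?t \<star> ?uA))"
      by (simp add: kr)
    also have "(k \<star> \<^bold>1 ?A) \<cdot> (\<^bold>1 ?t \<star> ?uA) = (\<^bold>1 ?z \<star> ?uA) \<cdot> (k \<star> \<^bold>1 (\<I> (sobj Z)))"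
      using tens2_left_right[of ?uA k] tens2_right_left[of ?uA k] by simp
    also have "ract Z \<cdot> \<dots> = (ract Z \<cdot> (\<^bold>1 ?z \<star> ?uA)) \<cdot> (k \<star> \<^bold>1 (\<I> (sobj Z)))" by simp
    also have "\<dots> = k \<cdot> \<r> ?t" using run_nat'[of k "sobj Z" ?z] ze(4) by simp
    finally show "k \<cdot> ract T \<cdot> (\<^bold>1 ?t \<star> ?uA) = k \<cdot> \<r> ?t" .
  qed simp_all
  have 5: "ract T \<cdot> (lact T \<star> \<^bold>1 ?A) = lact T \<cdot> (\<^bold>1 ?C \<star> ract T) \<cdot> \<alpha> ?C ?t ?A"
  proof (rule invertible2_mono[of k])
    have "k \<cdot> ract T \<cdot> (lact T \<star> \<^bold>1 ?A) = ract Z \<cdot> ((k \<cdot> lact T) \<star> \<^bold>1 ?A)"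
      by (simp add: kr whiskerR)
    also have "\<dots> = (ract Z \<cdot> (lact Z \<star> \<^bold>1 ?A)) \<cdot> ((\<^bold>1 ?C \<star> k) \<star> \<^bold>1 ?A)"
      by (simp add: l(4) whiskerR)
    also have "ract Z \<cdot> (lact Z \<star> \<^bold>1 ?A) = lact Z \<cdot> (\<^bold>1 ?C \<star> ract Z) \<cdot> \<alpha> ?C ?z ?A" by (rule ze)
    also have "(\<dots>) \<cdot> ((\<^bold>1 ?C \<star> k) \<star> \<^bold>1 ?A) =
      lact Z \<cdot> (\<^bold>1 ?C \<star> ract Z) \<cdot> (\<alpha> ?C ?z ?A \<cdot> ((\<^bold>1 ?C \<star> k) \<star> \<^bold>1 ?A))"
      by simp
    also have "\<alpha> ?C ?z ?A \<cdot> ((\<^bold>1 ?C \<star> k) \<star> \<^bold>1 ?A) = (\<^bold>1 ?C \<star> (k \<star> \<^bold>1 ?A)) \<cdot> \<alpha> ?C ?t ?A"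
      by (subst assoc_nat') simp_all
    also have "lact Z \<cdot> (\<^bold>1 ?C \<star> ract Z) \<cdot> \<dots> = lact Z \<cdot> (\<^bold>1 ?C \<star> (ract Z \<cdot> (k \<star> \<^bold>1 ?A))) \<cdot> \<alpha> ?C ?t ?A"
      by (simp add: whiskerL)
    also have "\<dots> = lact Z \<cdot> (\<^bold>1 ?C \<star> k) \<cdot> (\<^bold>1 ?C \<star> ract T) \<cdot> \<alpha> ?C ?t ?A"
      by (simp add: r(4)[symmetric] whiskerL)
    finally show "k \<cdot> ract T \<cdot> (lact T \<star> \<^bold>1 ?A) = k \<cdot> lact T \<cdot> (\<^bold>1 ?C \<star> ract T) \<cdot> \<alpha> ?C ?t ?A"
      by (simp add: kl)
  qed simp_all
  have "T \<in> eq_mor1 B"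
    unfolding eq_mor1_def bimodule_def left_module_def right_module_def Let_def hom1_def hom2_def
    using 1 2 3 4 5 by simp
  then show ?thesis using l r by (simp add: bimodule_iso_def)
qed

text \<open>\<open>tensor_model Y X Z q\<close> says that the bimodule \<open>Z\<close> is a relative tensor product of \<open>Y\<close> and \<open>X\<close>, with
  projection \<open>q\<close>. The section of \<open>q\<close> is required because whiskering preserves split epimorphisms but
  not coequalisers in general, and the actions on a relative tensor product are defined by factoring
  through a whiskered projection.\<close>

definition tensor_model ::
    "('o, 'm, 'c) bimod \<Rightarrow> ('o, 'm, 'c) bimod \<Rightarrow> ('o, 'm, 'c) bimod \<Rightarrow> 'c \<Rightarrow> bool" where
  "tensor_model Y X Z q \<longleftrightarrow> Y \<in> eq_mor1 B \<and> X \<in> eq_mor1 B \<and> Z \<in> eq_mor1 B \<and>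
     bsrc Y = btrg X \<and> bsrc Z = bsrc X \<and> btrg Z = btrg Y \<and>
     coequaliser B (ract Y \<star> \<^bold>1 (bcar X)) ((\<^bold>1 (bcar Y) \<star> lact X) \<cdot> \<alpha> (bcar Y) (salg Y) (bcar X)) q \<and>
     Cod q = bcar Z \<and>
     (\<exists>s. s \<in> Arr \<and> Dom s = bcar Z \<and> Cod s = bcar Y \<otimes> bcar X \<and> q \<cdot> s = \<^bold>1 (bcar Z)) \<and>
     lact Z \<cdot> (\<^bold>1 (talg Y) \<star> q) \<cdot> \<alpha> (talg Y) (bcar Y) (bcar X) = q \<cdot> (lact Y \<star> \<^bold>1 (bcar X)) \<and>
     ract Z \<cdot> (q \<star> \<^bold>1 (salg X)) = q \<cdot> (\<^bold>1 (bcar Y) \<star> ract X) \<cdot> \<alpha> (bcar Y) (bcar X) (salg X)"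

lemma tensor_modelD:
  assumes "tensor_model Y X Z q"
  shows "Y \<in> eq_mor1 B" "X \<in> eq_mor1 B" "Z \<in> eq_mor1 B"
    "bsrc Y = btrg X" "bsrc Z = bsrc X" "btrg Z = btrg Y"
    "coequaliser B (ract Y \<star> \<^bold>1 (bcar X)) ((\<^bold>1 (bcar Y) \<star> lact X) \<cdot> \<alpha> (bcar Y) (salg Y) (bcar X)) q"
    "Cod q = bcar Z"
    "\<exists>s. s \<in> Arr \<and> Dom s = bcar Z \<and> Cod s = bcar Y \<otimes> bcar X \<and> q \<cdot> s = \<^bold>1 (bcar Z)"
    "lact Z \<cdot> (\<^bold>1 (talg Y) \<star> q) \<cdot> \<alpha> (talg Y) (bcar Y) (bcar X) = q \<cdot> (lact Y \<star> \<^bold>1 (bcar X))"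
    "ract Z \<cdot> (q \<star> \<^bold>1 (salg X)) = q \<cdot> (\<^bold>1 (bcar Y) \<star> ract X) \<cdot> \<alpha> (bcar Y) (bcar X) (salg X)"
  using assms unfolding tensor_model_def by blast+

lemma tensor_model_proj:
  assumes m: "tensor_model Y X Z q"
  shows "q \<in> Arr" "Dom q = bcar Y \<otimes> bcar X"
  using coequaliserD[OF tensor_modelD(7)[OF m]] tensor_modelD(1,2,4)[OF m] by simp_all

text \<open>The chosen coequaliser \<open>p\<close> and the model projection \<open>q\<close> factor through each other by inverse isomorphisms
  \<open>j\<close> and \<open>i\<close>; the actions on the chosen object are then forced to be those of \<open>Z\<close> transported along \<open>j\<close>.\<close>

lemma tensor_model_iso:
  assumes m: "tensor_model Y X Z q"
  defines "p \<equiv> tens_proj B Y X" and "T \<equiv> rel_tens B Y X"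
  defines "k \<equiv> factor2 B p q"
  shows "bimodule_iso k T Z" "k \<cdot> p = q" "p \<in> Arr" "Dom p = bcar Y \<otimes> bcar X" "Cod p = bcar T"
    "\<exists>s. s \<in> Arr \<and> Dom s = bcar T \<and> Cod s = bcar Y \<otimes> bcar X \<and> p \<cdot> s = \<^bold>1 (bcar T)"
proof -
  let ?y = "bcar Y" and ?x = "bcar X" and ?z = "bcar Z"
  let ?f = "ract Y \<star> \<^bold>1 ?x" and ?g = "(\<^bold>1 ?y \<star> lact X) \<cdot> \<alpha> ?y (salg Y) ?x"
  note d [simp] = tensor_modelD(1-6,8)[OF m] and q [simp] = tensor_model_proj[OF m]
  note Yd [simp] = eq_mor1D[OF d(1)] and Xd [simp] = eq_mor1D[OF d(2)] and Zd [simp] = eq_mor1D[OF d(3)]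
  note cq = tensor_modelD(7)[OF m]
  have f [simp]: "?f \<in> Arr" "?g \<in> Arr" "Cod ?g = Cod ?f" "Cod ?f = ?y \<otimes> ?x"
    by simp_all
  have cp: "coequaliser B ?f ?g p"
    unfolding p_def tens_proj_def using cq by (rule someI)
  have p [simp]: "p \<in> Arr" "Dom p = ?y \<otimes> ?x" using coequaliserD[OF cp] by simp_all
  obtain j where j: "j \<in> Arr" "Dom j = Cod p" "Cod j = Cod q" "j \<cdot> p = q"
    using coequaliser_factor[OF cp, of q] coequaliserD[OF cq] by blast
  obtain i where i: "i \<in> Arr" "Dom i = Cod q" "Cod i = Cod p" "i \<cdot> q = p"
    using coequaliser_factor[OF cq, of p] coequaliserD[OF cp] by blast
  note [simp] = j(1-3) i(1-3)
  have ij: "i \<cdot> j = \<^bold>1 (Cod p)"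
    by (rule coequaliser_unique[OF cp f(1-3)]) (simp_all add: i(4) j(4))
  have ji: "j \<cdot> i = \<^bold>1 (Cod q)"
    by (rule coequaliser_unique[OF cq f(1-3)]) (simp_all add: i(4) j(4))
  have jinv: "inverse2 B j i" using ij ji by (intro inverse2I) simp_all
  then have jI [simp]: "invertible2 B j" by (auto simp: invertible2_def)
  obtain s where s [simp]: "s \<in> Arr" "Dom s = ?z" "Cod s = ?y \<otimes> ?x" and qs: "q \<cdot> s = \<^bold>1 ?z"
    using tensor_modelD(9)[OF m] by blast
  have ps: "p \<cdot> s \<cdot> j = \<^bold>1 (Cod p)"
  proof (rule invertible2_mono[of j])
    show "j \<cdot> p \<cdot> s \<cdot> j = j \<cdot> \<^bold>1 (Cod p)"
      using reassoc[OF j(4), of "s \<cdot> j"] reassoc[OF qs, of j] by simp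
  qed simp_all
  have k: "k = j" unfolding k_def
    by (rule factor2_eqI[where s = "s \<cdot> j"]) (simp_all add: ps j(4))
  have [simp]: "bsrc T = bsrc X" "btrg T = btrg Y" "bcar T = Cod p"
    by (simp_all add: T_def rel_tens_def Let_def p_def)
  let ?C = "talg Y" and ?A = "salg X"
  have pm [simp]: "Cod p \<in> Mor1 B" "src1 B (Cod p) = sobj X" "trg1 B (Cod p) = tobj Y"
    using mor2_mor1[OF p(1)] by simp_all
  have lw: "(\<^bold>1 ?C \<star> p) \<cdot> (\<^bold>1 ?C \<star> (s \<cdot> j)) = \<^bold>1 (?C \<otimes> Cod p)"
    by (subst whiskerL[symmetric]) (simp_all add: ps)
  have lT: "lact T = i \<cdot> lact Z \<cdot> (\<^bold>1 ?C \<star> j)"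
  proof -
    have "i \<cdot> lact Z \<cdot> (\<^bold>1 ?C \<star> q) = p \<cdot> (lact Y \<star> \<^bold>1 ?x) \<cdot> inv2 B (\<alpha> ?C ?y ?x)"
    proof (rule invertible2_epi[of "\<alpha> ?C ?y ?x"])
      have "(i \<cdot> lact Z \<cdot> (\<^bold>1 ?C \<star> q)) \<cdot> \<alpha> ?C ?y ?x = i \<cdot> (lact Z \<cdot> (\<^bold>1 ?C \<star> q) \<cdot> \<alpha> ?C ?y ?x)"
        by simp
      also have "\<dots> = i \<cdot> q \<cdot> (lact Y \<star> \<^bold>1 ?x)" by (simp only: tensor_modelD(10)[OF m])
      also have "\<dots> = p \<cdot> (lact Y \<star> \<^bold>1 ?x)" by (rule reassoc[OF i(4)]) simp_all
      finally show "(i \<cdot> lact Z \<cdot> (\<^bold>1 ?C \<star> q)) \<cdot> \<alpha> ?C ?y ?x =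
        (p \<cdot> (lact Y \<star> \<^bold>1 ?x) \<cdot> inv2 B (\<alpha> ?C ?y ?x)) \<cdot> \<alpha> ?C ?y ?x" by simp
    qed simp_all
    moreover have "(\<^bold>1 ?C \<star> j) \<cdot> (\<^bold>1 ?C \<star> p) = \<^bold>1 ?C \<star> q"
      by (subst whiskerL[symmetric]) (simp_all add: j(4))
    ultimately have "factor2 B (\<^bold>1 ?C \<star> p) (p \<cdot> (lact Y \<star> \<^bold>1 ?x) \<cdot> inv2 B (\<alpha> ?C ?y ?x)) =
      i \<cdot> lact Z \<cdot> (\<^bold>1 ?C \<star> j)"
      by (intro factor2_eqI[where s = "\<^bold>1 ?C \<star> (s \<cdot> j)"]) (simp_all add: lw)
    then show ?thesis by (simp add: T_def rel_tens_def Let_def p_def)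
  qed
  have rw: "(p \<star> \<^bold>1 ?A) \<cdot> ((s \<cdot> j) \<star> \<^bold>1 ?A) = \<^bold>1 (Cod p \<otimes> ?A)"
    by (subst whiskerR[symmetric]) (simp_all add: ps)
  have rT: "ract T = i \<cdot> ract Z \<cdot> (j \<star> \<^bold>1 ?A)"
  proof -
    have "i \<cdot> ract Z \<cdot> (q \<star> \<^bold>1 ?A) = i \<cdot> q \<cdot> (\<^bold>1 ?y \<star> ract X) \<cdot> \<alpha> ?y ?x ?A"
      by (simp only: tensor_modelD(11)[OF m])
    also have "\<dots> = p \<cdot> (\<^bold>1 ?y \<star> ract X) \<cdot> \<alpha> ?y ?x ?A" by (rule reassoc[OF i(4)]) simp_all
    finally have "i \<cdot> ract Z \<cdot> (q \<star> \<^bold>1 ?A) = p \<cdot> (\<^bold>1 ?y \<star> ract X) \<cdot> \<alpha> ?y ?x ?A" .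
    moreover have "(j \<star> \<^bold>1 ?A) \<cdot> (p \<star> \<^bold>1 ?A) = q \<star> \<^bold>1 ?A"
      by (subst whiskerR[symmetric]) (simp_all add: j(4))
    ultimately have "factor2 B (p \<star> \<^bold>1 ?A) (p \<cdot> (\<^bold>1 ?y \<star> ract X) \<cdot> \<alpha> ?y ?x ?A) =
      i \<cdot> ract Z \<cdot> (j \<star> \<^bold>1 ?A)"
      by (intro factor2_eqI[where s = "(s \<cdot> j) \<star> \<^bold>1 ?A"]) (simp_all add: rw)
    then show ?thesis by (simp add: T_def rel_tens_def Let_def p_def)
  qed
  show "bimodule_iso k T Z"
    unfolding k
  proof (rule eq_mor1_transport)
    show "j \<cdot> lact T = lact Z \<cdot> (\<^bold>1 (talg Z) \<star> j)"
      unfolding lT using reassoc[OF ji, of "lact Z \<cdot> (\<^bold>1 (talg Z) \<star> j)"] by simp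
    show "j \<cdot> ract T = ract Z \<cdot> (j \<star> \<^bold>1 (salg Z))"
      unfolding rT using reassoc[OF ji, of "ract Z \<cdot> (j \<star> \<^bold>1 (salg Z))"] by simp
  qed (simp_all add: lT rT)
  show "k \<cdot> p = q" using k j by simp
  show "p \<in> Arr" "Dom p = ?y \<otimes> ?x" "Cod p = bcar T" by simp_all
  show "\<exists>s. s \<in> Arr \<and> Dom s = bcar T \<and> Cod s = ?y \<otimes> ?x \<and> p \<cdot> s = \<^bold>1 (bcar T)"
    by (rule exI[of _ "s \<cdot> j"]) (simp add: ps)
qed

text \<open>A bimodule is its own tensor product with a regular bimodule. The bar resolution is contracted by
  inserting the unit of the algebra, on the far left here and on the far right in the mirror image.\<close>

lemma tensor_model_unit_left:
  assumes X [simp]: "X \<in> eq_mor1 B"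
  shows "tensor_model (regular_bimod (btrg X)) X X (lact X)"
proof -
  note Xd [simp] = eq_mor1D[OF X] and od [simp] = eq_objD[OF eq_mor1D(2)[OF X]]
  note oe = eq_obj_eqs[OF eq_mor1D(2)[OF X]] and xe = eq_mor1_eqs[OF X]
  let ?C = "talg X" and ?x = "bcar X" and ?I = "\<I> (tobj X)"
  let ?m = "mult (snd (btrg X))" and ?u = "munit (snd (btrg X))"
  define s where "s = (?u \<star> \<^bold>1 ?x) \<cdot> inv2 B (\<l> ?x)"
  define t where "t = ((?u \<star> \<^bold>1 ?C) \<cdot> inv2 B (\<l> ?C)) \<star> \<^bold>1 ?x"
  have [simp]: "s \<in> Arr" "Dom s = ?x" "Cod s = ?C \<otimes> ?x"
    "t \<in> Arr" "Dom t = ?C \<otimes> ?x" "Cod t = (?C \<otimes> ?C) \<otimes> ?x"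
    by (simp_all add: s_def t_def)
  have qs: "lact X \<cdot> s = \<^bold>1 ?x"
    unfolding s_def using reassoc[OF xe(2), of "inv2 B (\<l> ?x)"] by simp
  have ft: "(?m \<star> \<^bold>1 ?x) \<cdot> t = \<^bold>1 (?C \<otimes> ?x)"
  proof -
    have "?m \<cdot> (?u \<star> \<^bold>1 ?C) \<cdot> inv2 B (\<l> ?C) = \<^bold>1 ?C"
      using reassoc[OF oe(2), of "inv2 B (\<l> ?C)"] by simp
    then show ?thesis unfolding t_def by (subst whiskerR[symmetric]) simp_all
  qed
  have gt: "((\<^bold>1 ?C \<star> lact X) \<cdot> \<alpha> ?C ?C ?x) \<cdot> t = s \<cdot> lact X"
  proof -
    have e: "\<alpha> ?I ?C ?x \<cdot> (inv2 B (\<l> ?C) \<star> \<^bold>1 ?x) = inv2 B (\<l> (?C \<otimes> ?x))"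
    proof (rule invertible2_mono[of "\<l> (?C \<otimes> ?x)"])
      have "\<l> (?C \<otimes> ?x) \<cdot> \<alpha> ?I ?C ?x \<cdot> (inv2 B (\<l> ?C) \<star> \<^bold>1 ?x) =
        (\<l> ?C \<star> \<^bold>1 ?x) \<cdot> (inv2 B (\<l> ?C) \<star> \<^bold>1 ?x)"
        by (rule reassoc[OF lun_tens]) simp_all
      also have "\<dots> = \<^bold>1 (?C \<otimes> ?x)" by (subst whiskerR[symmetric]) simp_all
      finally show "\<l> (?C \<otimes> ?x) \<cdot> \<alpha> ?I ?C ?x \<cdot> (inv2 B (\<l> ?C) \<star> \<^bold>1 ?x) =
        \<l> (?C \<otimes> ?x) \<cdot> inv2 B (\<l> (?C \<otimes> ?x))" by simp
    qed simp_all
    have n: "(\<^bold>1 ?I \<star> lact X) \<cdot> inv2 B (\<l> (?C \<otimes> ?x)) = inv2 B (\<l> ?x) \<cdot> lact X"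
    proof (rule invertible2_mono[of "\<l> ?x"])
      have l: "\<l> ?x \<cdot> (\<^bold>1 ?I \<star> lact X) = lact X \<cdot> \<l> (?C \<otimes> ?x)"
        by (subst lun_nat') simp_all
      have "\<l> ?x \<cdot> (\<^bold>1 ?I \<star> lact X) \<cdot> inv2 B (\<l> (?C \<otimes> ?x)) =
        (lact X \<cdot> \<l> (?C \<otimes> ?x)) \<cdot> inv2 B (\<l> (?C \<otimes> ?x))"
        by (rule reassoc[OF l]) simp_all
      then show "\<l> ?x \<cdot> (\<^bold>1 ?I \<star> lact X) \<cdot> inv2 B (\<l> (?C \<otimes> ?x)) = \<l> ?x \<cdot> inv2 B (\<l> ?x) \<cdot> lact X"
        by simp
    qed simp_all
    have "((\<^bold>1 ?C \<star> lact X) \<cdot> \<alpha> ?C ?C ?x) \<cdot> t =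
      (\<^bold>1 ?C \<star> lact X) \<cdot> (\<alpha> ?C ?C ?x \<cdot> ((?u \<star> \<^bold>1 ?C) \<star> \<^bold>1 ?x)) \<cdot> (inv2 B (\<l> ?C) \<star> \<^bold>1 ?x)"
      by (simp add: t_def whiskerR)
    also have "\<alpha> ?C ?C ?x \<cdot> ((?u \<star> \<^bold>1 ?C) \<star> \<^bold>1 ?x) = (?u \<star> \<^bold>1 (?C \<otimes> ?x)) \<cdot> \<alpha> ?I ?C ?x"
      by (subst assoc_nat') simp_all
    also have "(\<^bold>1 ?C \<star> lact X) \<cdot> (\<dots>) \<cdot> (inv2 B (\<l> ?C) \<star> \<^bold>1 ?x) =
      ((\<^bold>1 ?C \<star> lact X) \<cdot> (?u \<star> \<^bold>1 (?C \<otimes> ?x))) \<cdot> inv2 B (\<l> (?C \<otimes> ?x))"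
      by (simp add: e)
    also have "(\<^bold>1 ?C \<star> lact X) \<cdot> (?u \<star> \<^bold>1 (?C \<otimes> ?x)) = (?u \<star> \<^bold>1 ?x) \<cdot> (\<^bold>1 ?I \<star> lact X)"
      using tens2_left_right[of "lact X" ?u] tens2_right_left[of "lact X" ?u] by simp
    finally show ?thesis by (simp add: s_def n)
  qed
  have "coequaliser B (?m \<star> \<^bold>1 ?x) ((\<^bold>1 ?C \<star> lact X) \<cdot> \<alpha> ?C ?C ?x) (lact X)"
  proof (rule split_coequaliser[where s = s and t = t])
    show "(?m \<star> \<^bold>1 ?x) \<cdot> t = \<^bold>1 (Cod (?m \<star> \<^bold>1 ?x)) \<and>
        ((\<^bold>1 ?C \<star> lact X) \<cdot> \<alpha> ?C ?C ?x) \<cdot> t = s \<cdot> lact X \<or>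
      ((\<^bold>1 ?C \<star> lact X) \<cdot> \<alpha> ?C ?C ?x) \<cdot> t = \<^bold>1 (Cod (?m \<star> \<^bold>1 ?x)) \<and>
        (?m \<star> \<^bold>1 ?x) \<cdot> t = s \<cdot> lact X"
      using ft gt by simp
    show "lact X \<cdot> (?m \<star> \<^bold>1 ?x) = lact X \<cdot> (\<^bold>1 ?C \<star> lact X) \<cdot> \<alpha> ?C ?C ?x" by (rule xe)
  qed (use qs in simp_all)
  moreover have "\<exists>s. s \<in> Arr \<and> Dom s = ?x \<and> Cod s = ?C \<otimes> ?x \<and> lact X \<cdot> s = \<^bold>1 ?x"
    by (rule exI[of _ s]) (simp add: qs)
  ultimately show ?thesis
    unfolding tensor_model_def using xe(1,5) by simp
qed

lemma tensor_model_unit_right: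
  assumes Y [simp]: "Y \<in> eq_mor1 B"
  shows "tensor_model Y (regular_bimod (bsrc Y)) Y (ract Y)"
proof -
  note Yd [simp] = eq_mor1D[OF Y] and od [simp] = eq_objD[OF eq_mor1D(1)[OF Y]]
  note oe = eq_obj_eqs[OF eq_mor1D(1)[OF Y]] and ye = eq_mor1_eqs[OF Y]
  let ?A = "salg Y" and ?y = "bcar Y" and ?I = "\<I> (sobj Y)"
  let ?m = "mult (snd (bsrc Y))" and ?u = "munit (snd (bsrc Y))"
  define s where "s = (\<^bold>1 ?y \<star> ?u) \<cdot> inv2 B (\<r> ?y)"
  define t where "t = inv2 B (\<alpha> ?y ?A ?A) \<cdot> (\<^bold>1 ?y \<star> ((\<^bold>1 ?A \<star> ?u) \<cdot> inv2 B (\<r> ?A)))"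
  have [simp]: "s \<in> Arr" "Dom s = ?y" "Cod s = ?y \<otimes> ?A"
    "t \<in> Arr" "Dom t = ?y \<otimes> ?A" "Cod t = (?y \<otimes> ?A) \<otimes> ?A"
    by (simp_all add: s_def t_def)
  have qs: "ract Y \<cdot> s = \<^bold>1 ?y"
    unfolding s_def using reassoc[OF ye(4), of "inv2 B (\<r> ?y)"] by simp
  have gt: "((\<^bold>1 ?y \<star> ?m) \<cdot> \<alpha> ?y ?A ?A) \<cdot> t = \<^bold>1 (?y \<otimes> ?A)"
  proof -
    have "?m \<cdot> (\<^bold>1 ?A \<star> ?u) \<cdot> inv2 B (\<r> ?A) = \<^bold>1 ?A"
      using reassoc[OF oe(3), of "inv2 B (\<r> ?A)"] by simp
    then show ?thesis unfolding t_def by (simp add: whiskerL[symmetric])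
  qed
  have ft: "(ract Y \<star> \<^bold>1 ?A) \<cdot> t = s \<cdot> ract Y"
  proof -
    have e: "inv2 B (\<alpha> ?y ?A ?I) \<cdot> (\<^bold>1 ?y \<star> inv2 B (\<r> ?A)) = inv2 B (\<r> (?y \<otimes> ?A))"
    proof (rule invertible2_mono[of "\<r> (?y \<otimes> ?A)"])
      have r: "\<r> (?y \<otimes> ?A) = (\<^bold>1 ?y \<star> \<r> ?A) \<cdot> \<alpha> ?y ?A ?I"
        by (rule run_tens[symmetric]) simp_all
      have "\<r> (?y \<otimes> ?A) \<cdot> inv2 B (\<alpha> ?y ?A ?I) \<cdot> (\<^bold>1 ?y \<star> inv2 B (\<r> ?A)) =
        (\<^bold>1 ?y \<star> \<r> ?A) \<cdot> (\<^bold>1 ?y \<star> inv2 B (\<r> ?A))"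
        unfolding r by simp
      also have "\<dots> = \<^bold>1 (?y \<otimes> ?A)" by (subst whiskerL[symmetric]) simp_all
      finally show "\<r> (?y \<otimes> ?A) \<cdot> inv2 B (\<alpha> ?y ?A ?I) \<cdot> (\<^bold>1 ?y \<star> inv2 B (\<r> ?A)) =
        \<r> (?y \<otimes> ?A) \<cdot> inv2 B (\<r> (?y \<otimes> ?A))" by simp
    qed simp_all
    have n: "(ract Y \<star> \<^bold>1 ?I) \<cdot> inv2 B (\<r> (?y \<otimes> ?A)) = inv2 B (\<r> ?y) \<cdot> ract Y"
    proof (rule invertible2_mono[of "\<r> ?y"])
      have r: "\<r> ?y \<cdot> (ract Y \<star> \<^bold>1 ?I) = ract Y \<cdot> \<r> (?y \<otimes> ?A)"
        by (subst run_nat') simp_all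
      have "\<r> ?y \<cdot> (ract Y \<star> \<^bold>1 ?I) \<cdot> inv2 B (\<r> (?y \<otimes> ?A)) =
        (ract Y \<cdot> \<r> (?y \<otimes> ?A)) \<cdot> inv2 B (\<r> (?y \<otimes> ?A))"
        by (rule reassoc[OF r]) simp_all
      then show "\<r> ?y \<cdot> (ract Y \<star> \<^bold>1 ?I) \<cdot> inv2 B (\<r> (?y \<otimes> ?A)) = \<r> ?y \<cdot> inv2 B (\<r> ?y) \<cdot> ract Y"
        by simp
    qed simp_all
    have a: "inv2 B (\<alpha> ?y ?A ?A) \<cdot> (\<^bold>1 ?y \<star> (\<^bold>1 ?A \<star> ?u)) = (\<^bold>1 (?y \<otimes> ?A) \<star> ?u) \<cdot> inv2 B (\<alpha> ?y ?A ?I)"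
    proof (rule invertible2_mono[of "\<alpha> ?y ?A ?A"])
      have assoc: "\<alpha> ?y ?A ?A \<cdot> (\<^bold>1 (?y \<otimes> ?A) \<star> ?u) = (\<^bold>1 ?y \<star> (\<^bold>1 ?A \<star> ?u)) \<cdot> \<alpha> ?y ?A ?I"
        using assoc_nat'[of ?u "\<^bold>1 ?A" "\<^bold>1 ?y", OF _ _ _ _ _ refl refl refl] by simp
      show "\<alpha> ?y ?A ?A \<cdot> inv2 B (\<alpha> ?y ?A ?A) \<cdot> (\<^bold>1 ?y \<star> (\<^bold>1 ?A \<star> ?u)) =
        \<alpha> ?y ?A ?A \<cdot> (\<^bold>1 (?y \<otimes> ?A) \<star> ?u) \<cdot> inv2 B (\<alpha> ?y ?A ?I)"
        by simp (subst reassoc[OF assoc], simp_all)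
    qed simp_all
    have "(ract Y \<star> \<^bold>1 ?A) \<cdot> t =
      (ract Y \<star> \<^bold>1 ?A) \<cdot> (inv2 B (\<alpha> ?y ?A ?A) \<cdot> (\<^bold>1 ?y \<star> (\<^bold>1 ?A \<star> ?u))) \<cdot> (\<^bold>1 ?y \<star> inv2 B (\<r> ?A))"
      by (simp add: t_def whiskerL)
    also have "\<dots> = ((ract Y \<star> \<^bold>1 ?A) \<cdot> (\<^bold>1 (?y \<otimes> ?A) \<star> ?u)) \<cdot> inv2 B (\<r> (?y \<otimes> ?A))"
      by (simp add: a e)
    also have "(ract Y \<star> \<^bold>1 ?A) \<cdot> (\<^bold>1 (?y \<otimes> ?A) \<star> ?u) = (\<^bold>1 ?y \<star> ?u) \<cdot> (ract Y \<star> \<^bold>1 ?I)"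
      using tens2_left_right[of ?u "ract Y"] tens2_right_left[of ?u "ract Y"] by simp
    finally show ?thesis by (simp add: s_def n)
  qed
  have "coequaliser B (ract Y \<star> \<^bold>1 ?A) ((\<^bold>1 ?y \<star> ?m) \<cdot> \<alpha> ?y ?A ?A) (ract Y)"
  proof (rule split_coequaliser[where s = s and t = t])
    show "(ract Y \<star> \<^bold>1 ?A) \<cdot> t = \<^bold>1 (Cod (ract Y \<star> \<^bold>1 ?A)) \<and>
        ((\<^bold>1 ?y \<star> ?m) \<cdot> \<alpha> ?y ?A ?A) \<cdot> t = s \<cdot> ract Y \<or>
      ((\<^bold>1 ?y \<star> ?m) \<cdot> \<alpha> ?y ?A ?A) \<cdot> t = \<^bold>1 (Cod (ract Y \<star> \<^bold>1 ?A)) \<and>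
        (ract Y \<star> \<^bold>1 ?A) \<cdot> t = s \<cdot> ract Y"
      using ft gt by simp
    show "ract Y \<cdot> (ract Y \<star> \<^bold>1 ?A) = ract Y \<cdot> (\<^bold>1 ?y \<star> ?m) \<cdot> \<alpha> ?y ?A ?A" by (rule ye)
  qed (use qs in simp_all)
  moreover have "\<exists>s. s \<in> Arr \<and> Dom s = ?y \<and> Cod s = ?y \<otimes> ?A \<and> ract Y \<cdot> s = \<^bold>1 ?y"
    by (rule exI[of _ s]) (simp add: qs)
  ultimately show ?thesis
    unfolding tensor_model_def using ye(3,5) by simp
qed

text \<open>Models are invariant under isomorphism of the factors. This reduces every threefold product below
  to a product of two concrete bimodules: an inner product may be replaced by its model.\<close>

lemma tensor_model_iso_cong:
  assumes m: "tensor_model Y X Z q" and k: "bimodule_iso k Y' Y" and l: "bimodule_iso l X' X"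
  shows "tensor_model Y' X' Z (q \<cdot> (k \<star> l))"
proof -
  note d [simp] = tensor_modelD(1-6,8)[OF m] and q [simp] = tensor_model_proj[OF m]
  note kd [simp] = bimodule_isoD(1,3-8)[OF k] and ld [simp] = bimodule_isoD(1,3-8)[OF l]
  note [simp] = eq_mor1D[OF d(1)] eq_mor1D[OF d(2)] eq_mor1D[OF d(3)]
    eq_mor1D(3-11)[OF kd(1)] eq_mor1D(3-11)[OF ld(1)]
  note kl = bimodule_isoD(9)[OF k, simplified] and kr = bimodule_isoD(10)[OF k, simplified]
    and ll = bimodule_isoD(9)[OF l, simplified] and lr = bimodule_isoD(10)[OF l, simplified]
  let ?y = "bcar Y" and ?x = "bcar X" and ?S = "salg Y" and ?C = "talg Y" and ?A = "salg X"
  let ?y' = "bcar Y'" and ?x' = "bcar X'" and ?K = "k \<star> l"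
  note ic = interchange'[symmetric]
  have "coequaliser B (ract Y' \<star> \<^bold>1 ?x') ((\<^bold>1 ?y' \<star> lact X') \<cdot> \<alpha> ?y' ?S ?x') (q \<cdot> ?K)"
  proof (rule coequaliser_iso[OF tensor_modelD(7)[OF m], where u = "(k \<star> \<^bold>1 ?S) \<star> l"])
    show "?K \<cdot> (ract Y' \<star> \<^bold>1 ?x') = (ract Y \<star> \<^bold>1 ?x) \<cdot> ((k \<star> \<^bold>1 ?S) \<star> l)"
      by (simp add: ic kr)
    have "?K \<cdot> (\<^bold>1 ?y' \<star> lact X') \<cdot> \<alpha> ?y' ?S ?x' = (?K \<cdot> (\<^bold>1 ?y' \<star> lact X')) \<cdot> \<alpha> ?y' ?S ?x'"
      by simp
    also have "?K \<cdot> (\<^bold>1 ?y' \<star> lact X') = (\<^bold>1 ?y \<star> lact X) \<cdot> (k \<star> (\<^bold>1 ?S \<star> l))"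
      by (simp add: ic ll)
    also have "(\<dots>) \<cdot> \<alpha> ?y' ?S ?x' = (\<^bold>1 ?y \<star> lact X) \<cdot> ((k \<star> (\<^bold>1 ?S \<star> l)) \<cdot> \<alpha> ?y' ?S ?x')"
      by simp
    also have "(k \<star> (\<^bold>1 ?S \<star> l)) \<cdot> \<alpha> ?y' ?S ?x' = \<alpha> ?y ?S ?x \<cdot> ((k \<star> \<^bold>1 ?S) \<star> l)"
      by (subst assoc_nat') simp_all
    finally show "?K \<cdot> (\<^bold>1 ?y' \<star> lact X') \<cdot> \<alpha> ?y' ?S ?x' =
      ((\<^bold>1 ?y \<star> lact X) \<cdot> \<alpha> ?y ?S ?x) \<cdot> ((k \<star> \<^bold>1 ?S) \<star> l)" by simp
  qed simp_all
  moreover have "lact Z \<cdot> (\<^bold>1 ?C \<star> (q \<cdot> ?K)) \<cdot> \<alpha> ?C ?y' ?x' = (q \<cdot> ?K) \<cdot> (lact Y' \<star> \<^bold>1 ?x')"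
  proof -
    have "lact Z \<cdot> (\<^bold>1 ?C \<star> (q \<cdot> ?K)) \<cdot> \<alpha> ?C ?y' ?x' =
      lact Z \<cdot> (\<^bold>1 ?C \<star> q) \<cdot> ((\<^bold>1 ?C \<star> ?K) \<cdot> \<alpha> ?C ?y' ?x')"
      by (simp add: whiskerL)
    also have "(\<^bold>1 ?C \<star> ?K) \<cdot> \<alpha> ?C ?y' ?x' = \<alpha> ?C ?y ?x \<cdot> ((\<^bold>1 ?C \<star> k) \<star> l)"
      by (subst assoc_nat') simp_all
    also have "lact Z \<cdot> (\<^bold>1 ?C \<star> q) \<cdot> \<dots> =
      (lact Z \<cdot> (\<^bold>1 ?C \<star> q) \<cdot> \<alpha> ?C ?y ?x) \<cdot> ((\<^bold>1 ?C \<star> k) \<star> l)" by simp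
    also have "lact Z \<cdot> (\<^bold>1 ?C \<star> q) \<cdot> \<alpha> ?C ?y ?x = q \<cdot> (lact Y \<star> \<^bold>1 ?x)"
      by (rule tensor_modelD(10)[OF m])
    finally show ?thesis by (simp add: ic kl)
  qed
  moreover have "ract Z \<cdot> ((q \<cdot> ?K) \<star> \<^bold>1 ?A) = (q \<cdot> ?K) \<cdot> (\<^bold>1 ?y' \<star> ract X') \<cdot> \<alpha> ?y' ?x' ?A"
  proof -
    have "ract Z \<cdot> ((q \<cdot> ?K) \<star> \<^bold>1 ?A) = (ract Z \<cdot> (q \<star> \<^bold>1 ?A)) \<cdot> (?K \<star> \<^bold>1 ?A)"
      by (simp add: whiskerR)
    also have "ract Z \<cdot> (q \<star> \<^bold>1 ?A) = q \<cdot> (\<^bold>1 ?y \<star> ract X) \<cdot> \<alpha> ?y ?x ?A"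
      by (rule tensor_modelD(11)[OF m])
    also have "(\<dots>) \<cdot> (?K \<star> \<^bold>1 ?A) = q \<cdot> (\<^bold>1 ?y \<star> ract X) \<cdot> (\<alpha> ?y ?x ?A \<cdot> (?K \<star> \<^bold>1 ?A))"
      by simp
    also have "\<alpha> ?y ?x ?A \<cdot> (?K \<star> \<^bold>1 ?A) = (k \<star> (l \<star> \<^bold>1 ?A)) \<cdot> \<alpha> ?y' ?x' ?A"
      by (subst assoc_nat') simp_all
    also have "q \<cdot> (\<^bold>1 ?y \<star> ract X) \<cdot> \<dots> =
      q \<cdot> ((\<^bold>1 ?y \<star> ract X) \<cdot> (k \<star> (l \<star> \<^bold>1 ?A))) \<cdot> \<alpha> ?y' ?x' ?A" by simp
    also have "(\<^bold>1 ?y \<star> ract X) \<cdot> (k \<star> (l \<star> \<^bold>1 ?A)) = ?K \<cdot> (\<^bold>1 ?y' \<star> ract X')"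
      by (simp add: ic lr)
    finally show ?thesis by simp
  qed
  moreover obtain s where s [simp]: "s \<in> Arr" "Dom s = bcar Z" "Cod s = ?y \<otimes> ?x"
    and "q \<cdot> s = \<^bold>1 (bcar Z)"
    using tensor_modelD(9)[OF m] by blast
  then have "\<exists>t. t \<in> Arr \<and> Dom t = bcar Z \<and> Cod t = ?y' \<otimes> ?x' \<and> (q \<cdot> ?K) \<cdot> t = \<^bold>1 (bcar Z)"
    by (intro exI[of _ "inv2 B ?K \<cdot> s"]) simp
  ultimately show ?thesis unfolding tensor_model_def by simp
qed

lemma tensor_model_iso_left:
  assumes m: "tensor_model Y X Z q" and k: "bimodule_iso k Y' Y"
  shows "tensor_model Y' X Z (q \<cdot> (k \<star> \<^bold>1 (bcar X)))"
  by (rule tensor_model_iso_cong[OF m k bimodule_iso_id[OF tensor_modelD(2)[OF m]]])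

lemma tensor_model_iso_right:
  assumes m: "tensor_model Y X Z q" and k: "bimodule_iso k X' X"
  shows "tensor_model Y X' Z (q \<cdot> (\<^bold>1 (bcar Y) \<star> k))"
  by (rule tensor_model_iso_cong[OF m bimodule_iso_id[OF tensor_modelD(1)[OF m]] k])

end

section \<open>Computing in the equivariant completion\<close>

abbreviation bmap where "bmap T Z k \<equiv> \<lparr>mdom = T, mcod = Z, mfun = k\<rparr>"

context bicategory
begin

abbreviation EQ where "EQ \<equiv> eq_completion B"

lemma eq_completion_simps [simp]:
  "Mor1 EQ = eq_mor1 B" "src1 EQ = bsrc" "trg1 EQ = btrg"
  "Mor2 EQ = {F. mdom F \<in> eq_mor1 B \<and> mcod F \<in> eq_mor1 B \<and> bimodule_map B F}"
  "dom2 EQ = mdom" "cod2 EQ = mcod"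
  "id2 EQ X = bmap X X (\<^bold>1 (bcar X))"
  "comp2 EQ G F = bmap (mdom F) (mcod G) (mfun G \<cdot> mfun F)"
  "unit1 EQ = regular_bimod" "tens1 EQ = rel_tens B" "tens2 EQ = rel_tens_map B"
  "assoc EQ = rel_assoc B" "lun EQ = rel_lun B" "run EQ = rel_run B"
  by (simp_all add: eq_completion_def)

lemma bimodule_iso_mor2:
  assumes k: "bimodule_iso k T Z"
  shows "bmap T Z k \<in> Mor2 EQ"
  using bimodule_isoD[OF k] by (simp add: bimodule_map_def hom2_def)

lemma inverse2_completion:
  assumes k: "bimodule_iso k T Z"
  shows "inverse2 EQ (bmap T Z k) (bmap Z T (inv2 B k))"
  unfolding inverse2_def hom2_def
  using bimodule_iso_mor2[OF k] bimodule_iso_mor2[OF bimodule_iso_inv[OF k]] bimodule_isoD[OF k]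
  by simp

text \<open>Inverses in the completion have inverses of the underlying 2-morphisms as their underlying 2-morphisms,
  and those are unique.\<close>

lemma inv2_completion:
  assumes k: "bimodule_iso k T Z"
  shows "inv2 EQ (bmap T Z k) = bmap Z T (inv2 B k)"
  unfolding inv2_def[of EQ]
proof (rule the_equality)
  show "inverse2 EQ (bmap T Z k) (bmap Z T (inv2 B k))" by (rule inverse2_completion[OF k])
  fix G assume G: "inverse2 EQ (bmap T Z k) G"
  note d = bimodule_isoD[OF k]
  have g: "mdom G = Z" "mcod G = T" "mfun G \<in> Arr" "Dom (mfun G) = bcar Z" "Cod (mfun G) = bcar T"
    "mfun G \<cdot> k = \<^bold>1 (bcar T)" "k \<cdot> mfun G = \<^bold>1 (bcar Z)"
    using G by (auto simp: inverse2_def hom2_def bimodule_map_def Let_def)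
  have "inverse2 B k (mfun G)" using g d by (intro inverse2I) simp_all
  then have "mfun G = inv2 B k" by (simp add: inv2_eqI)
  then show "G = bmap Z T (inv2 B k)" using g by (cases G) simp
qed

lemma bimodule_iso_comp:
  assumes k: "bimodule_iso k T Z" and l: "bimodule_iso l Z W"
  shows "bimodule_iso (l \<cdot> k) T W"
proof -
  note kd [simp] = bimodule_isoD(1-8)[OF k] and ld [simp] = bimodule_isoD(2-8)[OF l]
  note [simp] = eq_mor1D(3-11)[OF kd(1)] eq_mor1D[OF kd(2)] eq_mor1D(3-11)[OF ld(1)]
  have "(l \<cdot> k) \<cdot> lact T = l \<cdot> lact Z \<cdot> (\<^bold>1 (talg Z) \<star> k)"
    using bimodule_isoD(9)[OF k] by simp
  also have "\<dots> = (lact W \<cdot> (\<^bold>1 (talg W) \<star> l)) \<cdot> (\<^bold>1 (talg Z) \<star> k)"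
    by (rule reassoc[OF bimodule_isoD(9)[OF l]]) simp_all
  also have "\<dots> = lact W \<cdot> (\<^bold>1 (talg W) \<star> (l \<cdot> k))" by (simp add: whiskerL)
  finally have 1: "(l \<cdot> k) \<cdot> lact T = lact W \<cdot> (\<^bold>1 (talg W) \<star> (l \<cdot> k))" .
  have "(l \<cdot> k) \<cdot> ract T = l \<cdot> ract Z \<cdot> (k \<star> \<^bold>1 (salg Z))"
    using bimodule_isoD(10)[OF k] by simp
  also have "\<dots> = (ract W \<cdot> (l \<star> \<^bold>1 (salg W))) \<cdot> (k \<star> \<^bold>1 (salg Z))"
    by (rule reassoc[OF bimodule_isoD(10)[OF l]]) simp_all
  also have "\<dots> = ract W \<cdot> ((l \<cdot> k) \<star> \<^bold>1 (salg W))" by (simp add: whiskerR)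
  finally have 2: "(l \<cdot> k) \<cdot> ract T = ract W \<cdot> ((l \<cdot> k) \<star> \<^bold>1 (salg W))" .
  show ?thesis unfolding bimodule_iso_def using 1 2 by simp
qed

text \<open>The isomorphism from the chosen relative tensor product to a model with projection \<open>q\<close>. When one factor
  is regular and \<open>q\<close> is the action of the algebra on the other, it is the unitor of the completion.\<close>

definition comparison :: "('o, 'm, 'c) bimod \<Rightarrow> ('o, 'm, 'c) bimod \<Rightarrow> 'c \<Rightarrow> 'c" where
  "comparison Y X q = factor2 B (tens_proj B Y X) q"

lemma comparison_iso: "tensor_model Y X Z q \<Longrightarrow> bimodule_iso (comparison Y X q) (rel_tens B Y X) Z"
  unfolding comparison_def by (rule tensor_model_iso)

lemma comparison_proj: "tensor_model Y X Z q \<Longrightarrow> comparison Y X q \<cdot> tens_proj B Y X = q"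
  unfolding comparison_def by (rule tensor_model_iso)

text \<open>If \<open>g \<star> f\<close> is compatible with the projections to a common model, then the induced map of relative tensor
  products is the quotient of the two comparison isomorphisms. The same holds for the associator,
  in \<open>rel_assoc_model\<close>, when both ways of forming the threefold product have \<open>T\<close> as a model.\<close>

lemma rel_tens_map_model:
  assumes m: "tensor_model Y X Z q" and m': "tensor_model Y' X' Z q'"
    and g: "g \<in> Arr" "Dom g = bcar Y" "Cod g = bcar Y'"
    and f: "f \<in> Arr" "Dom f = bcar X" "Cod f = bcar X'"
    and e: "q' \<cdot> (g \<star> f) = q"
  shows "rel_tens_map B (bmap Y Y' g) (bmap X X' f) =
    bmap (rel_tens B Y X) (rel_tens B Y' X') (inv2 B (comparison Y' X' q') \<cdot> comparison Y X q)"
proof -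
  let ?p = "tens_proj B Y X" and ?p' = "tens_proj B Y' X'"
  let ?k = "comparison Y X q" and ?k' = "comparison Y' X' q'"
  note [simp] = tensor_model_iso(3-5)[OF m] tensor_model_iso(3-5)[OF m'] g f
    bimodule_isoD(5-8)[OF comparison_iso[OF m]] bimodule_isoD(5-8)[OF comparison_iso[OF m']]
    tensor_model_proj[OF m] tensor_model_proj[OF m']
  note [simp] = eq_mor1D(3-5)[OF tensor_modelD(1)[OF m]] eq_mor1D(3-5)[OF tensor_modelD(2)[OF m]]
      tensor_modelD(4)[OF m]
  obtain s where s [simp]: "s \<in> Arr" "Dom s = bcar (rel_tens B Y X)" "Cod s = bcar Y \<otimes> bcar X"
    and ps: "?p \<cdot> s = \<^bold>1 (bcar (rel_tens B Y X))"
    using tensor_model_iso(6)[OF m] by blast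
  have "factor2 B ?p (?p' \<cdot> (g \<star> f)) = inv2 B ?k' \<cdot> ?k"
  proof (rule factor2_eqI[where s = s])
    have "(inv2 B ?k' \<cdot> ?k) \<cdot> ?p = inv2 B ?k' \<cdot> q' \<cdot> (g \<star> f)"
      by (simp add: comparison_proj[OF m] e)
    also have "\<dots> = inv2 B ?k' \<cdot> (?k' \<cdot> ?p') \<cdot> (g \<star> f)"
      by (simp only: comparison_proj[OF m'])
    finally show "(inv2 B ?k' \<cdot> ?k) \<cdot> ?p = ?p' \<cdot> (g \<star> f)" by simp
  qed (simp_all add: ps)
  then show ?thesis by (simp add: rel_tens_map_def)
qed

lemma rel_tens_map_id:
  assumes m: "tensor_model Y X Z q"
  shows "rel_tens_map B (bmap Y Y (\<^bold>1 (bcar Y))) (bmap X X (\<^bold>1 (bcar X))) =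
    bmap (rel_tens B Y X) (rel_tens B Y X) (\<^bold>1 (bcar (rel_tens B Y X)))"
proof -
  note [simp] = eq_mor1D(3-5)[OF tensor_modelD(1)[OF m]] eq_mor1D(3-5)[OF tensor_modelD(2)[OF m]]
      tensor_modelD(4)[OF m]
    tensor_model_proj[OF m] bimodule_isoD(5-8)[OF comparison_iso[OF m]]
  show ?thesis by (subst rel_tens_map_model[OF m m]) simp_all
qed

lemma rel_assoc_model:
  assumes zy: "tensor_model Z Y V q" and vx: "tensor_model V X T p"
    and yx: "tensor_model Y X W q'" and zw: "tensor_model Z W T p'"
    and e: "p \<cdot> (q \<star> \<^bold>1 (bcar X)) = p' \<cdot> (\<^bold>1 (bcar Z) \<star> q') \<cdot> \<alpha> (bcar Z) (bcar Y) (bcar X)"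
  defines "l \<equiv> comparison (rel_tens B Z Y) X (p \<cdot> (comparison Z Y q \<star> \<^bold>1 (bcar X)))"
    and "r \<equiv> comparison Z (rel_tens B Y X) (p' \<cdot> (\<^bold>1 (bcar Z) \<star> comparison Y X q'))"
  shows "rel_assoc B Z Y X =
    bmap (rel_tens B (rel_tens B Z Y) X) (rel_tens B Z (rel_tens B Y X)) (inv2 B r \<cdot> l)"
proof -
  let ?ZY = "rel_tens B Z Y" and ?YX = "rel_tens B Y X"
  let ?x = "bcar X" and ?y = "bcar Y" and ?z = "bcar Z"
  let ?k = "comparison Z Y q" and ?k' = "comparison Y X q'"
  note kzy = comparison_iso[OF zy] and kyx = comparison_iso[OF yx]
  note ml = tensor_model_iso_left[OF vx kzy] and mr = tensor_model_iso_right[OF zw kyx]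
  note kl = comparison_iso[OF ml, folded l_def] and kr = comparison_iso[OF mr, folded r_def]
  note pl = comparison_proj[OF ml, folded l_def] and pr = comparison_proj[OF mr, folded r_def]
  note [simp] = tensor_model_iso(3-5)[OF zy] tensor_model_iso(3-5)[OF yx]
    tensor_model_iso(3-5)[OF ml] tensor_model_iso(3-5)[OF mr]
    bimodule_isoD(3-8)[OF kzy] bimodule_isoD(3-8)[OF kyx] bimodule_isoD(5-8)[OF kl]
        bimodule_isoD(5-8)[OF kr]
    tensor_model_proj[OF zy] tensor_model_proj[OF yx] tensor_model_proj[OF vx] tensor_model_proj[OF zw]
    tensor_modelD(4-6,8)[OF zy] tensor_modelD(4-6,8)[OF yx] tensor_modelD(8)[OF vx]
        tensor_modelD(8)[OF zw]
  note [simp] = eq_mor1D(3-5)[OF tensor_modelD(1)[OF zy]] eq_mor1D(3-5)[OF tensor_modelD(1)[OF yx]]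
    eq_mor1D(3-5)[OF tensor_modelD(2)[OF yx]] eq_mor1D(3-5)[OF tensor_modelD(1)[OF vx]]
    eq_mor1D(3-5)[OF tensor_modelD(2)[OF zw]]
    eq_mor1D(3-5)[OF bimodule_isoD(1)[OF kzy]] eq_mor1D(3-5)[OF bimodule_isoD(1)[OF kyx]]
  let ?pzy = "tens_proj B Z Y" and ?pyx = "tens_proj B Y X"
  let ?pl = "tens_proj B ?ZY X" and ?pr = "tens_proj B Z ?YX"
  let ?a = "\<alpha> ?z ?y ?x"
  obtain s where s [simp]: "s \<in> Arr" "Dom s = bcar ?ZY" "Cod s = ?z \<otimes> ?y"
    and ps: "?pzy \<cdot> s = \<^bold>1 (bcar ?ZY)"
    using tensor_model_iso(6)[OF zy] by blast
  obtain t where t [simp]: "t \<in> Arr" "Dom t = bcar (rel_tens B ?ZY X)" "Cod t = bcar ?ZY \<otimes> ?x"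
    and pt: "?pl \<cdot> t = \<^bold>1 (bcar (rel_tens B ?ZY X))"
    using tensor_model_iso(6)[OF ml] by blast
  have sec: "?pl \<cdot> (?pzy \<star> \<^bold>1 ?x) \<cdot> (s \<star> \<^bold>1 ?x) \<cdot> t = \<^bold>1 (bcar (rel_tens B ?ZY X))"
  proof -
    have "(?pzy \<star> \<^bold>1 ?x) \<cdot> (s \<star> \<^bold>1 ?x) = \<^bold>1 (bcar ?ZY \<otimes> ?x)"
      by (subst whiskerR[symmetric]) (simp_all add: ps)
    from reassoc[OF this, of t] show ?thesis by (simp add: pt)
  qed
  have "(inv2 B r \<cdot> l) \<cdot> ?pl \<cdot> (?pzy \<star> \<^bold>1 ?x) = inv2 B r \<cdot> (l \<cdot> ?pl) \<cdot> (?pzy \<star> \<^bold>1 ?x)"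
    by simp
  also have "\<dots> = inv2 B r \<cdot> p \<cdot> ((?k \<cdot> ?pzy) \<star> \<^bold>1 ?x)"
    by (simp add: pl whiskerR)
  also have "\<dots> = inv2 B r \<cdot> p' \<cdot> (\<^bold>1 ?z \<star> (?k' \<cdot> ?pyx)) \<cdot> ?a"
    by (simp only: comparison_proj[OF zy] comparison_proj[OF yx] e)
  also have "\<dots> = inv2 B r \<cdot> (p' \<cdot> (\<^bold>1 ?z \<star> ?k')) \<cdot> (\<^bold>1 ?z \<star> ?pyx) \<cdot> ?a"
    by (simp add: whiskerL)
  also have "\<dots> = inv2 B r \<cdot> (r \<cdot> ?pr) \<cdot> (\<^bold>1 ?z \<star> ?pyx) \<cdot> ?a"
    by (simp only: pr)
  also have "\<dots> = ?pr \<cdot> (\<^bold>1 ?z \<star> ?pyx) \<cdot> ?a" by simp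
  finally have "factor2 B (?pl \<cdot> (?pzy \<star> \<^bold>1 ?x)) (?pr \<cdot> (\<^bold>1 ?z \<star> ?pyx) \<cdot> ?a) = inv2 B r \<cdot> l"
    by (intro factor2_eqI[where s = "(s \<star> \<^bold>1 ?x) \<cdot> t"]) (simp_all add: sec)
  then show ?thesis by (simp add: rel_assoc_def)
qed

lemma inv2_comp:
  assumes [simp]: "invertible2 B f" "invertible2 B g" "Dom g = Cod f"
  shows "inv2 B (g \<cdot> f) = inv2 B f \<cdot> inv2 B g"
proof (rule inv2_eqI)
  have [simp]: "f \<in> Arr" "g \<in> Arr" by (auto intro: invertible2_mor2)
  show "inverse2 B (g \<cdot> f) (inv2 B f \<cdot> inv2 B g)" by (rule inverse2I) auto
qed

lemma inv2_inv2 [simp]: "invertible2 B f \<Longrightarrow> inv2 B (inv2 B f) = f"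
  using invertible2_mor2[of f] by (intro inv2_eqI inverse2I) auto

lemma unit_alg_eq_obj:
  assumes c [simp]: "c \<in> Obj B"
  shows "(c, unit_alg B c) \<in> eq_obj B"
proof -
  let ?I = "\<I> c" and ?U = "Unit c"
  note m = rep_lun[of ?U c, simplified] and i = rep_id[of ?U, simplified]
    and n = rep_lun_inv[of ?U c, simplified]
  have "\<l> ?I \<cdot> (\<l> ?I \<star> \<^bold>1 ?I) = \<l> ?I \<cdot> (\<^bold>1 ?I \<star> \<l> ?I) \<cdot> \<alpha> ?I ?I ?I"
    by (rule rep_equal[OF rep_comp[OF rep_tens[OF m i] m]
          rep_comp[OF rep_comp[OF rep_assoc[of ?U ?U ?U] rep_tens[OF i m]] m]]) simp_all
  then have "algebra B c (unit_alg B c)"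
    using lun_run_unit[of c]
    by (simp add: algebra_def unit_alg_def Let_def hom1_def hom2_def)
  moreover have "\<alpha> ?I ?I ?I \<cdot> (inv2 B (\<l> ?I) \<star> \<^bold>1 ?I) \<cdot> inv2 B (\<l> ?I) = (\<^bold>1 ?I \<star> inv2 B (\<l> ?I)) \<cdot>
      inv2 B (\<l> ?I)"
    by (rule rep_equal[OF rep_comp[OF rep_comp[OF n rep_tens[OF n i]]
          rep_assoc[of ?U ?U ?U]] rep_comp[OF n rep_tens[OF i n]]]) simp_all
  then have "coalgebra B c (unit_alg B c)"
    using lun_run_unit[of c, symmetric]
    by (simp add: coalgebra_def unit_alg_def Let_def hom1_def hom2_def)
  moreover have "(\<^bold>1 ?I \<star> \<l> ?I) \<cdot> \<alpha> ?I ?I ?I \<cdot> (inv2 B (\<l> ?I) \<star> \<^bold>1 ?I) = inv2 B (\<l> ?I) \<cdot> \<l> ?I"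
    by (rule rep_equal[OF rep_comp[OF rep_comp[OF rep_tens[OF n i]
          rep_assoc[of ?U ?U ?U]] rep_tens[OF i m]] rep_comp[OF m n]]) simp_all
  moreover have "inv2 B (\<l> ?I) \<cdot> \<l> ?I = (\<l> ?I \<star> \<^bold>1 ?I) \<cdot> inv2 B (\<alpha> ?I ?I ?I) \<cdot> (\<^bold>1 ?I \<star> inv2 B (\<l> ?I))"
    by (rule rep_equal[OF rep_comp[OF m n] rep_comp[OF rep_comp[OF
          rep_tens[OF i n] rep_assoc_inv[of ?U ?U ?U]] rep_tens[OF m i]]]) simp_all
  ultimately show ?thesis
    by (simp add: eq_obj_def frobenius_algebra_def separable_def)
      (simp add: unit_alg_def)
qed

end

section \<open>The adjoint equivalence\<close>

context invertible_dimension
begin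

abbreviation L where "L \<equiv> mod_of B X"
abbreviation R where "R \<equiv> dual_mod_of B X"
abbreviation Ib where "Ib \<equiv> unit_alg B b"

lemma mod_simps [simp]:
  "bsrc L = (a, A)" "btrg L = (b, Ib)" "bcar L = X" "lact L = \<l> X"
  "bsrc R = (b, Ib)" "btrg R = (a, A)" "bcar R = Xd" "ract R = \<r> Xd"
  by (simp_all add: mod_of_def dual_mod_of_def)

lemma unit_alg_simps [simp]:
  "acar Ib = \<I> b" "mult Ib = \<l> (\<I> b)" "munit Ib = \<^bold>1 (\<I> b)"
  by (simp_all add: unit_alg_def)

lemma end_alg_eq_obj: "(a, A) \<in> eq_obj B"
  using frobenius_end_alg separable_end_alg by (simp add: eq_obj_def)

lemma rep_ract: "represents (Atom X \<odot> M) (Atom X) (ract L) (\<lambda>V. E (X \<otimes> V))"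
  by (rule rep_adapt[OF rep_comp[OF rep_comp[OF
        rep_assoc_inv[of "Atom X" "Atom Xd" "Atom X"]
        rep_tens[OF rep_E rep_id[of "Atom X"]]]
        rep_lun[of "Atom X" b]]])
    (simp_all add: mod_of_def)

lemma rep_lact: "represents (M \<odot> Atom Xd) (Atom Xd) (lact R) (\<lambda>V. G (E V))"
  by (rule rep_adapt[OF rep_comp[OF rep_comp[OF
        rep_assoc[of "Atom Xd" "Atom X" "Atom Xd"]
        rep_tens[OF rep_id[of "Atom Xd"] rep_E]]
        rep_run[of "Atom Xd" b]]])
    (simp_all add: dual_mod_of_def)

lemma act_simps_mod [simp]:
  "ract L \<in> Arr" "Dom (ract L) = X \<otimes> (Xd \<otimes> X)" "Cod (ract L) = X"
  "lact R \<in> Arr" "Dom (lact R) = (Xd \<otimes> X) \<otimes> Xd" "Cod (lact R) = Xd"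
  using representsD(3-5)[OF rep_ract] representsD(3-5)[OF rep_lact] by simp_all

lemma E_E:
  assumes "V \<in> Mor1 B" "trg1 B V = b"
  shows "E V \<cdot> F (G (E V)) = E V \<cdot> E (X \<otimes> (Xd \<otimes> V))"
  using E_nat[of "E V" V] assms by simp

lemma mod_eq_mor1: "L \<in> eq_mor1 B"
proof -
  note r = rep_ract and i = rep_id[of "Atom X", simplified] and iM = rep_id[of M, simplified]
    and l = rep_lun[of "Atom X" b, simplified] and u = rep_munit and m = rep_mult
    and iU = rep_id[of "Unit b", simplified] and lU = rep_lun[of "Unit b" b, simplified]
  let ?I = "\<I> b" and ?M = "Xd \<otimes> X"
  have 1: "\<l> X \<cdot> (\<l> ?I \<star> \<^bold>1 X) = \<l> X \<cdot> (\<^bold>1 ?I \<star> \<l> X) \<cdot> \<alpha> ?I ?I X"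
    by (rule rep_equal[OF rep_comp[OF rep_tens[OF lU i] l]
          rep_comp[OF rep_comp[OF rep_assoc[of "Unit b" "Unit b" "Atom X"] rep_tens[OF iU l]] l]])
      simp_all
  have 2: "ract L \<cdot> (ract L \<star> \<^bold>1 ?M) = ract L \<cdot> F (mult A) \<cdot> \<alpha> X ?M ?M"
    by (rule rep_equal[OF rep_comp[OF rep_tens[OF r iM] r]
          rep_comp[OF rep_comp[OF rep_assoc[of "Atom X" M M] rep_tens[OF i m]] r]])
      (simp_all add: E_E)
  have 3: "ract L \<cdot> F (munit A) = \<r> X"
    by (rule rep_equal[OF rep_comp[OF rep_tens[OF i u] r] rep_run[of "Atom X" a]])
      (simp_all add: E_XN)
  have 4: "ract L \<cdot> (\<l> X \<star> \<^bold>1 ?M) = \<l> X \<cdot> (\<^bold>1 ?I \<star> ract L) \<cdot> \<alpha> ?I X ?M"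
    by (rule rep_equal[OF rep_comp[OF rep_tens[OF l iM] r]
          rep_comp[OF rep_comp[OF rep_assoc[of "Unit b" "Atom X" M] rep_tens[OF iU r]] l]])
      simp_all
  show ?thesis
    unfolding eq_mor1_def bimodule_def left_module_def right_module_def Let_def hom1_def hom2_def
    using 1 2 3 4 end_alg_eq_obj unit_alg_eq_obj[of b] by simp
qed

lemma dual_mod_eq_mor1: "R \<in> eq_mor1 B"
proof -
  note l = rep_lact and i = rep_id[of "Atom Xd", simplified] and iM = rep_id[of M, simplified]
    and r = rep_run[of "Atom Xd" b, simplified] and u = rep_munit and m = rep_mult
    and iU = rep_id[of "Unit b", simplified] and lU = rep_lun[of "Unit b" b, simplified]
  let ?I = "\<I> b" and ?M = "Xd \<otimes> X"
  have 1: "lact R \<cdot> (mult A \<star> \<^bold>1 Xd) = lact R \<cdot> (\<^bold>1 ?M \<star> lact R) \<cdot> \<alpha> ?M ?M Xd"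
    by (rule rep_equal[OF rep_comp[OF rep_tens[OF m i] l]
          rep_comp[OF rep_comp[OF rep_assoc[of M M "Atom Xd"] rep_tens[OF iM l]] l]])
      (simp_all add: whiskerL[symmetric] E_E)
  have 2: "lact R \<cdot> (munit A \<star> \<^bold>1 Xd) = \<l> Xd"
    by (rule rep_equal[OF rep_comp[OF rep_tens[OF u i] l] rep_lun[of "Atom Xd" a]])
      (simp_all add: XdE_N)
  have 3: "\<r> Xd \<cdot> (\<r> Xd \<star> \<^bold>1 ?I) = \<r> Xd \<cdot> G (\<l> ?I) \<cdot> \<alpha> Xd ?I ?I"
    by (rule rep_equal[OF rep_comp[OF rep_tens[OF r iU] r]
          rep_comp[OF rep_comp[OF rep_assoc[of "Atom Xd" "Unit b" "Unit b"] rep_tens[OF i lU]] r]])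
      simp_all
  have 4: "\<r> Xd \<cdot> (lact R \<star> \<^bold>1 ?I) = lact R \<cdot> (\<^bold>1 ?M \<star> \<r> Xd) \<cdot> \<alpha> ?M Xd ?I"
    by (rule rep_equal[OF rep_comp[OF rep_tens[OF l iU] r]
          rep_comp[OF rep_comp[OF rep_assoc[of M "Atom Xd" "Unit b"] rep_tens[OF iM r]] l]])
      simp_all
  show ?thesis
    unfolding eq_mor1_def bimodule_def left_module_def right_module_def Let_def hom1_def hom2_def
    using 1 2 3 4 end_alg_eq_obj unit_alg_eq_obj[of b] by simp
qed

text \<open>Over the unit algebra the two maps to be coequalised are equal, by the triangle axiom.\<close>

lemma model_RL: "tensor_model R L (regular_bimod (a, A)) (\<^bold>1 (Xd \<otimes> X))"
proof -
  let ?M = "Xd \<otimes> X"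
  note iM = rep_id[of M, simplified] and i = rep_id[of "Atom X", simplified]
    and id' = rep_id[of "Atom Xd", simplified]
  let ?f = "\<r> Xd \<star> \<^bold>1 X" and ?g = "G (\<l> X) \<cdot> \<alpha> Xd (\<I> b) X"
  have fg: "?g = ?f" using triangle'[of X Xd b] by simp
  have 1: "coequaliser B ?f ?g (\<^bold>1 ?M)"
    unfolding fg by (rule split_coequaliser[where s = "\<^bold>1 ?M" and t = "inv2 B ?f"]) simp_all
  have 2: "mult A \<cdot> \<alpha> ?M Xd X = lact R \<star> \<^bold>1 X"
    by (rule rep_equal[OF rep_comp[OF rep_assoc[of M "Atom Xd" "Atom X"] rep_mult]
          rep_tens[OF rep_lact i]]) simp_all
  have 3: "mult A = G (ract L) \<cdot> \<alpha> Xd X ?M"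
    by (rule rep_equal[OF rep_mult
          rep_comp[OF rep_assoc[of "Atom Xd" "Atom X" M] rep_tens[OF id' rep_ract]]]) simp_all
  have 4: "\<exists>s. s \<in> Arr \<and> Dom s = ?M \<and> Cod s = ?M \<and> \<^bold>1 ?M \<cdot> s = \<^bold>1 ?M"
    by (rule exI[of _ "\<^bold>1 ?M"]) simp
  have 5: "regular_bimod (a, A) \<in> eq_mor1 B" using end_alg_eq_obj by (rule regular_bimod_eq_mor1)
  show ?thesis
    unfolding tensor_model_def
    using 1 2 3[symmetric] 4 5 mod_eq_mor1 dual_mod_eq_mor1 by simp
qed

text \<open>Invertibility of the dimension makes the fork split: \<open>s = coev X \<cdot> dim\<^sup>-\<^sup>1\<close> is a section
  of \<open>evt X\<close>, and inserting \<open>s\<close> to the left of \<open>X \<otimes> X\<^sup>\<dagger>\<close> is a contraction \<open>t\<close> of the fork.\<close>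

lemma model_LR: "tensor_model L R (regular_bimod (b, Ib)) (evt B X)"
proof -
  let ?M = "Xd \<otimes> X" and ?I = "\<I> b" and ?W = "Atom X \<odot> Atom Xd"
  note iM = rep_id[of M, simplified] and i = rep_id[of "Atom X", simplified]
    and id' = rep_id[of "Atom Xd", simplified] and iU = rep_id[of "Unit b", simplified]
    and lU = rep_lun[of "Unit b" b, simplified] and iW = rep_id[of ?W, simplified]
    and l = rep_lun[of "Atom X" b, simplified] and r = rep_run[of "Atom Xd" b, simplified]
  let ?f = "ract L \<star> \<^bold>1 Xd" and ?g = "F (lact R) \<cdot> \<alpha> X ?M Xd"
  define s where "s = coev B X \<cdot> inv2 B (dim_r B X)"
  (* s \<otimes> 1 : X \<otimes> X\<^sup>\<dagger> \<Rightarrow> (X \<otimes> X\<^sup>\<dagger>) \<otimes> (X \<otimes> X\<^sup>\<dagger>), rebracketed as X \<otimes> A \<otimes> X\<^sup>\<dagger> *)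
  define t where "t = (\<alpha> X Xd X \<star> \<^bold>1 Xd) \<cdot> inv2 B (\<alpha> (X \<otimes> Xd) X Xd) \<cdot> (s \<star> \<^bold>1 (X \<otimes> Xd)) \<cdot> inv2 B
      (\<l> (X \<otimes> Xd))"
  have f: "represents ((Atom X \<odot> M) \<odot> Atom Xd) ?W ?f (\<lambda>V. E (X \<otimes> (Xd \<otimes> V)))"
    by (rule rep_adapt[OF rep_tens[OF rep_ract id']]) simp_all
  have g: "represents ((Atom X \<odot> M) \<odot> Atom Xd) ?W ?g (\<lambda>V. F (G (E V)))"
    by (rule rep_adapt[OF rep_comp[OF rep_assoc[of "Atom X" M "Atom Xd"]
          rep_tens[OF i rep_lact]]]) simp_all
  have s: "represents (Unit b) ?W s K" unfolding s_def by (rule rep_K)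
  have t: "represents ?W ((Atom X \<odot> M) \<odot> Atom Xd) t (\<lambda>V. K (X \<otimes> (Xd \<otimes> V)))"
    by (rule rep_adapt[OF rep_comp[OF rep_comp[OF rep_comp[OF
          rep_lun_inv[of ?W b] rep_tens[OF s iW]]
          rep_assoc_inv[of ?W "Atom X" "Atom Xd"]]
          rep_tens[OF rep_assoc[of "Atom X" "Atom Xd" "Atom X"] id']]])
      (simp_all add: t_def)
  note sm [simp] = representsD(3-5)[OF s, simplified] and tm [simp] = representsD(3-5)[OF t, simplified]
  have qs: "evt B X \<cdot> s = \<^bold>1 ?I"
    by (rule rep_equal[OF rep_comp[OF s rep_E] iU]) (simp_all add: E_K)
  have "coequaliser B ?f ?g (evt B X)"
  proof (rule split_coequaliser[where s = s and t = t])
    show "evt B X \<cdot> ?f = evt B X \<cdot> ?g"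
      by (rule rep_equal[OF rep_comp[OF f rep_E] rep_comp[OF g rep_E]])
        (simp_all add: E_E)
    have "?f \<cdot> t = \<^bold>1 (X \<otimes> Xd)"
      by (rule rep_equal[OF rep_comp[OF t f] iW]) (simp_all add: E_K)
    moreover have "?g \<cdot> t = s \<cdot> evt B X"
      by (rule rep_equal[OF rep_comp[OF t g] rep_comp[OF rep_E s]])
        (simp_all add: K_nat)
    ultimately show "(?f \<cdot> t = \<^bold>1 (Cod ?f) \<and> ?g \<cdot> t = s \<cdot> evt B X) \<or>
      (?g \<cdot> t = \<^bold>1 (Cod ?f) \<and> ?f \<cdot> t = s \<cdot> evt B X)" by simp
  qed (simp_all add: qs)
  moreover have "\<l> ?I \<cdot> (\<^bold>1 ?I \<star> evt B X) \<cdot> \<alpha> ?I X Xd = evt B X \<cdot> (\<l> X \<star> \<^bold>1 Xd)"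
    by (rule rep_equal[OF rep_comp[OF rep_comp[OF rep_assoc[of "Unit b" "Atom X" "Atom Xd"]
            rep_tens[OF iU rep_E]] lU] rep_comp[OF rep_tens[OF l id'] rep_E]])
      simp_all
  moreover have "\<l> ?I \<cdot> (evt B X \<star> \<^bold>1 ?I) = evt B X \<cdot> F (\<r> Xd) \<cdot> \<alpha> X Xd ?I"
    by (rule rep_equal[OF rep_comp[OF rep_tens[OF rep_E iU] lU]
          rep_comp[OF rep_comp[OF rep_assoc[of "Atom X" "Atom Xd" "Unit b"]
            rep_tens[OF i r]] rep_E]])
      simp_all
  moreover have "\<exists>s. s \<in> Arr \<and> Dom s = ?I \<and> Cod s = X \<otimes> Xd \<and> evt B X \<cdot> s = \<^bold>1 ?I"
    by (rule exI[of _ s]) (simp add: qs)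
  moreover have "regular_bimod (b, Ib) \<in> eq_mor1 B"
    using unit_alg_eq_obj[of b] by (intro regular_bimod_eq_mor1) simp
  ultimately show ?thesis
    unfolding tensor_model_def using mod_eq_mor1 dual_mod_eq_mor1 by simp
qed

text \<open>The unit is the inverse of the comparison with \<open>A\<close>, the counit is the comparison with \<open>I\<close>. In the first
  triangle identity the composites pass through four products with \<open>X\<close> as a model, with comparisons
  \<open>k1, \<dots>, k4\<close>; in the second the model is \<open>X\<^sup>\<dagger>\<close> and the comparisons are \<open>m1, \<dots>, m4\<close>.\<close>

lemma mod_adjoint_equivalence: "adjoint_equivalence EQ (a, A) (b, Ib) L R"
proof -
  let ?Ar = "regular_bimod (a, A)" and ?Ir = "regular_bimod (b, Ib)"
  let ?P = "rel_tens B R L" and ?Q = "rel_tens B L R" and ?T = "rel_tens B"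
  define p where "p = comparison R L (\<^bold>1 (Xd \<otimes> X))"
  define q where "q = comparison L R (evt B X)"
  have p: "bimodule_iso p ?P ?Ar" unfolding p_def by (rule comparison_iso[OF model_RL])
  have q: "bimodule_iso q ?Q ?Ir" unfolding q_def by (rule comparison_iso[OF model_LR])
  let ?\<eta> = "bmap ?Ar ?P (inv2 B p)" and ?\<epsilon> = "bmap ?Q ?Ir q"
  note p' = bimodule_iso_inv[OF p]
  note [simp] = mod_eq_mor1 dual_mod_eq_mor1
  note [simp] = bimodule_isoD(3-8)[OF p, simplified] bimodule_isoD(3-8)[OF q, simplified]
  note [simp] = bimodule_isoD(1)[OF p] bimodule_isoD(1)[OF q]

  (* the eight products in the triangle identities: four modelled by X and four by X\<^sup>\<dagger> *)
  have mLA: "tensor_model L ?Ar L (ract L)" using tensor_model_unit_right[OF mod_eq_mor1] by simp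
  have mIL: "tensor_model ?Ir L L (\<l> X)" using tensor_model_unit_left[OF mod_eq_mor1] by simp
  have mAR: "tensor_model ?Ar R R (lact R)" using tensor_model_unit_left[OF dual_mod_eq_mor1] by simp
  have mRI: "tensor_model R ?Ir R (\<r> Xd)" using tensor_model_unit_right[OF dual_mod_eq_mor1] by simp
  have mLP: "tensor_model L ?P L (ract L \<cdot> F p)" using tensor_model_iso_right[OF mLA p] by simp
  have mQL: "tensor_model ?Q L L (\<l> X \<cdot> (q \<star> \<^bold>1 X))" using tensor_model_iso_left[OF mIL q] by simp
  have mPR: "tensor_model ?P R R (lact R \<cdot> (p \<star> \<^bold>1 Xd))" using tensor_model_iso_left[OF mAR p] by simp
  have mRQ: "tensor_model R ?Q R (\<r> Xd \<cdot> G q)" using tensor_model_iso_right[OF mRI q] by simp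

  define k1 where "k1 = comparison L ?Ar (ract L)"
  define k2 where "k2 = comparison L ?P (ract L \<cdot> F p)"
  define k3 where "k3 = comparison ?Q L (\<l> X \<cdot> (q \<star> \<^bold>1 X))"
  define k4 where "k4 = comparison ?Ir L (\<l> X)"
  define m1 where "m1 = comparison ?Ar R (lact R)"
  define m2 where "m2 = comparison ?P R (lact R \<cdot> (p \<star> \<^bold>1 Xd))"
  define m3 where "m3 = comparison R ?Q (\<r> Xd \<cdot> G q)"
  define m4 where "m4 = comparison R ?Ir (\<r> Xd)"
  have k1: "bimodule_iso k1 (?T L ?Ar) L" unfolding k1_def by (rule comparison_iso[OF mLA])
  have k2: "bimodule_iso k2 (?T L ?P) L" unfolding k2_def by (rule comparison_iso[OF mLP])
  have k3: "bimodule_iso k3 (?T ?Q L) L" unfolding k3_def by (rule comparison_iso[OF mQL])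
  have k4: "bimodule_iso k4 (?T ?Ir L) L" unfolding k4_def by (rule comparison_iso[OF mIL])
  have m1: "bimodule_iso m1 (?T ?Ar R) R" unfolding m1_def by (rule comparison_iso[OF mAR])
  have m2: "bimodule_iso m2 (?T ?P R) R" unfolding m2_def by (rule comparison_iso[OF mPR])
  have m3: "bimodule_iso m3 (?T R ?Q) R" unfolding m3_def by (rule comparison_iso[OF mRQ])
  have m4: "bimodule_iso m4 (?T R ?Ir) R" unfolding m4_def by (rule comparison_iso[OF mRI])
  note [simp] = bimodule_isoD(5-8)[OF k1, simplified] bimodule_isoD(5-8)[OF k2, simplified]
    bimodule_isoD(5-8)[OF k3, simplified] bimodule_isoD(5-8)[OF k4, simplified]
    bimodule_isoD(5-8)[OF m1, simplified] bimodule_isoD(5-8)[OF m2, simplified]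
    bimodule_isoD(5-8)[OF m3, simplified] bimodule_isoD(5-8)[OF m4, simplified]

  have runL: "rel_run B L = bmap (?T L ?Ar) L k1"
    by (simp add: rel_run_def k1_def comparison_def)
  have lunL: "rel_lun B L = bmap (?T ?Ir L) L k4"
    by (simp add: rel_lun_def k4_def comparison_def)
  have lunR: "rel_lun B R = bmap (?T ?Ar R) R m1"
    by (simp add: rel_lun_def m1_def comparison_def)
  have runR: "rel_run B R = bmap (?T R ?Ir) R m4"
    by (simp add: rel_run_def m4_def comparison_def)
  have L\<eta>: "rel_tens_map B (bmap L L (\<^bold>1 X)) ?\<eta> = bmap (?T L ?Ar) (?T L ?P) (inv2 B k2 \<cdot> k1)"
    unfolding k1_def k2_def
    by (rule rel_tens_map_model[OF mLA mLP]) (simp_all add: whiskerL[symmetric])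
  have \<epsilon>L: "rel_tens_map B ?\<epsilon> (bmap L L (\<^bold>1 X)) = bmap (?T ?Q L) (?T ?Ir L) (inv2 B k4 \<cdot> k3)"
    unfolding k3_def k4_def by (rule rel_tens_map_model[OF mQL mIL]) simp_all
  have \<eta>R: "rel_tens_map B ?\<eta> (bmap R R (\<^bold>1 Xd)) = bmap (?T ?Ar R) (?T ?P R) (inv2 B m2 \<cdot> m1)"
    unfolding m1_def m2_def
    by (rule rel_tens_map_model[OF mAR mPR]) (simp_all add: whiskerR[symmetric])
  have R\<epsilon>: "rel_tens_map B (bmap R R (\<^bold>1 Xd)) ?\<epsilon> = bmap (?T R ?Q) (?T R ?Ir) (inv2 B m4 \<cdot> m3)"
    unfolding m3_def m4_def by (rule rel_tens_map_model[OF mRQ mRI]) simp_all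
  have aL: "rel_assoc B L R L = bmap (?T ?Q L) (?T L ?P) (inv2 B k2 \<cdot> k3)"
  proof -
    have "\<l> X \<cdot> (evt B X \<star> \<^bold>1 X) = ract L \<cdot> \<alpha> X Xd X" by (simp add: mod_of_def)
    then show ?thesis
      using rel_assoc_model[OF model_LR mIL model_RL mLA] by (simp add: p_def q_def k2_def k3_def)
  qed
  have aR: "rel_assoc B R L R = bmap (?T ?P R) (?T R ?Q) (inv2 B m3 \<cdot> m2)"
  proof -
    have "lact R = \<r> Xd \<cdot> G (evt B X) \<cdot> \<alpha> Xd X Xd" by (simp add: dual_mod_of_def)
    then show ?thesis
      using rel_assoc_model[OF model_RL mAR model_LR mRI] by (simp add: p_def q_def m2_def m3_def)
  qed
  have aL': "bimodule_iso (inv2 B k2 \<cdot> k3) (?T ?Q L) (?T L ?P)"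
    by (rule bimodule_iso_comp[OF k3 bimodule_iso_inv[OF k2]])
  have iRL: "rel_tens_map B (bmap R R (\<^bold>1 Xd)) (bmap L L (\<^bold>1 X)) = bmap ?P ?P (\<^bold>1 (bcar ?P))"
    using rel_tens_map_id[OF model_RL] by simp
  have iLP: "rel_tens_map B (bmap L L (\<^bold>1 X)) (bmap ?P ?P (\<^bold>1 (bcar ?P))) = bmap (?T L ?P) (?T L
      ?P) (\<^bold>1 (bcar (?T L ?P)))"
    using rel_tens_map_id[OF mLP] by simp
  have iPR: "rel_tens_map B (bmap ?P ?P (\<^bold>1 (bcar ?P))) (bmap R R (\<^bold>1 Xd)) = bmap (?T ?P R) (?T ?P
      R) (\<^bold>1 (bcar (?T ?P R)))"
    using rel_tens_map_id[OF mPR] by simp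

  have "adjunction EQ (a, A) (b, Ib) L R ?\<eta> ?\<epsilon>"
    unfolding adjunction_def
  proof (intro conjI)
    show "L \<in> hom1 EQ (a, A) (b, Ib)" "R \<in> hom1 EQ (b, Ib) (a, A)" by (simp_all add: hom1_def)
    show "?\<eta> \<in> hom2 EQ (unit1 EQ (a, A)) (tens1 EQ R L)"
      using bimodule_iso_mor2[OF p'] by (simp add: hom2_def)
    show "?\<epsilon> \<in> hom2 EQ (tens1 EQ L R) (unit1 EQ (b, Ib))"
      using bimodule_iso_mor2[OF q] by (simp add: hom2_def)
    show "zigR EQ L L ?\<eta> (id2 EQ R) ?\<epsilon> = id2 EQ L"
      by (simp add: zigR_def runL lunL L\<eta> \<epsilon>L aL iRL iLP inv2_completion[OF k1] inv2_completion[OF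
          aL'] inv2_comp)
    show "zigL EQ R R ?\<eta> (id2 EQ L) ?\<epsilon> = id2 EQ R"
      by (simp add: zigL_def runR lunR R\<epsilon> \<eta>R aR iRL iPR inv2_completion[OF m1])
  qed
  moreover have "invertible2 EQ ?\<eta>" "invertible2 EQ ?\<epsilon>"
    using inverse2_completion[OF p'] inverse2_completion[OF q] unfolding invertible2_def by blast+
  ultimately show ?thesis unfolding adjoint_equivalence_def by blast
qed

end

theorem theorem4p8:
  fixes B :: "('o, 'm, 'c) pivotal_bicat" and X :: 'm and a b :: 'o
  assumes "pivotal_bicategory B"
    and "idempotent_complete B"
    and "X \<in> hom1 B a b"
    and "invertible2 B (dim_r B X)"
  shows "frobenius_algebra B a (end_alg B X) \<and>
         separable B (end_alg B X) \<and>
         symmetric B (end_alg B X) \<and>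
         adjoint_equivalence (eq_completion B)
           (a, end_alg B X) (b, unit_alg B b) (mod_of B X) (dual_mod_of B X)"
proof -
  interpret pivotal_bicategory B by fact
  interpret invertible_dimension B X a b
    using assms(3,4) by unfold_locales
  show ?thesis
    using frobenius_end_alg separable_end_alg symmetric_end_alg mod_adjoint_equivalence by blast
qed

end
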